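(* Let $E$ be a row-finite directed graph with no sources and let $R$ be a commutative ring with identity. Suppose that $E$ satisfies Condition (K). (1) Suppose that $I$ is an ideal in $L_R(E)$. Then $$I= \operatorname{span}_R \{rs_{\lambda}s_{\mu^*}: r\in R,\ \lambda,\mu\in E^*,\ rp_{s(\mu)} \in I\}.$$ (2) Let $\mathcal{H}_E$ be the set of all saturated hereditary subsets of $E^0$, let $\mathcal{L}(R)$ be the set of ideals of $R$ and let $\mathcal{F}$ be the set of all functions $\pi:\mathcal{H}_E \to \mathcal{L}(R)$ such that $$\pi\Big(\bigvee_{H \in \mathcal{A}}H\Big) = \bigcap_{H \in \mathcal{A}}\pi(H)\quad\text{ for all } \mathcal{A} \subseteq \mathcal{H}_E.$$ Then the map $\Gamma$ from $\mathcal{F}$ to the set $\mathcal{L}(L_R(E))$ of ideals of $L_R(E)$ given by $$\Gamma(\pi) = \operatorname{span}_R\{rs_{\mu}s_{\nu^*} :\text{ there exists }H \in \mathcal{H}_E \text{ such that } r \in \pi(H) \text{ and } s_{\mu}s_{\nu^*} \in I_H\}$$ is a bijection. (3) Let $\pi_1,\pi_2\in\mathcal{F}$. Then $\Gamma(\pi_1) \subseteq \Gamma(\pi_2)$ if and only if $\pi_1(H) \subseteq \pi_2(H)$ for all $H \in \mathcal{H}_E$.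
   Context: Graphs. $E=(E^0,E^1,r,s)$ is a directed graph with vertices $E^0$, edges $E^1$ and range and source maps $r,s:E^1\to E^0$. Write $vE^1=r^{-1}(v)$. $E$ is row-finite if every $vE^1$ is finite, and has no sources if every $vE^1$ is nonempty. Paths are written $\mu=e_1\cdots e_n$ with $s(e_i)=r(e_{i+1})$, with $r(\mu)=r(e_1)$, $s(\mu)=s(e_n)$; vertices are paths of length $0$; $E^*$ is the set of finite paths. $H\subseteq E^0$ is hereditary if $r(e)\in H$ implies $s(e)\in H$ for all $e\in E^1$, and saturated if $s(vE^1)\subseteq H$ implies $v\in H$ for all $v\in E^0$. For $\mathcal{A}\subseteq\mathcal{H}_E$, $\bigvee_{H\in\mathcal{A}}H$ is the smallest saturated hereditary set containing every $H\in\mathcal{A}$. The case $\mathcal{A}=\emptyset$ is included: the empty join is $\emptyset$ and the empty intersection is $R$, so $\pi(\emptyset)=R$. Condition (K): for every $v\in E^0$, either there is no cycle based at $v$, or there are at least two distinct return paths based at $v$. Here a return path based at $v$ is a path $e_1\cdots e_n$, $n\ge1$, with $r(e_1)=v=s(e_n)$ and $s(e_i)\neq v$ for $i<n$. Leavitt path algebra. $L_R(E)$ is the universal $R$-algebra generated by elements $p_v$ ($v\in E^0$), $s_e,s_{e^*}$ ($e\in E^1$) such that: the $p_v$ are mutually orthogonal idempotents; $p_{r(e)}s_e=s_e=s_ep_{s(e)}$ and $p_{s(e)}s_{e^*}=s_{e^*}=s_{e^*}p_{r(e)}$; $s_{e^*}s_f=\delta_{e,f}p_{s(e)}$; and $p_v=\sum_{e\in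 vE^1}s_es_{e^*}$ for all $v$. For $\mu=e_1\cdots e_n$ put $s_\mu=s_{e_1}\cdots s_{e_n}$ and $s_{\mu^*}=s_{e_n^*}\cdots s_{e_1^*}$; for a vertex $v$, $s_v=s_{v^*}=p_v$. For $H\in\mathcal{H}_E$, $I_H$ is the ideal of $L_R(E)$ generated by $\{p_v:v\in H\}$. Ideals are two-sided. *)

theory Defs
  imports "HOL-Algebra.QuotRing" "HOL-Algebra.Module" "Graph_Theory.Digraph"
begin

section \<open>Directed graphs\<close>

text \<open>
  A directed graph is a \<^locale>\<open>wf_digraph\<close>: the vertex set is \<^const>\<open>verts\<close>, the edge
  set is \<^const>\<open>arcs\<close>, the source map \<open>s\<close> is \<^const>\<open>tail\<close> and the range map \<open>r\<close> is
  \<^const>\<open>head\<close>. Hence \<open>vE\<^sup>1\<close>, the inverse image of \<open>v\<close> under \<open>r\<close>, is \<open>in_arcs E v\<close>.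
\<close>

definition row_finite :: "('v, 'e) pre_digraph \<Rightarrow> bool" where
  "row_finite E \<longleftrightarrow> (\<forall>v \<in> verts E. finite (in_arcs E v))"

definition no_sources :: "('v, 'e) pre_digraph \<Rightarrow> bool" where
  "no_sources E \<longleftrightarrow> (\<forall>v \<in> verts E. in_arcs E v \<noteq> {})"

text \<open>
  A finite path is a pair of its range and its list of edges, so that the vertex \<open>v\<close>, as a
  path of length 0, is \<open>(v, [])\<close>. Consecutive edges satisfy \<open>s(e\<^sub>i) = r(e\<^sub>i\<^sub>+\<^sub>1)\<close>.
\<close>

definition fin_paths :: "('v, 'e) pre_digraph \<Rightarrow> ('v \<times> 'e list) set" where
  "fin_paths E = {(v, es). v \<in> verts E \<and> set es \<subseteq> arcs E \<and>
     successively (\<lambda>e f. tail E e = head E f) es \<and> (es \<noteq> [] \<longrightarrow> head E (hd es) = v)}"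

definition path_source :: "('v, 'e) pre_digraph \<Rightarrow> 'v \<times> 'e list \<Rightarrow> 'v" where
  "path_source E \<mu> = (case \<mu> of (v, es) \<Rightarrow> if es = [] then v else tail E (last es))"

definition hereditary :: "('v, 'e) pre_digraph \<Rightarrow> 'v set \<Rightarrow> bool" where
  "hereditary E H \<longleftrightarrow> (\<forall>e \<in> arcs E. head E e \<in> H \<longrightarrow> tail E e \<in> H)"

definition saturated :: "('v, 'e) pre_digraph \<Rightarrow> 'v set \<Rightarrow> bool" where
  "saturated E H \<longleftrightarrow> (\<forall>v \<in> verts E. tail E ` in_arcs E v \<subseteq> H \<longrightarrow> v \<in> H)"

definition sat_hered :: "('v, 'e) pre_digraph \<Rightarrow> 'v set set" where
  "sat_hered E = {H. H \<subseteq> verts E \<and> hereditary E H \<and> saturated E H}"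

text \<open>The smallest saturated hereditary set containing all members of \<open>\<A>\<close>.\<close>

definition sh_join :: "('v, 'e) pre_digraph \<Rightarrow> 'v set set \<Rightarrow> 'v set" where
  "sh_join E \<A> = \<Inter> {K \<in> sat_hered E. \<forall>H \<in> \<A>. H \<subseteq> K}"

definition cycle_at :: "('v, 'e) pre_digraph \<Rightarrow> 'v \<Rightarrow> 'e list \<Rightarrow> bool" where
  "cycle_at E v es \<longleftrightarrow> (v, es) \<in> fin_paths E \<and> es \<noteq> [] \<and> path_source E (v, es) = v"

definition return_path_at :: "('v, 'e) pre_digraph \<Rightarrow> 'v \<Rightarrow> 'e list \<Rightarrow> bool" where
  "return_path_at E v es \<longleftrightarrow>
     (v, es) \<in> fin_paths E \<and> es \<noteq> [] \<and> path_source E (v, es) = v \<and>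
     (\<forall>e \<in> set (butlast es). tail E e \<noteq> v)"

definition condition_K :: "('v, 'e) pre_digraph \<Rightarrow> bool" where
  "condition_K E \<longleftrightarrow> (\<forall>v \<in> verts E.
     (\<nexists>es. cycle_at E v es) \<or>
     (\<exists>\<mu> \<nu>. return_path_at E v \<mu> \<and> return_path_at E v \<nu> \<and> \<mu> \<noteq> \<nu>))"


section \<open>Two-sided ideals and spans in algebras without unit\<close>

text \<open>
  Leavitt path algebras have no unit when the graph has infinitely many vertices, so the
  library's \<^locale>\<open>ideal\<close>, which presupposes a unital ring, does not apply to them. Algebras
  are records of type \<^typ>\<open>('r, 'a) module\<close> whose field \<^const>\<open>one\<close> is never used.
\<close>

definition rng_ideal :: "'a set \<Rightarrow> ('a, 'm) ring_scheme \<Rightarrow> bool" where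
  "rng_ideal I A \<longleftrightarrow> additive_subgroup I A \<and>
     (\<forall>a \<in> I. \<forall>x \<in> carrier A. x \<otimes>\<^bsub>A\<^esub> a \<in> I \<and> a \<otimes>\<^bsub>A\<^esub> x \<in> I)"

definition rng_genideal :: "('a, 'm) ring_scheme \<Rightarrow> 'a set \<Rightarrow> 'a set" where
  "rng_genideal A S = \<Inter> {I. rng_ideal I A \<and> S \<subseteq> I}"

definition span_of ::
    "('r, 'n) ring_scheme \<Rightarrow> ('r, 'a, 'm) module_scheme \<Rightarrow> 'a set \<Rightarrow> 'a set" where
  "span_of R M S = \<Inter> {N. submodule N R M \<and> S \<subseteq> N}"


section \<open>Free algebras\<close>

text \<open>
  The free (non-unital) \<open>R\<close>-algebra on a set \<open>X\<close>: finitely supported \<open>R\<close>-valued functions on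
  the nonempty words over \<open>X\<close>, multiplied by convolution over the ways of cutting a word.
\<close>

definition free_alg ::
    "('r, 'n) ring_scheme \<Rightarrow> 'g set \<Rightarrow> ('r, 'g list \<Rightarrow> 'r) module" where
  "free_alg R X = \<lparr>
     carrier = {f. range f \<subseteq> carrier R \<and> finite {w. f w \<noteq> \<zero>\<^bsub>R\<^esub>} \<and>
                   (\<forall>w. f w \<noteq> \<zero>\<^bsub>R\<^esub> \<longrightarrow> w \<noteq> [] \<and> set w \<subseteq> X)},
     mult = (\<lambda>f g w. \<Oplus>\<^bsub>R\<^esub>i \<in> {0..length w}. f (take i w) \<otimes>\<^bsub>R\<^esub> g (drop i w)),
     one = undefined,
     zero = (\<lambda>w. \<zero>\<^bsub>R\<^esub>),
     add = (\<lambda>f g w. f w \<oplus>\<^bsub>R\<^esub> g w),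
     smult = (\<lambda>r f w. r \<otimes>\<^bsub>R\<^esub> f w)\<rparr>"

definition free_gen :: "('r, 'n) ring_scheme \<Rightarrow> 'g \<Rightarrow> 'g list \<Rightarrow> 'r" where
  "free_gen R x = (\<lambda>w. if w = [x] then \<one>\<^bsub>R\<^esub> else \<zero>\<^bsub>R\<^esub>)"


section \<open>Leavitt path algebras\<close>

text \<open>The formal generators \<open>p\<^sub>v\<close>, \<open>s\<^sub>e\<close> and \<open>s\<^sub>e\<^sub>*\<close>.\<close>

datatype ('v, 'e) lgen = Vertex 'v | Edge 'e | Ghost 'e

definition lgens :: "('v, 'e) pre_digraph \<Rightarrow> ('v, 'e) lgen set" where
  "lgens E = Vertex ` verts E \<union> Edge ` arcs E \<union> Ghost ` arcs E"

definition leavitt_relators ::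
    "('r, 'n) ring_scheme \<Rightarrow> ('v, 'e) pre_digraph \<Rightarrow> (('v, 'e) lgen list \<Rightarrow> 'r) set" where
  "leavitt_relators R E =
     (let F = free_alg R (lgens E);
          p = (\<lambda>v. free_gen R (Vertex v));
          s = (\<lambda>e. free_gen R (Edge e));
          t = (\<lambda>e. free_gen R (Ghost e))
      in {p v \<otimes>\<^bsub>F\<^esub> p v \<ominus>\<^bsub>F\<^esub> p v | v. v \<in> verts E} \<union>
         {p v \<otimes>\<^bsub>F\<^esub> p w | v w. v \<in> verts E \<and> w \<in> verts E \<and> v \<noteq> w} \<union>
         {p (head E e) \<otimes>\<^bsub>F\<^esub> s e \<ominus>\<^bsub>F\<^esub> s e | e. e \<in> arcs E} \<union>
         {s e \<otimes>\<^bsub>F\<^esub> p (tail E e) \<ominus>\<^bsub>F\<^esub> s e | e. e \<in> arcs E} \<union>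
         {p (tail E e) \<otimes>\<^bsub>F\<^esub> t e \<ominus>\<^bsub>F\<^esub> t e | e. e \<in> arcs E} \<union>
         {t e \<otimes>\<^bsub>F\<^esub> p (head E e) \<ominus>\<^bsub>F\<^esub> t e | e. e \<in> arcs E} \<union>
         {t e \<otimes>\<^bsub>F\<^esub> s e \<ominus>\<^bsub>F\<^esub> p (tail E e) | e. e \<in> arcs E} \<union>
         {t e \<otimes>\<^bsub>F\<^esub> s f | e f. e \<in> arcs E \<and> f \<in> arcs E \<and> e \<noteq> f} \<union>
         {p v \<ominus>\<^bsub>F\<^esub> (\<Oplus>\<^bsub>F\<^esub>e \<in> in_arcs E v. s e \<otimes>\<^bsub>F\<^esub> t e) | v. v \<in> verts E})"

text \<open>
  The algebra ideal generated by the relators. Closure under scalars has to be demanded here,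
  as the free algebra has no (local) units.
\<close>

definition leavitt_kernel ::
    "('r, 'n) ring_scheme \<Rightarrow> ('v, 'e) pre_digraph \<Rightarrow> (('v, 'e) lgen list \<Rightarrow> 'r) set" where
  "leavitt_kernel R E = \<Inter> {J. rng_ideal J (free_alg R (lgens E)) \<and>
     submodule J R (free_alg R (lgens E)) \<and> leavitt_relators R E \<subseteq> J}"

text \<open>
  \<open>L\<^sub>R(E)\<close> is the quotient of the free algebra by this ideal, with the induced scalar
  multiplication; \<open>r\<close> times a coset is the coset of \<open>r\<close> times any representative.
\<close>

definition lpa ::
    "('r, 'n) ring_scheme \<Rightarrow> ('v, 'e) pre_digraph \<Rightarrow>
     ('r, (('v, 'e) lgen list \<Rightarrow> 'r) set) module" where
  "lpa R E =
     (let F = free_alg R (lgens E); J = leavitt_kernel R E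
      in ring.extend (F Quot J)
           (module.fields (\<lambda>r A. \<Union>a \<in> A. J +>\<^bsub>F\<^esub> (r \<odot>\<^bsub>F\<^esub> a))))"

definition lpa_gen ::
    "('r, 'n) ring_scheme \<Rightarrow> ('v, 'e) pre_digraph \<Rightarrow> ('v, 'e) lgen \<Rightarrow>
     (('v, 'e) lgen list \<Rightarrow> 'r) set" where
  "lpa_gen R E x = leavitt_kernel R E +>\<^bsub>free_alg R (lgens E)\<^esub> free_gen R x"

text \<open>For a path \<open>\<mu>\<close>, \<open>lpa_path R E \<mu>\<close> is \<open>s\<^sub>\<mu>\<close> and \<open>lpa_ghost R E \<mu>\<close> is \<open>s\<^sub>\<mu>\<^sub>*\<close>.\<close>

fun lpa_path ::
    "('r, 'n) ring_scheme \<Rightarrow> ('v, 'e) pre_digraph \<Rightarrow> 'v \<times> 'e list \<Rightarrow>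
     (('v, 'e) lgen list \<Rightarrow> 'r) set" where
  "lpa_path R E (v, []) = lpa_gen R E (Vertex v)"
| "lpa_path R E (v, [e]) = lpa_gen R E (Edge e)"
| "lpa_path R E (v, e # f # es) = lpa_gen R E (Edge e) \<otimes>\<^bsub>lpa R E\<^esub> lpa_path R E (v, f # es)"

fun lpa_ghost ::
    "('r, 'n) ring_scheme \<Rightarrow> ('v, 'e) pre_digraph \<Rightarrow> 'v \<times> 'e list \<Rightarrow>
     (('v, 'e) lgen list \<Rightarrow> 'r) set" where
  "lpa_ghost R E (v, []) = lpa_gen R E (Vertex v)"
| "lpa_ghost R E (v, [e]) = lpa_gen R E (Ghost e)"
| "lpa_ghost R E (v, e # f # es) = lpa_ghost R E (v, f # es) \<otimes>\<^bsub>lpa R E\<^esub> lpa_gen R E (Ghost e)"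

definition vertex_ideal ::
    "('r, 'n) ring_scheme \<Rightarrow> ('v, 'e) pre_digraph \<Rightarrow> 'v set \<Rightarrow>
     (('v, 'e) lgen list \<Rightarrow> 'r) set set" where
  "vertex_ideal R E H = rng_genideal (lpa R E) {lpa_gen R E (Vertex v) | v. v \<in> H}"


section \<open>The parametrisation of ideals\<close>

text \<open>
  Functions on \<open>\<H>\<^sub>E\<close> are extensional, so that they are determined by their values on \<open>\<H>\<^sub>E\<close>.
  The intersection with \<open>carrier R\<close> only matters for \<open>\<A> = {}\<close>, where the value is \<open>R\<close>.
\<close>

definition ideal_functions ::
    "('r, 'n) ring_scheme \<Rightarrow> ('v, 'e) pre_digraph \<Rightarrow> ('v set \<Rightarrow> 'r set) set" where
  "ideal_functions R E =
     {\<pi> \<in> sat_hered E \<rightarrow>\<^sub>E {I. ideal I R}.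
        \<forall>\<A> \<subseteq> sat_hered E. \<pi> (sh_join E \<A>) = carrier R \<inter> (\<Inter>H \<in> \<A>. \<pi> H)}"

definition Gamma_ideal ::
    "('r, 'n) ring_scheme \<Rightarrow> ('v, 'e) pre_digraph \<Rightarrow> ('v set \<Rightarrow> 'r set) \<Rightarrow>
     (('v, 'e) lgen list \<Rightarrow> 'r) set set" where
  "Gamma_ideal R E \<pi> = span_of R (lpa R E)
     {r \<odot>\<^bsub>lpa R E\<^esub> (lpa_path R E \<mu> \<otimes>\<^bsub>lpa R E\<^esub> lpa_ghost R E \<nu>) | r \<mu> \<nu>.
        \<mu> \<in> fin_paths E \<and> \<nu> \<in> fin_paths E \<and>
        (\<exists>H \<in> sat_hered E. r \<in> \<pi> H \<and>
           lpa_path R E \<mu> \<otimes>\<^bsub>lpa R E\<^esub> lpa_ghost R E \<nu> \<in> vertex_ideal R E H)}"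

end

theory Submission
  imports Defs "HOL-Library.Sublist"
begin

text \<open>
  Part (1) needs no uniqueness theorem. By the Cuntz--Krieger relation an element \<open>a\<close> of an ideal
  \<open>I\<close> can be written as a combination of monomials \<open>s\<^sub>\<lambda>s\<^sub>\<mu>\<^sub>*\<close> whose paths \<open>\<mu>\<close> all have the same
  length. Condition (K) provides at each vertex \<open>w\<close> a closed path \<open>y\<close> that is not an initial
  segment of \<open>cy\<close> for any short closed path \<open>c\<close>; then \<open>s\<^sub>\<lambda>\<^sub>y\<^sub>* a s\<^sub>\<mu>\<^sub>y\<close> is the coefficient of
  \<open>s\<^sub>\<lambda>s\<^sub>\<mu>\<^sub>*\<close> times \<open>p\<^sub>w\<close>, so each term of \<open>a\<close> lies in the span.

  The inverse of \<open>\<Gamma>\<close> sends \<open>I\<close> to \<open>H \<mapsto> {r. \<forall>v \<in> H. rp\<^sub>v \<in> I}\<close>. That \<open>\<Gamma>(\<pi>)\<close> contains no more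
  multiples \<open>rp\<^sub>v\<close> than \<open>\<pi>\<close> prescribes is seen in the representation on infinite paths, where the
  scalars acting on a path \<open>y\<close> are taken modulo the union of the ideals that \<open>\<pi>\<close> attaches to
  the vertices of \<open>y\<close>; this union does not change when \<open>y\<close> is shifted.
\<close>

section \<open>Non-unital algebras\<close>

text \<open>A presentation by generators and relations yields equations, but never shows that an
  element is nonzero. Part (1) avoids this problem because it uses equations only. Ghost paths of
  equal length are orthogonal, so the right factor selects \<open>\<mu>\<close>. The paths
  \<open>\<lambda>\<close> that remain may be initial segments of one another, and the closed path
  \<open>y\<close> is appended to separate them. Recovering \<open>\<pi>\<close> does require
  elements to lie outside an ideal, and the representation serves this purpose alone.

  Two facts link functions and ideals. For fixed \<open>r\<close> and \<open>I\<close> the vertices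
  \<open>v\<close> with \<open>rp_v \<in> I\<close> form a saturated hereditary set, which turns
  joins into intersections. Conversely, each \<open>H\<close> is the join of the sets generated by
  its single vertices, so \<open>\<pi>\<close> amounts to a family of ideals indexed by vertices
  that grows from the head of an edge to its tail. Edges and ghost edges identify the component of a
  path with those of its shifts, so the scalars there must be reduced modulo something that depends
  on the tail of the path only; hence the union.

  As there is no unit, closure of ideals under scalars rests on local units.\<close>

locale rng_algebra = Module.module R A for R (structure) and A (structure) +
  assumes A_m_closed [simp, intro]:
      "\<lbrakk>x \<in> carrier A; y \<in> carrier A\<rbrakk> \<Longrightarrow> x \<otimes>\<^bsub>A\<^esub> y \<in> carrier A"
    and A_m_assoc:
      "\<lbrakk>x \<in> carrier A; y \<in> carrier A; z \<in> carrier A\<rbrakk> \<Longrightarrow>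
       (x \<otimes>\<^bsub>A\<^esub> y) \<otimes>\<^bsub>A\<^esub> z = x \<otimes>\<^bsub>A\<^esub> (y \<otimes>\<^bsub>A\<^esub> z)"
    and A_l_distr:
      "\<lbrakk>x \<in> carrier A; y \<in> carrier A; z \<in> carrier A\<rbrakk> \<Longrightarrow>
       (x \<oplus>\<^bsub>A\<^esub> y) \<otimes>\<^bsub>A\<^esub> z = x \<otimes>\<^bsub>A\<^esub> z \<oplus>\<^bsub>A\<^esub> y \<otimes>\<^bsub>A\<^esub> z"
    and A_r_distr:
      "\<lbrakk>x \<in> carrier A; y \<in> carrier A; z \<in> carrier A\<rbrakk> \<Longrightarrow>
       z \<otimes>\<^bsub>A\<^esub> (x \<oplus>\<^bsub>A\<^esub> y) = z \<otimes>\<^bsub>A\<^esub> x \<oplus>\<^bsub>A\<^esub> z \<otimes>\<^bsub>A\<^esub> y"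
    and smult_l_assoc:
      "\<lbrakk>r \<in> carrier R; x \<in> carrier A; y \<in> carrier A\<rbrakk> \<Longrightarrow>
       (r \<odot>\<^bsub>A\<^esub> x) \<otimes>\<^bsub>A\<^esub> y = r \<odot>\<^bsub>A\<^esub> (x \<otimes>\<^bsub>A\<^esub> y)"
    and smult_r_assoc:
      "\<lbrakk>r \<in> carrier R; x \<in> carrier A; y \<in> carrier A\<rbrakk> \<Longrightarrow>
       x \<otimes>\<^bsub>A\<^esub> (r \<odot>\<^bsub>A\<^esub> y) = r \<odot>\<^bsub>A\<^esub> (x \<otimes>\<^bsub>A\<^esub> y)"

text \<open>In the free algebra a ring ideal need not be closed under scalars, so both closures are
  recorded. In \<open>L\<close> the second follows from the first by
  \<open>rng_ideal_submodule\<close>.\<close>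

definition alg_ideal ::
    "'a set \<Rightarrow> ('r, 'n) ring_scheme \<Rightarrow> ('r, 'a, 'm) module_scheme \<Rightarrow> bool" where
  "alg_ideal J R A \<longleftrightarrow> rng_ideal J A \<and> submodule J R A"

section \<open>Ideals, submodules and finite linear combinations\<close>

lemma additive_subgroup_submodule:
  "submodule N R M \<Longrightarrow> additive_subgroup N M"
  by (simp add: additive_subgroup_def submodule_def)

lemma rng_ideal_subset: "rng_ideal I A \<Longrightarrow> I \<subseteq> carrier A"
  unfolding rng_ideal_def using additive_subgroup.a_subset by blast

lemma rng_idealD:
  assumes "rng_ideal I A"
  shows "\<zero>\<^bsub>A\<^esub> \<in> I"
    and "\<lbrakk>a \<in> I; b \<in> I\<rbrakk> \<Longrightarrow> a \<oplus>\<^bsub>A\<^esub> b \<in> I"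
    and "\<lbrakk>a \<in> I; x \<in> carrier A\<rbrakk> \<Longrightarrow> x \<otimes>\<^bsub>A\<^esub> a \<in> I"
    and "\<lbrakk>a \<in> I; x \<in> carrier A\<rbrakk> \<Longrightarrow> a \<otimes>\<^bsub>A\<^esub> x \<in> I"
  using assms unfolding rng_ideal_def
  by (auto intro: additive_subgroup.zero_closed additive_subgroup.a_closed)

lemma (in Module.module) submoduleI':
  assumes "N \<subseteq> carrier M" and "\<zero>\<^bsub>M\<^esub> \<in> N"
    and "\<And>a b. \<lbrakk>a \<in> N; b \<in> N\<rbrakk> \<Longrightarrow> a \<oplus>\<^bsub>M\<^esub> b \<in> N"
    and "\<And>r a. \<lbrakk>r \<in> carrier R; a \<in> N\<rbrakk> \<Longrightarrow> r \<odot>\<^bsub>M\<^esub> a \<in> N"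
  shows "submodule N R M"
proof (rule submoduleI)
  fix a assume "a \<in> N"
  then show "\<ominus>\<^bsub>M\<^esub> a \<in> N"
    using assms(1) assms(4)[of "\<ominus> \<one>" a] smult_l_minus[of \<one> a] by auto
qed (use assms in auto)

lemma (in Module.module) submodule_zero: "submodule N R M \<Longrightarrow> \<zero>\<^bsub>M\<^esub> \<in> N"
  using additive_subgroup.zero_closed additive_subgroup_submodule by blast

lemma (in Module.module) submodule_finsum:
  assumes "submodule N R M" and "\<And>i. i \<in> F \<Longrightarrow> f i \<in> N"
  shows "(\<Oplus>\<^bsub>M\<^esub>i\<in>F. f i) \<in> N"
proof (cases "finite F")
  case True
  then show ?thesis using assms(2)
  proof (induction F)
    case empty
    then show ?case by (simp add: submodule_zero[OF assms(1)])
  next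
    case (insert i F)
    have "f \<in> F \<rightarrow> carrier M" "f i \<in> carrier M"
      using insert.prems submoduleE(1)[OF assms(1)] by auto
    then show ?case
      using insert submoduleE(5)[OF assms(1)] by simp
  qed
next
  case False
  then show ?thesis by (simp add: M.finsum_infinite submodule_zero[OF assms(1)])
qed

lemma (in Module.module) submodule_Inter:
  assumes "\<N> \<noteq> {}" and "\<And>N. N \<in> \<N> \<Longrightarrow> submodule N R M"
  shows "submodule (\<Inter>\<N>) R M"
proof (rule submoduleI')
  show "\<Inter>\<N> \<subseteq> carrier M"
    using assms submoduleE(1) by blast
  show "\<zero>\<^bsub>M\<^esub> \<in> \<Inter>\<N>"
    using assms(2) submodule_zero by auto
  show "a \<oplus>\<^bsub>M\<^esub> b \<in> \<Inter>\<N>" if "a \<in> \<Inter>\<N>" "b \<in> \<Inter>\<N>" for a b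
    using that submoduleE(5)[OF assms(2)] by auto
  show "r \<odot>\<^bsub>M\<^esub> a \<in> \<Inter>\<N>" if "r \<in> carrier R" "a \<in> \<Inter>\<N>" for r a
    using that submoduleE(4)[OF assms(2)] by auto
qed

lemma (in Module.module) span_of_submodule:
  assumes "S \<subseteq> carrier M"
  shows "submodule (span_of R M S) R M"
  unfolding span_of_def
  by (rule submodule_Inter) (use assms carrier_is_submodule in auto)

lemma span_of_incl: "S \<subseteq> span_of R M S"
  unfolding span_of_def by auto

lemma span_of_base: "x \<in> S \<Longrightarrow> x \<in> span_of R M S"
  using span_of_incl by (rule subsetD)

lemma span_of_least: "submodule N R M \<Longrightarrow> S \<subseteq> N \<Longrightarrow> span_of R M S \<subseteq> N"
  unfolding span_of_def by auto

lemma span_of_mono: "S \<subseteq> T \<Longrightarrow> span_of R M S \<subseteq> span_of R M T"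
  unfolding span_of_def by auto

text \<open>Padding both coefficient functions by zero on the union of the index sets leaves one
  coefficient per index; this is the closure under addition in
  \<open>span_of_lin_comb\<close>.\<close>

lemma (in Module.module) finsum_lin_comb_add:
  assumes "finite F" "finite G" "m \<in> F \<union> G \<rightarrow> carrier M"
    and "c \<in> F \<rightarrow> carrier R" "d \<in> G \<rightarrow> carrier R"
  shows "(\<Oplus>\<^bsub>M\<^esub>i\<in>F. c i \<odot>\<^bsub>M\<^esub> m i) \<oplus>\<^bsub>M\<^esub> (\<Oplus>\<^bsub>M\<^esub>i\<in>G. d i \<odot>\<^bsub>M\<^esub> m i) =
    (\<Oplus>\<^bsub>M\<^esub>i\<in>F \<union> G. ((if i \<in> F then c i else \<zero>) \<oplus> (if i \<in> G then d i else \<zero>)) \<odot>\<^bsub>M\<^esub> m i)"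
proof -
  have ext: "(\<Oplus>\<^bsub>M\<^esub>i\<in>F'. b i \<odot>\<^bsub>M\<^esub> m i) = (\<Oplus>\<^bsub>M\<^esub>i\<in>F \<union> G. (if i \<in> F' then b i else \<zero>) \<odot>\<^bsub>M\<^esub> m i)"
    if "F' \<subseteq> F \<union> G" "b \<in> F' \<rightarrow> carrier R" for F' b
    by (rule M.add.finprod_mono_neutral_cong_left) (use that assms in \<open>auto simp: Pi_iff\<close>)
  have F: "(\<Oplus>\<^bsub>M\<^esub>i\<in>F. c i \<odot>\<^bsub>M\<^esub> m i) = (\<Oplus>\<^bsub>M\<^esub>i\<in>F \<union> G. (if i \<in> F then c i else \<zero>) \<odot>\<^bsub>M\<^esub> m i)"
    by (rule ext) (use assms in auto)
  have G: "(\<Oplus>\<^bsub>M\<^esub>i\<in>G. d i \<odot>\<^bsub>M\<^esub> m i) = (\<Oplus>\<^bsub>M\<^esub>i\<in>F \<union> G. (if i \<in> G then d i else \<zero>) \<odot>\<^bsub>M\<^esub> m i)"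
    by (rule ext) (use assms in auto)
  have "(\<Oplus>\<^bsub>M\<^esub>i\<in>F \<union> G. (if i \<in> F then c i else \<zero>) \<odot>\<^bsub>M\<^esub> m i) \<oplus>\<^bsub>M\<^esub>
      (\<Oplus>\<^bsub>M\<^esub>i\<in>F \<union> G. (if i \<in> G then d i else \<zero>) \<odot>\<^bsub>M\<^esub> m i) =
    (\<Oplus>\<^bsub>M\<^esub>i\<in>F \<union> G. (if i \<in> F then c i else \<zero>) \<odot>\<^bsub>M\<^esub> m i \<oplus>\<^bsub>M\<^esub>
      (if i \<in> G then d i else \<zero>) \<odot>\<^bsub>M\<^esub> m i)"
    by (rule M.finsum_addf[symmetric]) (use assms in \<open>auto simp: Pi_iff\<close>)
  also have "\<dots> = (\<Oplus>\<^bsub>M\<^esub>i\<in>F \<union> G. ((if i \<in> F then c i else \<zero>) \<oplus> (if i \<in> G then d i else \<zero>)) \<odot>\<^bsub>M\<^esub> m i)"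
    by (rule M.finsum_cong') (use assms in \<open>auto simp: Pi_iff smult_l_distr\<close>)
  finally show ?thesis unfolding F G .
qed

text \<open>The combinations themselves form a submodule, so the span, an intersection, lies among
  them. The index runs over \<open>I\<close> and not over the values \<open>m i\<close>, because
  different indices may give the same element.\<close>

lemma (in Module.module) span_of_lin_comb:
  assumes "m \<in> I \<rightarrow> carrier M" and "a \<in> span_of R M (m ` I)"
  obtains F c where "finite F" "F \<subseteq> I" "c \<in> F \<rightarrow> carrier R" "a = (\<Oplus>\<^bsub>M\<^esub>i\<in>F. c i \<odot>\<^bsub>M\<^esub> m i)"
proof -
  let ?N = "{a. \<exists>F c. finite F \<and> F \<subseteq> I \<and> c \<in> F \<rightarrow> carrier R \<and> a = (\<Oplus>\<^bsub>M\<^esub>i\<in>F. c i \<odot>\<^bsub>M\<^esub> m i)}"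
  have "submodule ?N R M"
  proof (rule submoduleI')
    show "?N \<subseteq> carrier M"
      using assms(1) by (auto intro!: M.finsum_closed smult_closed simp: Pi_iff)
    show "\<zero>\<^bsub>M\<^esub> \<in> ?N"
      by (rule CollectI, rule exI[of _ "{}"], rule exI[of _ "\<lambda>_. \<zero>"]) simp
  next
    fix a b assume "a \<in> ?N" "b \<in> ?N"
    then obtain F c G d where *: "finite F" "F \<subseteq> I" "c \<in> F \<rightarrow> carrier R" "a = (\<Oplus>\<^bsub>M\<^esub>i\<in>F. c i \<odot>\<^bsub>M\<^esub> m i)"
      "finite G" "G \<subseteq> I" "d \<in> G \<rightarrow> carrier R" "b = (\<Oplus>\<^bsub>M\<^esub>i\<in>G. d i \<odot>\<^bsub>M\<^esub> m i)"
      by auto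
    have "a \<oplus>\<^bsub>M\<^esub> b = (\<Oplus>\<^bsub>M\<^esub>i\<in>F \<union> G. ((if i \<in> F then c i else \<zero>) \<oplus> (if i \<in> G then d i else \<zero>)) \<odot>\<^bsub>M\<^esub> m i)"
      unfolding *(4,8) by (rule finsum_lin_comb_add) (use * assms(1) in auto)
    then show "a \<oplus>\<^bsub>M\<^esub> b \<in> ?N" using *
      by (intro CollectI exI[of _ "F \<union> G"] exI[of _ "\<lambda>i. (if i \<in> F then c i else \<zero>) \<oplus> (if i \<in> G then d i else \<zero>)"])
        (auto simp: Pi_iff)
  next
    fix r a assume r: "r \<in> carrier R" and "a \<in> ?N"
    then obtain F c where *: "finite F" "F \<subseteq> I" "c \<in> F \<rightarrow> carrier R" "a = (\<Oplus>\<^bsub>M\<^esub>i\<in>F. c i \<odot>\<^bsub>M\<^esub> m i)"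
      by auto
    have "r \<odot>\<^bsub>M\<^esub> a = (\<Oplus>\<^bsub>M\<^esub>i\<in>F. r \<odot>\<^bsub>M\<^esub> (c i \<odot>\<^bsub>M\<^esub> m i))"
      unfolding *(4) by (rule finsum_smult_ldistr) (use * r assms(1) in \<open>auto simp: Pi_iff\<close>)
    also have "\<dots> = (\<Oplus>\<^bsub>M\<^esub>i\<in>F. (r \<otimes> c i) \<odot>\<^bsub>M\<^esub> m i)"
      by (rule M.finsum_cong') (use * r assms(1) in \<open>auto simp: Pi_iff smult_assoc1\<close>)
    finally show "r \<odot>\<^bsub>M\<^esub> a \<in> ?N" using * r
      by (intro CollectI exI[of _ F] exI[of _ "\<lambda>i. r \<otimes> c i"]) (auto simp: Pi_iff)
  qed
  moreover have "m ` I \<subseteq> ?N"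
  proof
    fix x assume "x \<in> m ` I"
    then obtain i where "i \<in> I" "x = m i" by auto
    then show "x \<in> ?N" using assms(1)
      by (intro CollectI exI[of _ "{i}"] exI[of _ "\<lambda>_. \<one>"]) (auto simp: Pi_iff)
  qed
  ultimately have "span_of R M (m ` I) \<subseteq> ?N" by (rule span_of_least)
  then have "a \<in> ?N" using assms(2) by (rule subsetD)
  then show ?thesis by (elim CollectE exE conjE) (rule that)
qed

context rng_algebra
begin

lemma A_l_null [simp]: "x \<in> carrier A \<Longrightarrow> \<zero>\<^bsub>A\<^esub> \<otimes>\<^bsub>A\<^esub> x = \<zero>\<^bsub>A\<^esub>"
  using smult_l_assoc[of \<zero> "\<zero>\<^bsub>A\<^esub>" x] by simp

lemma A_r_null [simp]: "x \<in> carrier A \<Longrightarrow> x \<otimes>\<^bsub>A\<^esub> \<zero>\<^bsub>A\<^esub> = \<zero>\<^bsub>A\<^esub>"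
  using smult_r_assoc[of \<zero> x "\<zero>\<^bsub>A\<^esub>"] by simp

lemma finsum_l_mult:
  assumes "finite F" "f \<in> F \<rightarrow> carrier A" "x \<in> carrier A"
  shows "x \<otimes>\<^bsub>A\<^esub> (\<Oplus>\<^bsub>A\<^esub>i\<in>F. f i) = (\<Oplus>\<^bsub>A\<^esub>i\<in>F. x \<otimes>\<^bsub>A\<^esub> f i)"
  using assms by (induction F) (auto simp: Pi_def A_r_distr)

lemma finsum_r_mult:
  assumes "finite F" "f \<in> F \<rightarrow> carrier A" "x \<in> carrier A"
  shows "(\<Oplus>\<^bsub>A\<^esub>i\<in>F. f i) \<otimes>\<^bsub>A\<^esub> x = (\<Oplus>\<^bsub>A\<^esub>i\<in>F. f i \<otimes>\<^bsub>A\<^esub> x)"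
  using assms by (induction F) (auto simp: Pi_def A_l_distr)

lemma l_mult_submodule:
  assumes "submodule N R A" "x \<in> carrier A"
  shows "submodule {a \<in> carrier A. x \<otimes>\<^bsub>A\<^esub> a \<in> N} R A"
  by (rule submoduleI') (use assms submodule_zero submoduleE in \<open>auto simp: A_r_distr smult_r_assoc\<close>)

lemma r_mult_submodule:
  assumes "submodule N R A" "x \<in> carrier A"
  shows "submodule {a \<in> carrier A. a \<otimes>\<^bsub>A\<^esub> x \<in> N} R A"
  by (rule submoduleI') (use assms submodule_zero submoduleE in \<open>auto simp: A_l_distr smult_l_assoc\<close>)

lemma alg_idealI:
  assumes "submodule J R A"
    and "\<And>a x. \<lbrakk>a \<in> J; x \<in> carrier A\<rbrakk> \<Longrightarrow> x \<otimes>\<^bsub>A\<^esub> a \<in> J"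
    and "\<And>a x. \<lbrakk>a \<in> J; x \<in> carrier A\<rbrakk> \<Longrightarrow> a \<otimes>\<^bsub>A\<^esub> x \<in> J"
  shows "alg_ideal J R A"
  unfolding alg_ideal_def rng_ideal_def
  using assms additive_subgroup_submodule by auto

lemma alg_ideal_Inter:
  assumes "\<J> \<noteq> {}" and "\<And>J. J \<in> \<J> \<Longrightarrow> alg_ideal J R A"
  shows "alg_ideal (\<Inter>\<J>) R A"
proof (rule alg_idealI)
  show "submodule (\<Inter>\<J>) R A"
    by (rule submodule_Inter) (use assms alg_ideal_def in auto)
  fix a x assume a: "a \<in> \<Inter>\<J>" and x: "x \<in> carrier A"
  show "x \<otimes>\<^bsub>A\<^esub> a \<in> \<Inter>\<J>"
    using a x rng_idealD(3) assms(2) unfolding alg_ideal_def by fast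
  show "a \<otimes>\<^bsub>A\<^esub> x \<in> \<Inter>\<J>"
    using a x rng_idealD(4) assms(2) unfolding alg_ideal_def by fast
qed

lemma alg_ideal_carrier: "alg_ideal (carrier A) R A"
  by (rule alg_idealI) (auto intro: carrier_is_submodule)

text \<open>The hypothesis \<open>gen\<close> is the induction principle that makes \<open>X\<close> generate \<open>A\<close> as an algebra.\<close>

lemma alg_ideal_generators:
  assumes J: "submodule J R A"
    and X: "X \<subseteq> carrier A"
    and gen: "\<And>B. \<lbrakk>submodule B R A; X \<subseteq> B; \<And>x b. \<lbrakk>x \<in> X; b \<in> B\<rbrakk> \<Longrightarrow> x \<otimes>\<^bsub>A\<^esub> b \<in> B\<rbrakk> \<Longrightarrow> carrier A \<subseteq> B"
    and l: "\<And>a x. \<lbrakk>a \<in> J; x \<in> X\<rbrakk> \<Longrightarrow> x \<otimes>\<^bsub>A\<^esub> a \<in> J"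
    and r: "\<And>a x. \<lbrakk>a \<in> J; x \<in> X\<rbrakk> \<Longrightarrow> a \<otimes>\<^bsub>A\<^esub> x \<in> J"
  shows "alg_ideal J R A"
proof -
  have JA: "J \<subseteq> carrier A" using submoduleE(1)[OF J] .
  \<comment> \<open>The elements that multiply \<open>J\<close> into itself from one side form a
    submodule that contains \<open>X\<close> and absorbs \<open>X\<close> from the left, so
    \<open>gen\<close> applies to each of the two sides.\<close>
  let ?L = "{b \<in> carrier A. \<forall>a\<in>J. b \<otimes>\<^bsub>A\<^esub> a \<in> J}"
  let ?R = "{b \<in> carrier A. \<forall>a\<in>J. a \<otimes>\<^bsub>A\<^esub> b \<in> J}"
  have "carrier A \<subseteq> ?L"
  proof (rule gen)
    show "submodule ?L R A"
      by (rule submoduleI')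
        (use JA submodule_zero[OF J] submoduleE[OF J] in \<open>auto simp: A_l_distr smult_l_assoc subset_iff\<close>)
    show "X \<subseteq> ?L" using X l by auto
    show "x \<otimes>\<^bsub>A\<^esub> b \<in> ?L" if "x \<in> X" "b \<in> ?L" for x b
      using that X l JA by (auto simp: A_m_assoc subset_iff)
  qed
  moreover have "carrier A \<subseteq> ?R"
  proof (rule gen)
    show "submodule ?R R A"
      by (rule submoduleI')
        (use JA submodule_zero[OF J] submoduleE[OF J] in \<open>auto simp: A_r_distr smult_r_assoc subset_iff\<close>)
    show "X \<subseteq> ?R" using X r by auto
    show "x \<otimes>\<^bsub>A\<^esub> b \<in> ?R" if "x \<in> X" "b \<in> ?R" for x b
    proof -
      have "a \<otimes>\<^bsub>A\<^esub> (x \<otimes>\<^bsub>A\<^esub> b) \<in> J" if "a \<in> J" for a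
      proof -
        have "a \<otimes>\<^bsub>A\<^esub> (x \<otimes>\<^bsub>A\<^esub> b) = (a \<otimes>\<^bsub>A\<^esub> x) \<otimes>\<^bsub>A\<^esub> b"
          using \<open>x \<in> X\<close> \<open>b \<in> ?R\<close> that X JA by (subst A_m_assoc) auto
        then show ?thesis using r[OF that \<open>x \<in> X\<close>] \<open>b \<in> ?R\<close> by auto
      qed
      then show ?thesis using that X by auto
    qed
  qed
  ultimately show ?thesis by (intro alg_idealI J) auto
qed

end

text \<open>The construction of \<open>lpa\<close>, freed from the particular algebra and ideal so
  that the algebra laws can be proved for any quotient.\<close>

definition quot_alg :: "('r, 'a, 'm) module_scheme \<Rightarrow> 'a set \<Rightarrow> ('r, 'a set) module" where
  "quot_alg A J =
     ring.extend (A Quot J) (module.fields (\<lambda>r B. \<Union>a \<in> B. J +>\<^bsub>A\<^esub> (r \<odot>\<^bsub>A\<^esub> a)))"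

lemma quot_alg_simps [simp]:
  "carrier (quot_alg A J) = a_rcosets\<^bsub>A\<^esub> J"
  "mult (quot_alg A J) = rcoset_mult A J"
  "add (quot_alg A J) = set_add A"
  "zero (quot_alg A J) = J"
  "smult (quot_alg A J) = (\<lambda>r B. \<Union>a \<in> B. J +>\<^bsub>A\<^esub> (r \<odot>\<^bsub>A\<^esub> a))"
  by (simp_all add: quot_alg_def FactRing_def ring.extend_def module.fields_def)

locale quotient_algebra = rng_algebra R A for R (structure) and A (structure) and J +
  assumes J: "alg_ideal J R A"
begin

abbreviation "Q \<equiv> quot_alg A J"

definition q where "q a = J +>\<^bsub>A\<^esub> a"

lemma J_submodule: "submodule J R A" and J_ideal: "rng_ideal J A"
  using J by (auto simp: alg_ideal_def)

sublocale abelian_subgroup J A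
  by (rule abelian_subgroupI3)
    (auto simp: additive_subgroup_submodule[OF J_submodule] M.abelian_group_axioms)

lemma J_carrier: "a \<in> J \<Longrightarrow> a \<in> carrier A"
  using a_subset by auto

lemma q_self: "a \<in> carrier A \<Longrightarrow> a \<in> q a"
  unfolding q_def by (rule a_rcos_self)

lemma in_q_iff: "a \<in> carrier A \<Longrightarrow> b \<in> q a \<longleftrightarrow> b \<in> carrier A \<and> b \<ominus>\<^bsub>A\<^esub> a \<in> J"
proof
  assume a: "a \<in> carrier A" and "b \<in> q a"
  then obtain j where j: "j \<in> J" "b = j \<oplus>\<^bsub>A\<^esub> a"
    by (auto simp: q_def a_r_coset_def')
  then have "b \<ominus>\<^bsub>A\<^esub> a = j"
    using a J_carrier[OF j(1)] by (simp add: a_minus_def M.a_assoc M.r_neg)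
  then show "b \<in> carrier A \<and> b \<ominus>\<^bsub>A\<^esub> a \<in> J" using j a J_carrier[OF j(1)] by auto
next
  assume a: "a \<in> carrier A" and b: "b \<in> carrier A \<and> b \<ominus>\<^bsub>A\<^esub> a \<in> J"
  then have "b = (b \<ominus>\<^bsub>A\<^esub> a) \<oplus>\<^bsub>A\<^esub> a" by (simp add: a_minus_def M.a_assoc M.l_neg)
  then show "b \<in> q a" using b by (auto simp: q_def a_r_coset_def')
qed

lemma q_eqI: "b \<in> q a \<Longrightarrow> a \<in> carrier A \<Longrightarrow> q b = q a"
  unfolding q_def using M.a_repr_independence[OF _ _ a_subgroup] by blast

lemma q_eq_iff:
  assumes "a \<in> carrier A" "b \<in> carrier A"
  shows "q a = q b \<longleftrightarrow> a \<ominus>\<^bsub>A\<^esub> b \<in> J"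
  using assms in_q_iff[of b a] q_self[of a] q_eqI[of a b] by auto

lemma q_zero: "q \<zero>\<^bsub>A\<^esub> = J"
  unfolding q_def using M.a_coset_add_zero a_subset by blast

lemma q_in [simp]: "a \<in> carrier A \<Longrightarrow> q a \<in> carrier Q"
  by (auto simp: q_def A_RCOSETS_def')

lemma q_surj: "B \<in> carrier Q \<Longrightarrow> \<exists>a\<in>carrier A. B = q a"
  by (auto simp: q_def A_RCOSETS_def')

lemma carrier_Q: "carrier Q = q ` carrier A"
  using q_in q_surj by (auto simp del: quot_alg_simps)

lemma q_add: "\<lbrakk>a \<in> carrier A; b \<in> carrier A\<rbrakk> \<Longrightarrow> q (a \<oplus>\<^bsub>A\<^esub> b) = q a \<oplus>\<^bsub>Q\<^esub> q b"
  by (simp add: q_def a_rcos_sum)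

text \<open>\<open>rcoset_mult\<close> is a union over all pairs of representatives. As (j + a)(k +
  b) differs from ab by an element of \<open>J\<close>, all members of this union are the same
  coset.\<close>

lemma q_mult:
  assumes "a \<in> carrier A" "b \<in> carrier A"
  shows "q (a \<otimes>\<^bsub>A\<^esub> b) = q a \<otimes>\<^bsub>Q\<^esub> q b"
proof -
  have "q (a' \<otimes>\<^bsub>A\<^esub> b') = q (a \<otimes>\<^bsub>A\<^esub> b)" if a': "a' \<in> q a" and b': "b' \<in> q b" for a' b'
  proof -
    obtain j k where j: "j \<in> J" "a' = j \<oplus>\<^bsub>A\<^esub> a" and k: "k \<in> J" "b' = k \<oplus>\<^bsub>A\<^esub> b"
      using a' b' by (auto simp: q_def a_r_coset_def')
    note c = J_carrier[OF j(1)] J_carrier[OF k(1)] assms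
    have "a' \<otimes>\<^bsub>A\<^esub> b' = (j \<otimes>\<^bsub>A\<^esub> (k \<oplus>\<^bsub>A\<^esub> b) \<oplus>\<^bsub>A\<^esub> a \<otimes>\<^bsub>A\<^esub> k) \<oplus>\<^bsub>A\<^esub> a \<otimes>\<^bsub>A\<^esub> b"
      unfolding j(2) k(2) using c by (simp add: A_l_distr A_r_distr M.a_ac)
    moreover have "j \<otimes>\<^bsub>A\<^esub> (k \<oplus>\<^bsub>A\<^esub> b) \<oplus>\<^bsub>A\<^esub> a \<otimes>\<^bsub>A\<^esub> k \<in> J"
      using c j(1) k(1) rng_idealD[OF J_ideal] by auto
    ultimately have "a' \<otimes>\<^bsub>A\<^esub> b' \<in> q (a \<otimes>\<^bsub>A\<^esub> b)"
      by (auto simp: q_def a_r_coset_def')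
    then show ?thesis by (rule q_eqI) (use c in auto)
  qed
  then have "(\<Union>a'\<in>q a. \<Union>b'\<in>q b. q (a' \<otimes>\<^bsub>A\<^esub> b')) = (\<Union>a'\<in>q a. \<Union>b'\<in>q b. q (a \<otimes>\<^bsub>A\<^esub> b))"
    by (intro SUP_cong refl)
  also have "\<dots> = q (a \<otimes>\<^bsub>A\<^esub> b)" using q_self assms by auto
  finally show ?thesis by (simp add: rcoset_mult_def q_def)
qed

lemma q_smult:
  assumes "r \<in> carrier R" "a \<in> carrier A"
  shows "q (r \<odot>\<^bsub>A\<^esub> a) = r \<odot>\<^bsub>Q\<^esub> q a"
proof -
  have "q (r \<odot>\<^bsub>A\<^esub> b) = q (r \<odot>\<^bsub>A\<^esub> a)" if "b \<in> q a" for b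
  proof -
    obtain j where j: "j \<in> J" "b = j \<oplus>\<^bsub>A\<^esub> a" using \<open>b \<in> q a\<close> by (auto simp: q_def a_r_coset_def')
    then have "r \<odot>\<^bsub>A\<^esub> b = r \<odot>\<^bsub>A\<^esub> j \<oplus>\<^bsub>A\<^esub> r \<odot>\<^bsub>A\<^esub> a" "r \<odot>\<^bsub>A\<^esub> j \<in> J"
      using J_carrier[OF j(1)] assms submoduleE(4)[OF J_submodule] by (auto simp: smult_r_distr)
    then have "r \<odot>\<^bsub>A\<^esub> b \<in> q (r \<odot>\<^bsub>A\<^esub> a)" by (auto simp: q_def a_r_coset_def')
    then show ?thesis by (rule q_eqI) (use assms in auto)
  qed
  then have "(\<Union>b\<in>q a. q (r \<odot>\<^bsub>A\<^esub> b)) = (\<Union>b\<in>q a. q (r \<odot>\<^bsub>A\<^esub> a))" by (rule SUP_cong[OF refl])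
  also have "\<dots> = q (r \<odot>\<^bsub>A\<^esub> a)" using q_self assms by auto
  finally show ?thesis by (simp add: q_def)
qed

lemma quotient_rng_algebra: "rng_algebra R Q"
proof (intro rng_algebra.intro rng_algebra_axioms.intro Module.moduleI abelian_groupI)
  show "cring R" by (rule R.cring_axioms)
  have z: "\<zero>\<^bsub>Q\<^esub> = q \<zero>\<^bsub>A\<^esub>" by (simp add: q_zero)
  show "\<zero>\<^bsub>Q\<^esub> \<in> carrier Q" unfolding z by (rule q_in) simp
  show "\<zero>\<^bsub>Q\<^esub> \<oplus>\<^bsub>Q\<^esub> x = x" if "x \<in> carrier Q" for x
    using q_surj[OF that] by (auto simp del: quot_alg_simps simp: z q_add[symmetric])
  show "\<exists>y\<in>carrier Q. y \<oplus>\<^bsub>Q\<^esub> x = \<zero>\<^bsub>Q\<^esub>" if "x \<in> carrier Q" for x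
  proof -
    from q_surj[OF that] obtain a where "a \<in> carrier A" "x = q a" by blast
    then show ?thesis
      by (intro bexI[of _ "q (\<ominus>\<^bsub>A\<^esub> a)"]) (auto simp del: quot_alg_simps simp: z q_add[symmetric] M.l_neg)
  qed
qed (auto simp del: quot_alg_simps simp: carrier_Q q_add[symmetric] q_mult[symmetric] q_smult[symmetric]
    M.a_ac smult_l_distr smult_r_distr smult_assoc1 A_m_assoc A_l_distr A_r_distr smult_l_assoc smult_r_assoc)

sublocale Q: rng_algebra R Q
  by (rule quotient_rng_algebra)

lemma q_image_alg_ideal:
  assumes "alg_ideal K R A"
  shows "alg_ideal (q ` K) R Q"
proof -
  have K: "submodule K R A" "rng_ideal K A" using assms by (auto simp: alg_ideal_def)
  have KA: "a \<in> K \<Longrightarrow> a \<in> carrier A" for a using rng_ideal_subset[OF K(2)] by auto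
  show ?thesis
  proof (rule Q.alg_idealI, rule Q.submoduleI')
    show "q ` K \<subseteq> carrier Q" using KA q_in by blast
    show "\<zero>\<^bsub>Q\<^esub> \<in> q ` K" using submodule_zero[OF K(1)] q_zero by (auto intro!: rev_image_eqI)
    show "a \<oplus>\<^bsub>Q\<^esub> b \<in> q ` K" if "a \<in> q ` K" "b \<in> q ` K" for a b
      using that submoduleE(5)[OF K(1)] KA by (auto simp del: quot_alg_simps simp: q_add[symmetric])
    show "r \<odot>\<^bsub>Q\<^esub> a \<in> q ` K" if "r \<in> carrier R" "a \<in> q ` K" for r a
      using that submoduleE(4)[OF K(1)] KA by (auto simp del: quot_alg_simps simp: q_smult[symmetric])
    show "x \<otimes>\<^bsub>Q\<^esub> a \<in> q ` K" "a \<otimes>\<^bsub>Q\<^esub> x \<in> q ` K" if "a \<in> q ` K" "x \<in> carrier Q" for a x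
      using that(1) q_surj[OF that(2)] rng_idealD(3,4)[OF K(2)] KA
      by (auto simp del: quot_alg_simps simp: q_mult[symmetric])
  qed
qed

text \<open>Since \<open>J\<close> lies in \<open>K\<close>, a coset of \<open>J\<close> is either
  contained in \<open>K\<close> or disjoint from it. Membership in an ideal of the quotient can thus
  be tested on a representative.\<close>

lemma q_mem_image_iff:
  assumes "submodule K R A" "J \<subseteq> K" "a \<in> carrier A"
  shows "q a \<in> q ` K \<longleftrightarrow> a \<in> K"
proof
  assume "q a \<in> q ` K"
  then obtain b where b: "b \<in> K" "q a = q b" by auto
  have bA: "b \<in> carrier A" using b(1) submoduleE(1)[OF assms(1)] by auto
  have "a \<ominus>\<^bsub>A\<^esub> b \<in> K" using q_eq_iff[of a b] b bA assms by auto
  then have "(a \<ominus>\<^bsub>A\<^esub> b) \<oplus>\<^bsub>A\<^esub> b \<in> K" using submoduleE(5)[OF assms(1)] b by auto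
  then show "a \<in> K" using bA assms(3) by (simp add: a_minus_def M.a_assoc M.l_neg)
qed auto

end

section \<open>The free algebra\<close>

definition word_mono :: "('r, 'n) ring_scheme \<Rightarrow> 'g list \<Rightarrow> 'g list \<Rightarrow> 'r" where
  "word_mono R u = (\<lambda>w. if w = u then \<one>\<^bsub>R\<^esub> else \<zero>\<^bsub>R\<^esub>)"

lemma free_gen_word_mono: "free_gen R x = word_mono R [x]"
  by (simp add: free_gen_def word_mono_def)

locale free_algebra = cring R for R (structure) and X :: "'g set"
begin

abbreviation "F \<equiv> free_alg R X"

lemma F_simps:
  "f \<in> carrier F \<longleftrightarrow> (\<forall>w. f w \<in> carrier R) \<and> finite {w. f w \<noteq> \<zero>} \<and>
     (\<forall>w. w = [] \<or> \<not> set w \<subseteq> X \<longrightarrow> f w = \<zero>)"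
  "\<zero>\<^bsub>F\<^esub> = (\<lambda>w. \<zero>)"
  "f \<oplus>\<^bsub>F\<^esub> g = (\<lambda>w. f w \<oplus> g w)"
  "r \<odot>\<^bsub>F\<^esub> f = (\<lambda>w. r \<otimes> f w)"
  by (auto simp: free_alg_def)

lemma F_mult: "(f \<otimes>\<^bsub>F\<^esub> g) w = (\<Oplus>i\<in>{0..length w}. f (take i w) \<otimes> g (drop i w))"
  by (simp add: free_alg_def)

lemma F_add_closed: "\<lbrakk>f \<in> carrier F; g \<in> carrier F\<rbrakk> \<Longrightarrow> f \<oplus>\<^bsub>F\<^esub> g \<in> carrier F"
  unfolding F_simps
  by (auto intro!: finite_subset[of "{w. f w \<oplus> g w \<noteq> \<zero>}" "{w. f w \<noteq> \<zero>} \<union> {w. g w \<noteq> \<zero>}"])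

lemma F_smult_closed: "\<lbrakk>r \<in> carrier R; f \<in> carrier F\<rbrakk> \<Longrightarrow> r \<odot>\<^bsub>F\<^esub> f \<in> carrier F"
  unfolding F_simps
  by (auto intro!: finite_subset[of "{w. r \<otimes> f w \<noteq> \<zero>}" "{w. f w \<noteq> \<zero>}"])

lemma F_module: "Module.module R F"
proof (intro Module.moduleI abelian_groupI)
  show "cring R" by (rule is_cring)
  show "\<exists>g\<in>carrier F. g \<oplus>\<^bsub>F\<^esub> f = \<zero>\<^bsub>F\<^esub>" if "f \<in> carrier F" for f
    by (rule bexI[of _ "(\<ominus> \<one>) \<odot>\<^bsub>F\<^esub> f"])
      (use that in \<open>auto intro!: F_smult_closed ext simp: F_simps(2-4) l_minus l_neg F_simps(1)\<close>)
  show "\<zero>\<^bsub>F\<^esub> \<in> carrier F" by (simp add: F_simps)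
qed (auto simp: F_add_closed F_smult_closed, auto intro!: ext simp: F_simps a_ac l_distr r_distr m_assoc)

sublocale F: Module.module R F
  by (rule F_module)

lemma word_mono_closed [simp]: "w \<noteq> [] \<Longrightarrow> set w \<subseteq> X \<Longrightarrow> word_mono R w \<in> carrier F"
  by (auto simp: F_simps word_mono_def)

lemma F_valueD: "f \<in> carrier F \<Longrightarrow> f w \<in> carrier R"
  by (simp add: F_simps)

text \<open>Linear induction over the word basis: a property that defines a submodule has to be
  checked on monomials only. The induction removes one word of the support at a time.\<close>

lemma F_spanned:
  assumes N: "submodule N R F"
    and mono: "\<And>w. w \<noteq> [] \<Longrightarrow> set w \<subseteq> X \<Longrightarrow> word_mono R w \<in> N"
  shows "carrier F \<subseteq> N"
proof
  fix f assume "f \<in> carrier F"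
  then show "f \<in> N"
  proof (induction "card {w. f w \<noteq> \<zero>}" arbitrary: f)
    case 0
    then have "f = \<zero>\<^bsub>F\<^esub>" by (auto simp: F_simps)
    then show ?case using F.submodule_zero[OF N] by simp
  next
    case (Suc n)
    from Suc(2) have "{w. f w \<noteq> \<zero>} \<noteq> {}" by (metis card.empty nat.distinct(1))
    then obtain w where w: "f w \<noteq> \<zero>" by blast
    define g where "g = f(w := \<zero>)"
    have supp: "{u. g u \<noteq> \<zero>} = {u. f u \<noteq> \<zero>} - {w}" by (auto simp: g_def)
    have fin: "finite {u. f u \<noteq> \<zero>}" using Suc(3) by (simp add: F_simps)
    then have "finite {u. g u \<noteq> \<zero>}" unfolding supp by simp
    then have g: "g \<in> carrier F" using Suc(3) by (auto simp: F_simps g_def)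
    moreover have "n = card {u. g u \<noteq> \<zero>}" unfolding supp using Suc(2) w fin by simp
    ultimately have "g \<in> N" using Suc(1) by blast
    moreover have "f w \<odot>\<^bsub>F\<^esub> word_mono R w \<in> N"
    proof -
      have "w \<noteq> []" "set w \<subseteq> X" "f w \<in> carrier R" using w Suc(3) by (metis F_simps(1))+
      then show ?thesis using mono F.submoduleE(4)[OF N] by blast
    qed
    moreover have "f = f w \<odot>\<^bsub>F\<^esub> word_mono R w \<oplus>\<^bsub>F\<^esub> g"
      using Suc(3) by (auto simp: F_simps g_def word_mono_def fun_eq_iff)
    ultimately show ?case using F.submoduleE(5)[OF N] by metis
  qed
qed

text \<open>A word in the support of a product is a concatenation of two support words; finiteness
  of the support and the condition on its letters follow from this.\<close>

lemma F_mult_closed: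
  assumes f: "f \<in> carrier F" and g: "g \<in> carrier F"
  shows "f \<otimes>\<^bsub>F\<^esub> g \<in> carrier F"
proof -
  have val: "f w \<in> carrier R" "g w \<in> carrier R" for w using assms by (auto simp: F_simps)
  have supp: "\<exists>u v. w = u @ v \<and> f u \<noteq> \<zero> \<and> g v \<noteq> \<zero>" if "(f \<otimes>\<^bsub>F\<^esub> g) w \<noteq> \<zero>" for w
  proof -
    have "\<exists>i\<in>{0..length w}. f (take i w) \<otimes> g (drop i w) \<noteq> \<zero>"
    proof (rule ccontr)
      assume "\<not> ?thesis"
      then have "(f \<otimes>\<^bsub>F\<^esub> g) w = \<zero>" unfolding F_mult by (intro add.finprod_one_eqI) auto
      then show False using that by simp
    qed
    then obtain i where "f (take i w) \<otimes> g (drop i w) \<noteq> \<zero>" by auto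
    then show ?thesis using val
      by (intro exI[of _ "take i w"] exI[of _ "drop i w"]) auto
  qed
  have "{w. (f \<otimes>\<^bsub>F\<^esub> g) w \<noteq> \<zero>} \<subseteq> (\<lambda>(u, v). u @ v) ` ({u. f u \<noteq> \<zero>} \<times> {v. g v \<noteq> \<zero>})"
    using supp by fastforce
  moreover have "finite \<dots>" using assms by (simp add: F_simps)
  ultimately have "finite {w. (f \<otimes>\<^bsub>F\<^esub> g) w \<noteq> \<zero>}" by (rule finite_subset)
  moreover have "(f \<otimes>\<^bsub>F\<^esub> g) w \<in> carrier R" for w
    unfolding F_mult using val by (intro finsum_closed) auto
  moreover have "w \<noteq> [] \<and> set w \<subseteq> X" if w: "(f \<otimes>\<^bsub>F\<^esub> g) w \<noteq> \<zero>" for w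
  proof -
    obtain u v where "w = u @ v" "f u \<noteq> \<zero>" "g v \<noteq> \<zero>" using supp[OF w] by blast
    then show ?thesis using assms by (auto simp: F_simps)
  qed
  ultimately show ?thesis unfolding F_simps(1) by metis
qed

lemma F_l_distr:
  assumes "f \<in> carrier F" "g \<in> carrier F" "h \<in> carrier F"
  shows "(f \<oplus>\<^bsub>F\<^esub> g) \<otimes>\<^bsub>F\<^esub> h = f \<otimes>\<^bsub>F\<^esub> h \<oplus>\<^bsub>F\<^esub> g \<otimes>\<^bsub>F\<^esub> h"
proof
  fix w
  note val = assms[THEN F_valueD]
  have "((f \<oplus>\<^bsub>F\<^esub> g) \<otimes>\<^bsub>F\<^esub> h) w =
      (\<Oplus>i\<in>{0..length w}. f (take i w) \<otimes> h (drop i w) \<oplus> g (take i w) \<otimes> h (drop i w))"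
    unfolding F_mult F_simps(3) using val by (intro finsum_cong') (auto simp: l_distr)
  also have "\<dots> = (f \<otimes>\<^bsub>F\<^esub> h \<oplus>\<^bsub>F\<^esub> g \<otimes>\<^bsub>F\<^esub> h) w"
    unfolding F_mult F_simps(3) using val by (intro finsum_addf) auto
  finally show "((f \<oplus>\<^bsub>F\<^esub> g) \<otimes>\<^bsub>F\<^esub> h) w = (f \<otimes>\<^bsub>F\<^esub> h \<oplus>\<^bsub>F\<^esub> g \<otimes>\<^bsub>F\<^esub> h) w" .
qed

lemma F_r_distr:
  assumes "f \<in> carrier F" "g \<in> carrier F" "h \<in> carrier F"
  shows "h \<otimes>\<^bsub>F\<^esub> (f \<oplus>\<^bsub>F\<^esub> g) = h \<otimes>\<^bsub>F\<^esub> f \<oplus>\<^bsub>F\<^esub> h \<otimes>\<^bsub>F\<^esub> g"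
proof
  fix w
  note val = assms[THEN F_valueD]
  have "(h \<otimes>\<^bsub>F\<^esub> (f \<oplus>\<^bsub>F\<^esub> g)) w =
      (\<Oplus>i\<in>{0..length w}. h (take i w) \<otimes> f (drop i w) \<oplus> h (take i w) \<otimes> g (drop i w))"
    unfolding F_mult F_simps(3) using val by (intro finsum_cong') (auto simp: r_distr)
  also have "\<dots> = (h \<otimes>\<^bsub>F\<^esub> f \<oplus>\<^bsub>F\<^esub> h \<otimes>\<^bsub>F\<^esub> g) w"
    unfolding F_mult F_simps(3) using val by (intro finsum_addf) auto
  finally show "(h \<otimes>\<^bsub>F\<^esub> (f \<oplus>\<^bsub>F\<^esub> g)) w = (h \<otimes>\<^bsub>F\<^esub> f \<oplus>\<^bsub>F\<^esub> h \<otimes>\<^bsub>F\<^esub> g) w" .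
qed

lemma F_smult_l_assoc:
  assumes "r \<in> carrier R" "f \<in> carrier F" "g \<in> carrier F"
  shows "(r \<odot>\<^bsub>F\<^esub> f) \<otimes>\<^bsub>F\<^esub> g = r \<odot>\<^bsub>F\<^esub> (f \<otimes>\<^bsub>F\<^esub> g)"
proof
  fix w
  note val = assms(2,3)[THEN F_valueD]
  have "((r \<odot>\<^bsub>F\<^esub> f) \<otimes>\<^bsub>F\<^esub> g) w = (\<Oplus>i\<in>{0..length w}. r \<otimes> (f (take i w) \<otimes> g (drop i w)))"
    unfolding F_mult F_simps(4) using val assms(1) by (intro finsum_cong') (auto simp: m_assoc)
  also have "\<dots> = (r \<odot>\<^bsub>F\<^esub> (f \<otimes>\<^bsub>F\<^esub> g)) w"
    unfolding F_mult F_simps(4) using val assms(1) by (intro finsum_rdistr[symmetric]) auto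
  finally show "((r \<odot>\<^bsub>F\<^esub> f) \<otimes>\<^bsub>F\<^esub> g) w = (r \<odot>\<^bsub>F\<^esub> (f \<otimes>\<^bsub>F\<^esub> g)) w" .
qed

lemma F_smult_r_assoc:
  assumes "r \<in> carrier R" "f \<in> carrier F" "g \<in> carrier F"
  shows "f \<otimes>\<^bsub>F\<^esub> (r \<odot>\<^bsub>F\<^esub> g) = r \<odot>\<^bsub>F\<^esub> (f \<otimes>\<^bsub>F\<^esub> g)"
proof
  fix w
  note val = assms(2,3)[THEN F_valueD]
  have "(f \<otimes>\<^bsub>F\<^esub> (r \<odot>\<^bsub>F\<^esub> g)) w = (\<Oplus>i\<in>{0..length w}. r \<otimes> (f (take i w) \<otimes> g (drop i w)))"
    unfolding F_mult F_simps(4) using val assms(1) by (intro finsum_cong') (auto simp: m_lcomm)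
  also have "\<dots> = (r \<odot>\<^bsub>F\<^esub> (f \<otimes>\<^bsub>F\<^esub> g)) w"
    unfolding F_mult F_simps(4) using val assms(1) by (intro finsum_rdistr[symmetric]) auto
  finally show "(f \<otimes>\<^bsub>F\<^esub> (r \<odot>\<^bsub>F\<^esub> g)) w = (r \<odot>\<^bsub>F\<^esub> (f \<otimes>\<^bsub>F\<^esub> g)) w" .
qed

lemma word_mono_mult: "word_mono R u \<otimes>\<^bsub>F\<^esub> word_mono R v = word_mono R (u @ v)"
proof
  fix w
  show "(word_mono R u \<otimes>\<^bsub>F\<^esub> word_mono R v) w = word_mono R (u @ v) w"
  proof (cases "w = u @ v")
    case True
    have "(word_mono R u \<otimes>\<^bsub>F\<^esub> word_mono R v) w =
        (\<Oplus>i\<in>{0..length w}. if length u = i then \<one> else \<zero>)"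
    proof -
      have "take i (u @ v) = u \<and> drop i (u @ v) = v \<longleftrightarrow> length u = i" if "i \<le> length (u @ v)" for i
      proof
        assume "take i (u @ v) = u \<and> drop i (u @ v) = v"
        then have "length (take i (u @ v)) = length u" by simp
        then show "length u = i" using that by simp
      qed auto
      then show ?thesis
        unfolding F_mult by (intro finsum_cong') (auto simp: word_mono_def True)
    qed
    also have "\<dots> = \<one>"
      by (subst finsum_singleton) (auto simp: True)
    finally show ?thesis by (simp add: word_mono_def True)
  next
    case False
    then have "word_mono R u (take i w) \<otimes> word_mono R v (drop i w) = \<zero>" for i
      using append_take_drop_id[of i w] by (auto simp: word_mono_def)
    then show ?thesis unfolding F_mult using False by (simp add: word_mono_def)
  qed
qed

text \<open>Both sides are linear in each argument, so \<open>F_spanned\<close>, applied to one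
  argument after the other, reduces the claim to associativity of concatenation and avoids double
  sums over cut positions.\<close>

lemma F_m_assoc:
  assumes f: "f \<in> carrier F" and g: "g \<in> carrier F" and h: "h \<in> carrier F"
  shows "(f \<otimes>\<^bsub>F\<^esub> g) \<otimes>\<^bsub>F\<^esub> h = f \<otimes>\<^bsub>F\<^esub> (g \<otimes>\<^bsub>F\<^esub> h)"
proof -
  note closed = F_mult_closed F_add_closed F_smult_closed
  note lin = F_l_distr F_r_distr F_smult_l_assoc F_smult_r_assoc closed
  have zero: "\<zero>\<^bsub>F\<^esub> \<otimes>\<^bsub>F\<^esub> a = \<zero>\<^bsub>F\<^esub>" "a \<otimes>\<^bsub>F\<^esub> \<zero>\<^bsub>F\<^esub> = \<zero>\<^bsub>F\<^esub>" if "a \<in> carrier F" for a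
    using F_smult_l_assoc[of \<zero> "\<zero>\<^bsub>F\<^esub>" a] F_smult_r_assoc[of \<zero> a "\<zero>\<^bsub>F\<^esub>"] that closed by auto
  have 1: "carrier F \<subseteq> {h \<in> carrier F. (word_mono R u \<otimes>\<^bsub>F\<^esub> word_mono R v) \<otimes>\<^bsub>F\<^esub> h =
      word_mono R u \<otimes>\<^bsub>F\<^esub> (word_mono R v \<otimes>\<^bsub>F\<^esub> h)}"
    if "u \<noteq> []" "set u \<subseteq> X" "v \<noteq> []" "set v \<subseteq> X" for u v
    using that by (intro F_spanned F.submoduleI') (auto simp: lin zero word_mono_mult)
  have 2: "carrier F \<subseteq> {g \<in> carrier F. \<forall>h \<in> carrier F.
      (word_mono R u \<otimes>\<^bsub>F\<^esub> g) \<otimes>\<^bsub>F\<^esub> h = word_mono R u \<otimes>\<^bsub>F\<^esub> (g \<otimes>\<^bsub>F\<^esub> h)}"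
    if "u \<noteq> []" "set u \<subseteq> X" for u
    using that 1 by (intro F_spanned F.submoduleI') (auto simp: lin zero)
  have "carrier F \<subseteq> {f \<in> carrier F. \<forall>g \<in> carrier F. \<forall>h \<in> carrier F.
      (f \<otimes>\<^bsub>F\<^esub> g) \<otimes>\<^bsub>F\<^esub> h = f \<otimes>\<^bsub>F\<^esub> (g \<otimes>\<^bsub>F\<^esub> h)}"
    using 2 by (intro F_spanned F.submoduleI') (auto simp: lin zero)
  then show ?thesis using assms by auto
qed

sublocale F: rng_algebra R F
  by (unfold_locales) (auto simp: F_mult_closed F_m_assoc F_l_distr F_r_distr F_smult_l_assoc F_smult_r_assoc)

text \<open>A word is built by adding letters on the left. This provides the generation hypothesis
  of \<open>alg_ideal_generators\<close> for the free algebra and, through the quotient map, for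
  \<open>L\<close>.\<close>

lemma F_generated:
  assumes B: "submodule B R F"
    and gen: "\<And>x. x \<in> X \<Longrightarrow> free_gen R x \<in> B"
    and step: "\<And>x b. \<lbrakk>x \<in> X; b \<in> B\<rbrakk> \<Longrightarrow> free_gen R x \<otimes>\<^bsub>F\<^esub> b \<in> B"
  shows "carrier F \<subseteq> B"
proof (rule F_spanned[OF B])
  fix w :: "'g list" assume "w \<noteq> []" "set w \<subseteq> X"
  then show "word_mono R w \<in> B"
  proof (induction w rule: list_nonempty_induct)
    case (single x)
    then show ?case using gen by (simp add: free_gen_word_mono)
  next
    case (cons x w)
    then show ?case using step[of x "word_mono R w"] by (simp add: free_gen_word_mono word_mono_mult)
  qed
qed

end

section \<open>Relations in the Leavitt path algebra\<close>

locale leavitt = cring R for R (structure) +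
  fixes E :: "('v, 'e) pre_digraph"
  assumes E_wf: "wf_digraph E" and E_row_finite: "row_finite E"
begin

lemma head_in_verts [simp]: "e \<in> arcs E \<Longrightarrow> head E e \<in> verts E"
  and tail_in_verts [simp]: "e \<in> arcs E \<Longrightarrow> tail E e \<in> verts E"
  using E_wf by (auto simp: wf_digraph_def)

lemma finite_in_arcs [simp]: "v \<in> verts E \<Longrightarrow> finite (in_arcs E v)"
  using E_row_finite by (simp add: row_finite_def)

sublocale free_algebra R "lgens E" ..

abbreviation "Ker \<equiv> leavitt_kernel R E"
abbreviation "P v \<equiv> free_gen R (Vertex v :: ('v, 'e) lgen)"
abbreviation "S e \<equiv> free_gen R (Edge e :: ('v, 'e) lgen)"
abbreviation "T e \<equiv> free_gen R (Ghost e :: ('v, 'e) lgen)"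

lemma lgens_iff [simp]:
  "Vertex v \<in> lgens E \<longleftrightarrow> v \<in> verts E"
  "Edge e \<in> lgens E \<longleftrightarrow> e \<in> arcs E"
  "Ghost e \<in> lgens E \<longleftrightarrow> e \<in> arcs E"
  by (auto simp: lgens_def)

lemma gens_in_F [simp]:
  "v \<in> verts E \<Longrightarrow> P v \<in> carrier F"
  "e \<in> arcs E \<Longrightarrow> S e \<in> carrier F"
  "e \<in> arcs E \<Longrightarrow> T e \<in> carrier F"
  by (auto simp: free_gen_word_mono)

lemma free_gen_closed: "x \<in> lgens E \<Longrightarrow> free_gen R x \<in> carrier F"
  by (auto simp: free_gen_word_mono)

lemma relators:
  "v \<in> verts E \<Longrightarrow> P v \<otimes>\<^bsub>F\<^esub> P v \<ominus>\<^bsub>F\<^esub> P v \<in> leavitt_relators R E"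
  "\<lbrakk>v \<in> verts E; w \<in> verts E; v \<noteq> w\<rbrakk> \<Longrightarrow> P v \<otimes>\<^bsub>F\<^esub> P w \<in> leavitt_relators R E"
  "e \<in> arcs E \<Longrightarrow> P (head E e) \<otimes>\<^bsub>F\<^esub> S e \<ominus>\<^bsub>F\<^esub> S e \<in> leavitt_relators R E"
  "e \<in> arcs E \<Longrightarrow> S e \<otimes>\<^bsub>F\<^esub> P (tail E e) \<ominus>\<^bsub>F\<^esub> S e \<in> leavitt_relators R E"
  "e \<in> arcs E \<Longrightarrow> P (tail E e) \<otimes>\<^bsub>F\<^esub> T e \<ominus>\<^bsub>F\<^esub> T e \<in> leavitt_relators R E"
  "e \<in> arcs E \<Longrightarrow> T e \<otimes>\<^bsub>F\<^esub> P (head E e) \<ominus>\<^bsub>F\<^esub> T e \<in> leavitt_relators R E"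
  "e \<in> arcs E \<Longrightarrow> T e \<otimes>\<^bsub>F\<^esub> S e \<ominus>\<^bsub>F\<^esub> P (tail E e) \<in> leavitt_relators R E"
  "\<lbrakk>e \<in> arcs E; f \<in> arcs E; e \<noteq> f\<rbrakk> \<Longrightarrow> T e \<otimes>\<^bsub>F\<^esub> S f \<in> leavitt_relators R E"
  "v \<in> verts E \<Longrightarrow> P v \<ominus>\<^bsub>F\<^esub> (\<Oplus>\<^bsub>F\<^esub>e \<in> in_arcs E v. S e \<otimes>\<^bsub>F\<^esub> T e) \<in> leavitt_relators R E"
  unfolding leavitt_relators_def Let_def by blast+

lemma relators_cases:
  assumes "a \<in> leavitt_relators R E"
  obtains
      (PP) v where "v \<in> verts E" "a = P v \<otimes>\<^bsub>F\<^esub> P v \<ominus>\<^bsub>F\<^esub> P v"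
    | (PP0) v w where "v \<in> verts E" "w \<in> verts E" "v \<noteq> w" "a = P v \<otimes>\<^bsub>F\<^esub> P w"
    | (PS) e where "e \<in> arcs E" "a = P (head E e) \<otimes>\<^bsub>F\<^esub> S e \<ominus>\<^bsub>F\<^esub> S e"
    | (SP) e where "e \<in> arcs E" "a = S e \<otimes>\<^bsub>F\<^esub> P (tail E e) \<ominus>\<^bsub>F\<^esub> S e"
    | (PT) e where "e \<in> arcs E" "a = P (tail E e) \<otimes>\<^bsub>F\<^esub> T e \<ominus>\<^bsub>F\<^esub> T e"
    | (TP) e where "e \<in> arcs E" "a = T e \<otimes>\<^bsub>F\<^esub> P (head E e) \<ominus>\<^bsub>F\<^esub> T e"
    | (TS) e where "e \<in> arcs E" "a = T e \<otimes>\<^bsub>F\<^esub> S e \<ominus>\<^bsub>F\<^esub> P (tail E e)"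
    | (TS0) e f where "e \<in> arcs E" "f \<in> arcs E" "e \<noteq> f" "a = T e \<otimes>\<^bsub>F\<^esub> S f"
    | (CK) v where "v \<in> verts E" "a = P v \<ominus>\<^bsub>F\<^esub> (\<Oplus>\<^bsub>F\<^esub>e \<in> in_arcs E v. S e \<otimes>\<^bsub>F\<^esub> T e)"
  using assms unfolding leavitt_relators_def Let_def by (elim UnE) blast+

lemma relators_in_F: "leavitt_relators R E \<subseteq> carrier F"
proof
  fix a assume "a \<in> leavitt_relators R E"
  then show "a \<in> carrier F"
  proof (cases rule: relators_cases)
    case (CK v)
    have "(\<Oplus>\<^bsub>F\<^esub>e \<in> in_arcs E v. S e \<otimes>\<^bsub>F\<^esub> T e) \<in> carrier F"
      by (rule F.M.finsum_closed) auto
    then show ?thesis using CK by simp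
  qed simp_all
qed

lemma kernel_alt: "Ker = \<Inter> {J. alg_ideal J R F \<and> leavitt_relators R E \<subseteq> J}"
  unfolding leavitt_kernel_def alg_ideal_def by (simp add: conj_assoc)

lemma kernel_ideal: "alg_ideal Ker R F"
  unfolding kernel_alt
  by (rule F.alg_ideal_Inter) (use F.alg_ideal_carrier relators_in_F in auto)

lemma relators_in_kernel: "leavitt_relators R E \<subseteq> Ker"
  unfolding kernel_alt by blast

lemma kernel_least: "alg_ideal J R F \<Longrightarrow> leavitt_relators R E \<subseteq> J \<Longrightarrow> Ker \<subseteq> J"
  unfolding kernel_alt by blast

sublocale quot: quotient_algebra R F Ker
  by unfold_locales (rule kernel_ideal)

abbreviation "L \<equiv> lpa R E"
abbreviation "q \<equiv> quot.q"
abbreviation "gen x \<equiv> lpa_gen R E x"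
abbreviation "p v \<equiv> gen (Vertex v)"
abbreviation "s e \<equiv> gen (Edge e)"
abbreviation "t e \<equiv> gen (Ghost e)"

lemma lpa_quot: "L = quot_alg F Ker"
  by (simp add: lpa_def quot_alg_def Let_def)

lemma gen_q: "gen x = q (free_gen R x)"
  by (simp add: lpa_gen_def quot.q_def)

sublocale L: rng_algebra R L
  unfolding lpa_quot by (rule quot.quotient_rng_algebra)

lemmas q_add = quot.q_add[folded lpa_quot]
  and q_mult = quot.q_mult[folded lpa_quot]
  and q_smult = quot.q_smult[folded lpa_quot]
  and q_closed = quot.q_in[folded lpa_quot]
  and carrier_L = quot.carrier_Q[folded lpa_quot]

lemma q_zero: "q \<zero>\<^bsub>F\<^esub> = \<zero>\<^bsub>L\<^esub>"
  by (simp add: quot.q_zero lpa_quot)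

lemma q_finsum:
  assumes "finite I" "f \<in> I \<rightarrow> carrier F"
  shows "q (\<Oplus>\<^bsub>F\<^esub>i\<in>I. f i) = (\<Oplus>\<^bsub>L\<^esub>i\<in>I. q (f i))"
  using assms
  by (induction I) (auto simp: q_zero q_add q_closed Pi_def F.M.finsum_closed)

lemma gen_closed [simp]:
  "v \<in> verts E \<Longrightarrow> p v \<in> carrier L"
  "e \<in> arcs E \<Longrightarrow> s e \<in> carrier L"
  "e \<in> arcs E \<Longrightarrow> t e \<in> carrier L"
  by (simp_all add: gen_q q_closed)

lemma q_relator:
  assumes "a \<ominus>\<^bsub>F\<^esub> b \<in> leavitt_relators R E" "a \<in> carrier F" "b \<in> carrier F"
  shows "q a = q b"
  using assms relators_in_kernel quot.q_eq_iff by blast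

lemma q_relator_zero:
  assumes "a \<in> leavitt_relators R E"
  shows "q a = \<zero>\<^bsub>L\<^esub>"
proof -
  have a: "a \<in> carrier F" using assms relators_in_F by auto
  have "a \<ominus>\<^bsub>F\<^esub> \<zero>\<^bsub>F\<^esub> = a" using a by (simp add: a_minus_def F.M.add.inv_one)
  then show ?thesis
    using assms a relators_in_kernel quot.q_eq_iff[of a "\<zero>\<^bsub>F\<^esub>"] q_zero by auto
qed

lemma p_idem [simp]: "v \<in> verts E \<Longrightarrow> p v \<otimes>\<^bsub>L\<^esub> p v = p v"
  and p_orth: "\<lbrakk>v \<in> verts E; w \<in> verts E; v \<noteq> w\<rbrakk> \<Longrightarrow> p v \<otimes>\<^bsub>L\<^esub> p w = \<zero>\<^bsub>L\<^esub>"
  and p_s [simp]: "e \<in> arcs E \<Longrightarrow> p (head E e) \<otimes>\<^bsub>L\<^esub> s e = s e"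
  and s_p [simp]: "e \<in> arcs E \<Longrightarrow> s e \<otimes>\<^bsub>L\<^esub> p (tail E e) = s e"
  and p_t [simp]: "e \<in> arcs E \<Longrightarrow> p (tail E e) \<otimes>\<^bsub>L\<^esub> t e = t e"
  and t_p [simp]: "e \<in> arcs E \<Longrightarrow> t e \<otimes>\<^bsub>L\<^esub> p (head E e) = t e"
  and t_s [simp]: "e \<in> arcs E \<Longrightarrow> t e \<otimes>\<^bsub>L\<^esub> s e = p (tail E e)"
  and t_s_orth: "\<lbrakk>e \<in> arcs E; f \<in> arcs E; e \<noteq> f\<rbrakk> \<Longrightarrow> t e \<otimes>\<^bsub>L\<^esub> s f = \<zero>\<^bsub>L\<^esub>"
  unfolding gen_q
  using q_relator[OF relators(1)] q_relator_zero[OF relators(2)] q_relator[OF relators(3)]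
    q_relator[OF relators(4)] q_relator[OF relators(5)] q_relator[OF relators(6)]
    q_relator[OF relators(7)] q_relator_zero[OF relators(8)]
  by (simp_all add: q_mult)

lemma p_sum:
  assumes "v \<in> verts E"
  shows "p v = (\<Oplus>\<^bsub>L\<^esub>e \<in> in_arcs E v. s e \<otimes>\<^bsub>L\<^esub> t e)"
proof -
  have "q (P v) = q (\<Oplus>\<^bsub>F\<^esub>e \<in> in_arcs E v. S e \<otimes>\<^bsub>F\<^esub> T e)"
    by (rule q_relator[OF relators(9)]) (use assms in \<open>auto intro!: F.M.finsum_closed\<close>)
  also have "\<dots> = (\<Oplus>\<^bsub>L\<^esub>e \<in> in_arcs E v. q (S e \<otimes>\<^bsub>F\<^esub> T e))"
    by (rule q_finsum) (use assms in auto)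
  also have "\<dots> = (\<Oplus>\<^bsub>L\<^esub>e \<in> in_arcs E v. s e \<otimes>\<^bsub>L\<^esub> t e)"
    by (rule L.M.finsum_cong') (auto simp: gen_q q_mult q_closed)
  finally show ?thesis by (simp add: gen_q)
qed

lemma L_generated:
  assumes B: "submodule B R L"
    and gen: "\<And>x. x \<in> lgens E \<Longrightarrow> gen x \<in> B"
    and step: "\<And>x b. \<lbrakk>x \<in> lgens E; b \<in> B\<rbrakk> \<Longrightarrow> gen x \<otimes>\<^bsub>L\<^esub> b \<in> B"
  shows "carrier L \<subseteq> B"
proof -
  have "carrier F \<subseteq> {f \<in> carrier F. q f \<in> B}"
  proof (rule F_generated)
    show "submodule {f \<in> carrier F. q f \<in> B} R F"
      by (rule F.submoduleI')
        (use L.submodule_zero[OF B] L.submoduleE[OF B] in \<open>auto simp: q_zero q_add q_smult\<close>)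
  qed (use gen step in \<open>auto simp: free_gen_closed gen_q q_mult\<close>)
  then show ?thesis unfolding carrier_L by auto
qed

section \<open>Paths and monomials\<close>

text \<open>\<open>fin_paths\<close> in recursive form, with range and source both as arguments, so
  that composition of paths is a statement about a common middle vertex and the empty list needs no
  special treatment.\<close>

fun rpath :: "'v \<Rightarrow> 'e list \<Rightarrow> 'v \<Rightarrow> bool" where
  "rpath v [] w \<longleftrightarrow> v = w \<and> v \<in> verts E"
| "rpath v (e # es) w \<longleftrightarrow> e \<in> arcs E \<and> head E e = v \<and> rpath (tail E e) es w"

lemma rpath_verts: "rpath v es w \<Longrightarrow> v \<in> verts E \<and> w \<in> verts E"
  by (induction es arbitrary: v) auto

lemma rpath_append: "rpath v (es @ fs) w \<longleftrightarrow> (\<exists>u. rpath v es u \<and> rpath u fs w)"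
  by (induction es arbitrary: v) (auto dest: rpath_verts)

lemma rpath_source_unique: "rpath v es w \<Longrightarrow> rpath v' es w' \<Longrightarrow> es \<noteq> [] \<or> v = v' \<Longrightarrow> v = v' \<and> w = w'"
  by (induction es arbitrary: v v') auto

lemma rpath_path_source: "rpath v es w \<Longrightarrow> path_source E (v, es) = w"
proof (induction es arbitrary: v)
  case (Cons e es)
  then show ?case using Cons.IH[of "tail E e"] by (cases es) (auto simp: path_source_def)
qed (simp add: path_source_def)

lemma fin_paths_rpath: "(v, es) \<in> fin_paths E \<longleftrightarrow> rpath v es (path_source E (v, es))"
proof (induction es arbitrary: v)
  case Nil
  then show ?case by (auto simp: fin_paths_def path_source_def)
next
  case (Cons e es)
  have "path_source E (v, e # es) = path_source E (tail E e, es)"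
    by (simp add: path_source_def)
  moreover have "(v, e # es) \<in> fin_paths E \<longleftrightarrow>
      e \<in> arcs E \<and> head E e = v \<and> (tail E e, es) \<in> fin_paths E"
    by (cases es) (auto simp: fin_paths_def)
  ultimately show ?case using Cons by simp
qed

lemma rpath_fin_paths: "rpath v es w \<Longrightarrow> (v, es) \<in> fin_paths E"
  using fin_paths_rpath rpath_path_source by blast

text \<open>In contrast to \<open>lpa_path\<close>, the recursion ends in a vertex idempotent, which
  the last edge absorbs by \<open>s_p\<close>. This removes the singleton case from all inductions
  on paths; \<open>gp\<close> is treated likewise.\<close>

fun sp :: "'v \<Rightarrow> 'e list \<Rightarrow> (('v, 'e) lgen list \<Rightarrow> 'a) set" where
  "sp v [] = p v"
| "sp v (e # es) = s e \<otimes>\<^bsub>L\<^esub> sp (tail E e) es"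

fun gp :: "'v \<Rightarrow> 'e list \<Rightarrow> (('v, 'e) lgen list \<Rightarrow> 'a) set" where
  "gp v [] = p v"
| "gp v (e # es) = gp (tail E e) es \<otimes>\<^bsub>L\<^esub> t e"

lemma sp_closed [simp]: "rpath v es w \<Longrightarrow> sp v es \<in> carrier L"
  and gp_closed [simp]: "rpath v es w \<Longrightarrow> gp v es \<in> carrier L"
  by (induction es arbitrary: v) auto

lemma lpa_path_nonempty: "rpath v es w \<Longrightarrow> es \<noteq> [] \<Longrightarrow> lpa_path R E (v', es) = sp v es"
proof (induction es arbitrary: v)
  case (Cons e es)
  then show ?case by (cases es) auto
qed simp

lemma lpa_ghost_nonempty: "rpath v es w \<Longrightarrow> es \<noteq> [] \<Longrightarrow> lpa_ghost R E (v', es) = gp v es"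
proof (induction es arbitrary: v)
  case (Cons e es)
  then show ?case by (cases es) auto
qed simp

lemma lpa_path_sp: "rpath v es w \<Longrightarrow> lpa_path R E (v, es) = sp v es"
  and lpa_ghost_gp: "rpath v es w \<Longrightarrow> lpa_ghost R E (v, es) = gp v es"
  using lpa_path_nonempty[of v es w v] lpa_ghost_nonempty[of v es w v] by (cases "es = []"; simp)+

lemma p_sp: "rpath v es w \<Longrightarrow> p v \<otimes>\<^bsub>L\<^esub> sp v es = sp v es"
  by (cases es) (auto simp: L.A_m_assoc[symmetric])

lemma gp_p: "rpath v es w \<Longrightarrow> gp v es \<otimes>\<^bsub>L\<^esub> p v = gp v es"
  by (cases es) (auto simp: L.A_m_assoc)

lemma sp_append:
  "\<lbrakk>rpath v es u; rpath u fs w\<rbrakk> \<Longrightarrow> sp v (es @ fs) = sp v es \<otimes>\<^bsub>L\<^esub> sp u fs"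
  by (induction es arbitrary: v) (auto simp: p_sp L.A_m_assoc)

lemma gp_append:
  "\<lbrakk>rpath v es u; rpath u fs w\<rbrakk> \<Longrightarrow> gp v (es @ fs) = gp u fs \<otimes>\<^bsub>L\<^esub> gp v es"
  by (induction es arbitrary: v) (auto simp: gp_p L.A_m_assoc)

lemma sp_p: "rpath v es w \<Longrightarrow> sp v es \<otimes>\<^bsub>L\<^esub> p w = sp v es"
  using sp_append[of v es w "[]" w] by (simp add: rpath_verts)

lemma p_gp: "rpath v es w \<Longrightarrow> p w \<otimes>\<^bsub>L\<^esub> gp v es = gp v es"
  using gp_append[of v es w "[]" w] by (simp add: rpath_verts)

lemma mult_middle:
  assumes "x \<in> carrier L" "a \<in> carrier L" "b \<in> carrier L" "y \<in> carrier L"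
  shows "(x \<otimes>\<^bsub>L\<^esub> a) \<otimes>\<^bsub>L\<^esub> (b \<otimes>\<^bsub>L\<^esub> y) = x \<otimes>\<^bsub>L\<^esub> ((a \<otimes>\<^bsub>L\<^esub> b) \<otimes>\<^bsub>L\<^esub> y)"
  using assms by (simp add: L.A_m_assoc)

lemma gp_sp: "rpath v es w \<Longrightarrow> gp v es \<otimes>\<^bsub>L\<^esub> sp v es = p w"
  by (induction es arbitrary: v) (auto simp: mult_middle p_sp)

text \<open>Different ranges are separated by orthogonal vertex idempotents. Incomparable paths with
  the same range agree up to a first pair of different edges, where \<open>t_s_orth\<close> gives
  zero.\<close>

lemma gp_sp_zero:
  assumes "rpath v es w" "rpath v' fs w'"
    and "v \<noteq> v' \<or> \<not> prefix es fs \<and> \<not> prefix fs es"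
  shows "gp v es \<otimes>\<^bsub>L\<^esub> sp v' fs = \<zero>\<^bsub>L\<^esub>"
proof (cases "v = v'")
  case False
  have "gp v es \<otimes>\<^bsub>L\<^esub> sp v' fs = (gp v es \<otimes>\<^bsub>L\<^esub> p v) \<otimes>\<^bsub>L\<^esub> (p v' \<otimes>\<^bsub>L\<^esub> sp v' fs)"
    using assms gp_p p_sp by auto
  also have "\<dots> = \<zero>\<^bsub>L\<^esub>"
    using assms False rpath_verts by (subst mult_middle) (auto simp: p_orth)
  finally show ?thesis .
next
  case True
  then have "\<not> prefix es fs" "\<not> prefix fs es" using assms(3) by auto
  then show ?thesis using assms(1,2) unfolding True
  proof (induction es arbitrary: v' fs)
    case (Cons e es)
    then obtain f fs' where fs: "fs = f # fs'" by (cases fs) auto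
    show ?case
    proof (cases "e = f")
      case True
      then show ?thesis using Cons fs by (auto simp: mult_middle p_sp)
    next
      case False
      then show ?thesis using Cons fs by (auto simp: mult_middle t_s_orth)
    qed
  qed simp
qed

section \<open>Monomials, their products with generators, and the algebra as their span\<close>

definition monom :: "'v \<times> 'e list \<times> 'v \<times> 'e list \<Rightarrow> (('v, 'e) lgen list \<Rightarrow> 'a) set" where
  "monom = (\<lambda>(v, es, v', fs). sp v es \<otimes>\<^bsub>L\<^esub> gp v' fs)"

definition idx :: "('v \<times> 'e list \<times> 'v \<times> 'e list) set" where
  "idx = {(v, es, v', fs). \<exists>w. rpath v es w \<and> rpath v' fs w}"

text \<open>Only the ghost path has its length fixed: two paths of equal length are comparable only
  if they are equal, which makes the ghost parts orthogonal. The lengths of the other paths remain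
  arbitrary.\<close>

definition idxn :: "nat \<Rightarrow> ('v \<times> 'e list \<times> 'v \<times> 'e list) set" where
  "idxn n = {(v, es, v', fs) \<in> idx. length fs = n}"

lemma monom_closed: "i \<in> idx \<Longrightarrow> monom i \<in> carrier L"
  by (auto simp: monom_def idx_def)

lemma monom_memI: "rpath v es w \<Longrightarrow> rpath v' fs w \<Longrightarrow> sp v es \<otimes>\<^bsub>L\<^esub> gp v' fs \<in> monom ` idx"
  by (rule image_eqI[of _ _ "(v, es, v', fs)"]) (auto simp: monom_def idx_def)

lemma lgens_cases:
  assumes "x \<in> lgens E"
  obtains (V) v where "v \<in> verts E" "x = Vertex v"
    | (S) e where "e \<in> arcs E" "x = Edge e"
    | (T) e where "e \<in> arcs E" "x = Ghost e"
  using assms by (auto simp: lgens_def)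

lemma gen_carrier: "x \<in> lgens E \<Longrightarrow> gen x \<in> carrier L"
  by (auto simp: lgens_def)

lemma p_mult_sp: "rpath v es w \<Longrightarrow> u \<in> verts E \<Longrightarrow>
    p u \<otimes>\<^bsub>L\<^esub> sp v es = (if u = v then sp v es else \<zero>\<^bsub>L\<^esub>)"
  using gp_sp_zero[of u "[]" u v es w] by (auto simp: p_sp)

lemma gp_mult_p: "rpath v es w \<Longrightarrow> u \<in> verts E \<Longrightarrow>
    gp v es \<otimes>\<^bsub>L\<^esub> p u = (if u = v then gp v es else \<zero>\<^bsub>L\<^esub>)"
  using gp_sp_zero[of v es w u "[]" u] by (auto simp: gp_p)

text \<open>A vertex keeps or kills a monomial, an edge lengthens its path or kills it, and a ghost
  edge cancels the first edge of the path, kills the monomial, or, if the path is empty, moves into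
  the ghost path.\<close>

lemma gen_mult_monom:
  assumes x: "x \<in> lgens E" and m: "m \<in> monom ` idx"
  shows "gen x \<otimes>\<^bsub>L\<^esub> m \<in> insert \<zero>\<^bsub>L\<^esub> (monom ` idx)"
proof -
  obtain v es v' fs w where m: "m = sp v es \<otimes>\<^bsub>L\<^esub> gp v' fs" "rpath v es w" "rpath v' fs w"
    using m by (auto simp: idx_def monom_def)
  note [simp] = m(2,3)[THEN rpath_verts, simplified] sp_closed[OF m(2)] gp_closed[OF m(3)]
  have assoc: "gen x \<otimes>\<^bsub>L\<^esub> m = (gen x \<otimes>\<^bsub>L\<^esub> sp v es) \<otimes>\<^bsub>L\<^esub> gp v' fs"
    using gen_carrier[OF x] by (simp add: m(1) L.A_m_assoc)
  from x show ?thesis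
  proof (cases rule: lgens_cases)
    case (V u)
    then show ?thesis using assoc m monom_memI[OF m(2,3)] by (auto simp: p_mult_sp[OF m(2)])
  next
    case (S e)
    show ?thesis
    proof (cases "v = tail E e")
      case True
      then have "gen x \<otimes>\<^bsub>L\<^esub> sp v es = sp (head E e) (e # es)" using S by simp
      moreover have "rpath (head E e) (e # es) w" using S True m by simp
      ultimately show ?thesis unfolding assoc using monom_memI[OF _ m(3)] by (metis insertI2)
    next
      case False
      have "s e \<otimes>\<^bsub>L\<^esub> sp v es = s e \<otimes>\<^bsub>L\<^esub> (p (tail E e) \<otimes>\<^bsub>L\<^esub> sp v es)"
        using S by (simp add: L.A_m_assoc[symmetric])
      also have "\<dots> = \<zero>\<^bsub>L\<^esub>" using S False by (subst p_mult_sp[OF m(2)]) auto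
      finally show ?thesis unfolding assoc using S by simp
    qed
  next
    case (T e)
    have te: "t e \<otimes>\<^bsub>L\<^esub> sp v es = t e \<otimes>\<^bsub>L\<^esub> (p (head E e) \<otimes>\<^bsub>L\<^esub> sp v es)"
      using T by (simp add: L.A_m_assoc[symmetric])
    show ?thesis
    proof (cases "v = head E e")
      case False
      then have "t e \<otimes>\<^bsub>L\<^esub> sp v es = \<zero>\<^bsub>L\<^esub>" using te T by (simp add: p_mult_sp[OF m(2)])
      then show ?thesis unfolding assoc using T by simp
    next
      case True
      show ?thesis
      proof (cases es)
        case Nil
        then have *: "rpath v' fs (head E e)" using m True by simp
        have "gen x \<otimes>\<^bsub>L\<^esub> m = t e \<otimes>\<^bsub>L\<^esub> gp v' fs"
          unfolding assoc using T Nil True by simp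
        \<comment> \<open>Ghost factors occur in reversed order, so a factor added on the left
          becomes the last edge of the path.\<close>
        also have "\<dots> = gp v' (fs @ [e])"
          using gp_append[OF *, of "[e]" "tail E e"] T by simp
        also have "\<dots> = sp (tail E e) [] \<otimes>\<^bsub>L\<^esub> gp v' (fs @ [e])"
          using p_gp[of v' "fs @ [e]" "tail E e"] T * by (simp add: rpath_append exI[of _ "head E e"])
        also have "\<dots> \<in> monom ` idx"
          by (rule monom_memI[of _ _ "tail E e"]) (use T * in \<open>auto simp: rpath_append\<close>)
        finally show ?thesis by simp
      next
        case (Cons f fs')
        show ?thesis
        proof (cases "e = f")
          case True
          have r: "rpath (tail E e) fs' w" using m Cons True by simp
          have "t e \<otimes>\<^bsub>L\<^esub> sp v es = sp (tail E e) fs'"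
            using T r Cons True p_sp[OF r] by (simp add: L.A_m_assoc[symmetric])
          then show ?thesis unfolding assoc using T monom_memI[OF r m(3)] by simp
        next
          case False
          have r: "rpath (tail E f) fs' w" "f \<in> arcs E" using m Cons by auto
          have "t e \<otimes>\<^bsub>L\<^esub> sp v es = \<zero>\<^bsub>L\<^esub>"
            using T r Cons False sp_closed[OF r(1)] by (simp add: L.A_m_assoc[symmetric] t_s_orth)
          then show ?thesis unfolding assoc using T by simp
        qed
      qed
    qed
  qed
qed

text \<open>The mirror image, with edges and ghost edges exchanged; it serves the right-hand ideal
  property of \<open>Gamma_ideal\<close>.\<close>

lemma monom_mult_gen:
  assumes x: "x \<in> lgens E" and m: "m \<in> monom ` idx"
  shows "m \<otimes>\<^bsub>L\<^esub> gen x \<in> insert \<zero>\<^bsub>L\<^esub> (monom ` idx)"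
proof -
  obtain v es v' fs w where m: "m = sp v es \<otimes>\<^bsub>L\<^esub> gp v' fs" "rpath v es w" "rpath v' fs w"
    using m by (auto simp: idx_def monom_def)
  note [simp] = m(2,3)[THEN rpath_verts, simplified] sp_closed[OF m(2)] gp_closed[OF m(3)]
  have assoc: "m \<otimes>\<^bsub>L\<^esub> gen x = sp v es \<otimes>\<^bsub>L\<^esub> (gp v' fs \<otimes>\<^bsub>L\<^esub> gen x)"
    using gen_carrier[OF x] by (simp add: m(1) L.A_m_assoc)
  from x show ?thesis
  proof (cases rule: lgens_cases)
    case (V u)
    then show ?thesis using assoc m monom_memI[OF m(2,3)] by (auto simp: gp_mult_p[OF m(3)])
  next
    case (T e)
    show ?thesis
    proof (cases "v' = tail E e")
      case True
      then have "gp v' fs \<otimes>\<^bsub>L\<^esub> gen x = gp (head E e) (e # fs)" using T by simp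
      moreover have "rpath (head E e) (e # fs) w" using T True m by simp
      ultimately show ?thesis unfolding assoc using monom_memI[OF m(2)] by (metis insertI2)
    next
      case False
      have "gp v' fs \<otimes>\<^bsub>L\<^esub> t e = (gp v' fs \<otimes>\<^bsub>L\<^esub> p (tail E e)) \<otimes>\<^bsub>L\<^esub> t e"
        using T by (simp add: L.A_m_assoc)
      also have "\<dots> = \<zero>\<^bsub>L\<^esub>" using T False by (subst gp_mult_p[OF m(3)]) auto
      finally show ?thesis unfolding assoc using T by simp
    qed
  next
    case (S e)
    have te: "gp v' fs \<otimes>\<^bsub>L\<^esub> s e = (gp v' fs \<otimes>\<^bsub>L\<^esub> p (head E e)) \<otimes>\<^bsub>L\<^esub> s e"
      using S by (simp add: L.A_m_assoc)
    show ?thesis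
    proof (cases "v' = head E e")
      case False
      then have "gp v' fs \<otimes>\<^bsub>L\<^esub> s e = \<zero>\<^bsub>L\<^esub>" using te S by (simp add: gp_mult_p[OF m(3)])
      then show ?thesis unfolding assoc using S by simp
    next
      case True
      show ?thesis
      proof (cases fs)
        case Nil
        then have *: "rpath v es (head E e)" using m True by simp
        have "m \<otimes>\<^bsub>L\<^esub> gen x = sp v es \<otimes>\<^bsub>L\<^esub> s e"
          unfolding assoc using S Nil True by simp
        also have "\<dots> = sp v (es @ [e])"
          using sp_append[OF *, of "[e]" "tail E e"] S by simp
        also have "\<dots> = sp v (es @ [e]) \<otimes>\<^bsub>L\<^esub> gp (tail E e) []"
          using sp_p[of v "es @ [e]" "tail E e"] S * by (simp add: rpath_append exI[of _ "head E e"])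
        also have "\<dots> \<in> monom ` idx"
          by (rule monom_memI[of _ _ "tail E e"]) (use S * in \<open>auto simp: rpath_append\<close>)
        finally show ?thesis by simp
      next
        case (Cons f fs')
        show ?thesis
        proof (cases "e = f")
          case True
          have r: "rpath (tail E e) fs' w" using m Cons True by simp
          have "gp v' fs \<otimes>\<^bsub>L\<^esub> s e = gp (tail E e) fs'"
            using S r Cons True gp_p[OF r] by (simp add: L.A_m_assoc)
          then show ?thesis unfolding assoc using S monom_memI[OF m(2) r] by simp
        next
          case False
          have r: "rpath (tail E f) fs' w" "f \<in> arcs E" using m Cons by auto
          have "gp v' fs \<otimes>\<^bsub>L\<^esub> s e = \<zero>\<^bsub>L\<^esub>"
            using S r Cons False gp_closed[OF r(1)] by (simp add: L.A_m_assoc t_s_orth)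
          then show ?thesis unfolding assoc using S by simp
        qed
      qed
    qed
  qed
qed

lemma gen_in_monom:
  assumes "x \<in> lgens E"
  shows "gen x \<in> monom ` idx"
  using assms
proof (cases rule: lgens_cases)
  case (V v)
  then show ?thesis using monom_memI[of v "[]" v v "[]"] by simp
next
  case (S e)
  then show ?thesis using monom_memI[of "head E e" "[e]" "tail E e" "tail E e" "[]"] by simp
next
  case (T e)
  then show ?thesis using monom_memI[of "tail E e" "[]" "tail E e" "head E e" "[e]"] by simp
qed

lemma monom_span: "carrier L \<subseteq> span_of R L (monom ` idx)"
proof (rule L_generated)
  have *: "submodule (span_of R L (monom ` idx)) R L"
    by (rule L.span_of_submodule) (use monom_closed in auto)
  then show "submodule (span_of R L (monom ` idx)) R L" .
  show "gen x \<in> span_of R L (monom ` idx)" if "x \<in> lgens E" for x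
    using gen_in_monom[OF that] by (rule span_of_base)
  show "gen x \<otimes>\<^bsub>L\<^esub> b \<in> span_of R L (monom ` idx)"
    if x: "x \<in> lgens E" and b: "b \<in> span_of R L (monom ` idx)" for x b
  proof -
    have "monom ` idx \<subseteq> {a \<in> carrier L. gen x \<otimes>\<^bsub>L\<^esub> a \<in> span_of R L (monom ` idx)}"
    proof
      fix m assume m: "m \<in> monom ` idx"
      then have "gen x \<otimes>\<^bsub>L\<^esub> m \<in> span_of R L (monom ` idx)"
        using gen_mult_monom[OF x m] L.submodule_zero[OF *] by (auto intro: span_of_base)
      then show "m \<in> {a \<in> carrier L. gen x \<otimes>\<^bsub>L\<^esub> a \<in> span_of R L (monom ` idx)}"
        using m monom_closed by auto
    qed
    then have "span_of R L (monom ` idx) \<subseteq> {a \<in> carrier L. gen x \<otimes>\<^bsub>L\<^esub> a \<in> span_of R L (monom ` idx)}"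
      by (rule span_of_least[OF L.l_mult_submodule[OF * gen_carrier[OF x]]])
    then show ?thesis using b by auto
  qed
qed

text \<open>The idempotent \<open>p w\<close> is inserted between the factors and replaced by its
  Cuntz--Krieger sum, so both paths grow by the same edge at their common source.\<close>

lemma monom_expand:
  assumes "rpath v es w" "rpath v' fs w"
  shows "sp v es \<otimes>\<^bsub>L\<^esub> gp v' fs =
    (\<Oplus>\<^bsub>L\<^esub>e\<in>in_arcs E w. sp v (es @ [e]) \<otimes>\<^bsub>L\<^esub> gp v' (fs @ [e]))"
proof -
  have w: "w \<in> verts E" using assms rpath_verts by blast
  note [simp] = sp_closed[OF assms(1)] gp_closed[OF assms(2)]
  have "sp v es \<otimes>\<^bsub>L\<^esub> gp v' fs = sp v es \<otimes>\<^bsub>L\<^esub> ((\<Oplus>\<^bsub>L\<^esub>e\<in>in_arcs E w. s e \<otimes>\<^bsub>L\<^esub> t e) \<otimes>\<^bsub>L\<^esub> gp v' fs)"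
    using p_gp[OF assms(2)] p_sum[OF w] by simp
  also have "\<dots> = (\<Oplus>\<^bsub>L\<^esub>e\<in>in_arcs E w. sp v es \<otimes>\<^bsub>L\<^esub> ((s e \<otimes>\<^bsub>L\<^esub> t e) \<otimes>\<^bsub>L\<^esub> gp v' fs))"
    using w by (subst L.finsum_r_mult) (auto simp: L.finsum_l_mult)
  also have "\<dots> = (\<Oplus>\<^bsub>L\<^esub>e\<in>in_arcs E w. sp v (es @ [e]) \<otimes>\<^bsub>L\<^esub> gp v' (fs @ [e]))"
    using assms
    by (intro L.M.finsum_cong') (auto simp: sp_append[OF assms(1), of "[_]"] gp_append[OF assms(2), of "[_]"] L.A_m_assoc)
  finally show ?thesis .
qed

text \<open>By \<open>monom_expand\<close> the spans increase with \<open>n\<close>. The union of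
  this chain is therefore a submodule, and it contains every monomial.\<close>

lemma monom_span_level: "a \<in> carrier L \<Longrightarrow> \<exists>n. a \<in> span_of R L (monom ` idxn n)"
proof -
  have idxn: "idxn n \<subseteq> idx" for n by (auto simp: idxn_def)
  then have sub: "submodule (span_of R L (monom ` idxn n)) R L" for n
    by (intro L.span_of_submodule) (use monom_closed in blast)
  have step: "span_of R L (monom ` idxn n) \<subseteq> span_of R L (monom ` idxn (Suc n))" for n
  proof (rule span_of_least[OF sub], rule subsetI)
    fix m assume "m \<in> monom ` idxn n"
    then obtain v es v' fs w where m: "m = sp v es \<otimes>\<^bsub>L\<^esub> gp v' fs" "rpath v es w" "rpath v' fs w"
      "length fs = n"
      by (auto simp: idx_def idxn_def monom_def)
    show "m \<in> span_of R L (monom ` idxn (Suc n))"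
      unfolding m(1) monom_expand[OF m(2,3)]
    proof (rule L.submodule_finsum[OF sub])
      fix e assume e: "e \<in> in_arcs E w"
      then have "(v, es @ [e], v', fs @ [e]) \<in> idxn (Suc n)"
        using m by (auto simp: idxn_def idx_def rpath_append)
      then show "sp v (es @ [e]) \<otimes>\<^bsub>L\<^esub> gp v' (fs @ [e]) \<in> span_of R L (monom ` idxn (Suc n))"
        using span_of_incl[of "monom ` idxn (Suc n)" R L] by (force simp: monom_def)
    qed
  qed
  have le: "span_of R L (monom ` idxn n) \<subseteq> span_of R L (monom ` idxn m)" if "n \<le> m" for n m
    using that step by (rule lift_Suc_mono_le[rotated])
  let ?U = "\<Union>n. span_of R L (monom ` idxn n)"
  have U: "submodule ?U R L"
  proof (rule L.submoduleI')
    show "?U \<subseteq> carrier L" using L.submoduleE(1)[OF sub] by blast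
    show "\<zero>\<^bsub>L\<^esub> \<in> ?U" using L.submodule_zero[OF sub] by blast
    show "r \<odot>\<^bsub>L\<^esub> a \<in> ?U" if "r \<in> carrier R" "a \<in> ?U" for r a
      using that L.submoduleE(4)[OF sub] by blast
    fix a b assume "a \<in> ?U" "b \<in> ?U"
    then obtain n m where "a \<in> span_of R L (monom ` idxn n)" "b \<in> span_of R L (monom ` idxn m)" by blast
    then have "a \<in> span_of R L (monom ` idxn (max n m))" "b \<in> span_of R L (monom ` idxn (max n m))"
      using le[of n "max n m"] le[of m "max n m"] by auto
    then show "a \<oplus>\<^bsub>L\<^esub> b \<in> ?U" using L.submoduleE(5)[OF sub] by blast
  qed
  have "monom ` idx \<subseteq> ?U"
  proof
    fix m assume "m \<in> monom ` idx"
    then obtain i where i: "i \<in> idx" "m = monom i" by blast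
    then have "i \<in> idxn (length (snd (snd (snd i))))" by (auto simp: idxn_def)
    then obtain n where "m \<in> monom ` idxn n" using i(2) by blast
    then have "m \<in> span_of R L (monom ` idxn n)" by (rule span_of_base)
    then show "m \<in> ?U" by blast
  qed
  then have "span_of R L (monom ` idx) \<subseteq> ?U" by (rule span_of_least[OF U])
  then show "a \<in> carrier L \<Longrightarrow> \<exists>n. a \<in> span_of R L (monom ` idxn n)" using monom_span by auto
qed

end

lemma rng_genideal_least: "rng_ideal K A \<Longrightarrow> S \<subseteq> K \<Longrightarrow> rng_genideal A S \<subseteq> K"
  unfolding rng_genideal_def by blast

lemma rng_genideal_base: "x \<in> S \<Longrightarrow> x \<in> rng_genideal A S"
  unfolding rng_genideal_def by blast

lemma rng_genideal_l_mult: "a \<in> rng_genideal A S \<Longrightarrow> x \<in> carrier A \<Longrightarrow> x \<otimes>\<^bsub>A\<^esub> a \<in> rng_genideal A S"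
  unfolding rng_genideal_def by (auto intro: rng_idealD)

lemma rng_genideal_r_mult: "a \<in> rng_genideal A S \<Longrightarrow> x \<in> carrier A \<Longrightarrow> a \<otimes>\<^bsub>A\<^esub> x \<in> rng_genideal A S"
  unfolding rng_genideal_def by (auto intro: rng_idealD)

context leavitt
begin

section \<open>Scalars and local units\<close>

lemma sum_p_mult_monom:
  assumes "finite V" "V \<subseteq> verts E" "v \<in> V" "rpath v es w" "rpath v' fs w"
  shows "(\<Oplus>\<^bsub>L\<^esub>u\<in>V. p u) \<otimes>\<^bsub>L\<^esub> (sp v es \<otimes>\<^bsub>L\<^esub> gp v' fs) = sp v es \<otimes>\<^bsub>L\<^esub> gp v' fs"
proof -
  note [simp] = sp_closed[OF assms(4)] gp_closed[OF assms(5)]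
  have V: "u \<in> V \<Longrightarrow> p u \<in> carrier L" for u using assms(2) by auto
  have "(\<Oplus>\<^bsub>L\<^esub>u\<in>V. p u) \<otimes>\<^bsub>L\<^esub> (sp v es \<otimes>\<^bsub>L\<^esub> gp v' fs) =
      ((\<Oplus>\<^bsub>L\<^esub>u\<in>V. p u) \<otimes>\<^bsub>L\<^esub> sp v es) \<otimes>\<^bsub>L\<^esub> gp v' fs"
    using V by (subst L.A_m_assoc) (auto intro: L.M.finsum_closed)
  also have "(\<Oplus>\<^bsub>L\<^esub>u\<in>V. p u) \<otimes>\<^bsub>L\<^esub> sp v es = (\<Oplus>\<^bsub>L\<^esub>u\<in>V. p u \<otimes>\<^bsub>L\<^esub> sp v es)"
    by (rule L.finsum_r_mult) (use assms(1) V in auto)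
  also have "\<dots> = (\<Oplus>\<^bsub>L\<^esub>u\<in>V. if v = u then sp v es else \<zero>\<^bsub>L\<^esub>)"
    by (rule L.M.finsum_cong') (use assms(2) in \<open>auto simp: p_mult_sp[OF assms(4)]\<close>)
  also have "\<dots> = sp v es"
    by (rule L.M.finsum_singleton) (use assms(1,3) in auto)
  finally show ?thesis .
qed

lemma local_unit:
  assumes "a \<in> carrier L"
  shows "\<exists>u\<in>carrier L. u \<otimes>\<^bsub>L\<^esub> a = a"
proof -
  let ?p = "\<lambda>V. \<Oplus>\<^bsub>L\<^esub>u\<in>V. p u"
  have pV: "?p V \<in> carrier L" if "V \<subseteq> verts E" for V
    using that by (intro L.M.finsum_closed) auto
  \<comment> \<open>Requiring the identity for all larger \<open>V\<close> as well lets two elements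
    share a unit: for a sum the union of their vertex sets works.\<close>
  define N where "N = {a \<in> carrier L. \<exists>V0. finite V0 \<and> V0 \<subseteq> verts E \<and>
    (\<forall>V. finite V \<and> V0 \<subseteq> V \<and> V \<subseteq> verts E \<longrightarrow> ?p V \<otimes>\<^bsub>L\<^esub> a = a)}"
  have N: "submodule N R L"
  proof (rule L.submoduleI')
    show "N \<subseteq> carrier L" by (auto simp: N_def)
    show "\<zero>\<^bsub>L\<^esub> \<in> N" by (auto simp: N_def pV intro!: exI[of _ "{}"])
  next
    fix a b assume ab: "a \<in> N" "b \<in> N"
    from ab(1) obtain V where V: "a \<in> carrier L" "finite V" "V \<subseteq> verts E"
      "\<forall>U. finite U \<and> V \<subseteq> U \<and> U \<subseteq> verts E \<longrightarrow> ?p U \<otimes>\<^bsub>L\<^esub> a = a"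
      unfolding N_def by blast
    from ab(2) obtain W where W: "b \<in> carrier L" "finite W" "W \<subseteq> verts E"
      "\<forall>U. finite U \<and> W \<subseteq> U \<and> U \<subseteq> verts E \<longrightarrow> ?p U \<otimes>\<^bsub>L\<^esub> b = b"
      unfolding N_def by blast
    show "a \<oplus>\<^bsub>L\<^esub> b \<in> N" unfolding N_def
      by (rule CollectI, intro conjI exI[of _ "V \<union> W"]) (use V W in \<open>simp_all add: L.A_r_distr pV\<close>)
  next
    fix r a assume r: "r \<in> carrier R" and "a \<in> N"
    then obtain V where V: "a \<in> carrier L" "finite V" "V \<subseteq> verts E"
      "\<forall>U. finite U \<and> V \<subseteq> U \<and> U \<subseteq> verts E \<longrightarrow> ?p U \<otimes>\<^bsub>L\<^esub> a = a"
      unfolding N_def by blast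
    show "r \<odot>\<^bsub>L\<^esub> a \<in> N" unfolding N_def
      by (rule CollectI, intro conjI exI[of _ V]) (use V r in \<open>simp_all add: L.smult_r_assoc pV\<close>)
  qed
  have "monom ` idx \<subseteq> N"
  proof
    fix m assume "m \<in> monom ` idx"
    then obtain v es v' fs w where m: "m = sp v es \<otimes>\<^bsub>L\<^esub> gp v' fs" "rpath v es w" "rpath v' fs w"
      by (auto simp: idx_def monom_def)
    have "v \<in> verts E" using m rpath_verts by blast
    then show "m \<in> N"
      unfolding N_def m(1)
      by (intro CollectI conjI exI[of _ "{v}"] allI impI sum_p_mult_monom[OF _ _ _ m(2,3)] L.A_m_closed)
        (use m in auto)
  qed
  then have "span_of R L (monom ` idx) \<subseteq> N" by (rule span_of_least[OF N])
  then have "a \<in> N" using monom_span assms by auto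
  then obtain V where V: "finite V" "V \<subseteq> verts E"
    "\<forall>U. finite U \<and> V \<subseteq> U \<and> U \<subseteq> verts E \<longrightarrow> ?p U \<otimes>\<^bsub>L\<^esub> a = a"
    unfolding N_def by blast
  show ?thesis by (rule bexI[of _ "?p V"]) (simp_all add: V pV)
qed

text \<open>If \<open>u\<close> is a left local unit for \<open>a\<close>, then ra = (ru)a. The
  facts on spans and sums in submodules thus become available for ideals defined without reference
  to scalars.\<close>

lemma rng_ideal_submodule:
  assumes I: "rng_ideal I L"
  shows "submodule I R L"
proof (rule L.submoduleI')
  show "r \<odot>\<^bsub>L\<^esub> a \<in> I" if r: "r \<in> carrier R" and a: "a \<in> I" for r a
  proof -
    have aL: "a \<in> carrier L" using a rng_ideal_subset[OF I] by auto
    then obtain u where u: "u \<in> carrier L" "u \<otimes>\<^bsub>L\<^esub> a = a" using local_unit by blast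
    then have "r \<odot>\<^bsub>L\<^esub> a = (r \<odot>\<^bsub>L\<^esub> u) \<otimes>\<^bsub>L\<^esub> a" using L.smult_l_assoc[of r u a] r aL by simp
    then show ?thesis using rng_idealD(3)[OF I a, of "r \<odot>\<^bsub>L\<^esub> u"] u r by simp
  qed
qed (use rng_idealD(1,2)[OF I] rng_ideal_subset[OF I] in auto)

section \<open>Condition (K) and coefficients\<close>

lemma rpath_unique: "rpath v es w \<Longrightarrow> rpath v es w' \<Longrightarrow> w = w'"
  using rpath_source_unique by blast

lemma rpath_append_iff: "rpath v es u \<Longrightarrow> rpath v (es @ fs) w \<longleftrightarrow> rpath u fs w"
  using rpath_unique by (auto simp: rpath_append)

lemma cycle_at_rpath: "cycle_at E v es \<longleftrightarrow> rpath v es v \<and> es \<noteq> []"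
  unfolding cycle_at_def fin_paths_rpath using rpath_path_source by auto

lemma return_path_rpath:
  "return_path_at E v es \<longleftrightarrow> rpath v es v \<and> es \<noteq> [] \<and> (\<forall>e \<in> set (butlast es). tail E e \<noteq> v)"
  unfolding return_path_at_def fin_paths_rpath using rpath_path_source by auto

text \<open>A proper initial segment that is closed would reach \<open>w\<close> at an edge before
  the last one. In particular, distinct return paths at \<open>w\<close> are incomparable.\<close>

lemma return_path_prefix:
  assumes "return_path_at E w \<alpha>" "rpath w c w" "c \<noteq> []" "prefix c \<alpha>"
  shows "c = \<alpha>"
proof (rule ccontr)
  assume "c \<noteq> \<alpha>"
  then obtain d where d: "\<alpha> = c @ d" "d \<noteq> []" using assms(4) by (auto simp: prefix_def)
  have "tail E (last c) = w"
    using rpath_path_source[OF assms(2)] assms(3) by (simp add: path_source_def)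
  moreover have "last c \<in> set (butlast \<alpha>)" using d assms(3) by (simp add: butlast_append)
  ultimately show False using assms(1) by (auto simp: return_path_rpath)
qed

text \<open>By the preceding lemma a nonempty closed \<open>c\<close> cannot end inside the first
  copy of \<open>\<alpha>\<close>, so a whole copy can be split off and the rest is closed
  again.\<close>

lemma return_path_power_prefix:
  assumes "return_path_at E w \<alpha>"
  shows "rpath w c w \<Longrightarrow> prefix c (concat (replicate k \<alpha>)) \<Longrightarrow> \<exists>j. c = concat (replicate j \<alpha>)"
proof (induction k arbitrary: c)
  case 0
  then show ?case by (auto intro: exI[of _ 0])
next
  case (Suc k)
  show ?case
  proof (cases "c = []")
    case True
    then show ?thesis by (auto intro: exI[of _ 0])
  next
    case False
    from Suc.prems(2) have "prefix c \<alpha> \<or> (\<exists>c'. c = \<alpha> @ c' \<and> prefix c' (concat (replicate k \<alpha>)))"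
      by (simp add: prefix_append)
    then show ?thesis
    proof (elim disjE exE conjE)
      assume "prefix c \<alpha>"
      then have "c = \<alpha>" using return_path_prefix assms Suc.prems(1) False by blast
      then show ?thesis by (intro exI[of _ 1]) simp
    next
      fix c' assume c': "c = \<alpha> @ c'" "prefix c' (concat (replicate k \<alpha>))"
      have "rpath w c' w" using Suc.prems(1) assms c'(1) rpath_append_iff return_path_rpath by blast
      then obtain j where "c' = concat (replicate j \<alpha>)" using Suc.IH c'(2) by blast
      then show ?thesis using c' by (intro exI[of _ "Suc j"]) simp
    qed
  qed
qed

lemma rpath_power: "rpath w \<alpha> w \<Longrightarrow> w \<in> verts E \<Longrightarrow> rpath w (concat (replicate k \<alpha>)) w"
  by (induction k) (auto simp: rpath_append_iff)

text \<open>For nonempty \<open>c\<close>, \<open>prefix y (c @ y)\<close> says that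
  \<open>y\<close> is an initial segment of the periodic path ccc... . At a vertex on no cycle there
  is no such \<open>c\<close>, and the empty path qualifies.\<close>

definition aperiodic :: "nat \<Rightarrow> 'v \<Rightarrow> 'e list \<Rightarrow> bool" where
  "aperiodic N w y \<longleftrightarrow> rpath w y w \<and>
     (\<forall>c. rpath w c w \<longrightarrow> c \<noteq> [] \<longrightarrow> length c \<le> N \<longrightarrow> \<not> prefix y (c @ y))"

text \<open>
  If \<open>\<alpha>\<close> and \<open>\<beta>\<close> are distinct return paths at \<open>w\<close>, the closed path \<open>\<alpha>\<^sup>N\<beta>\<close> is aperiodic, since
  its initial closed subpaths of length at most \<open>N\<close> are powers of \<open>\<alpha>\<close>.
\<close>

lemma condition_K_aperiodic:
  assumes K: "condition_K E" and w: "w \<in> verts E"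
  shows "\<exists>y. aperiodic N w y"
proof (cases "\<exists>es. cycle_at E w es")
  case False
  then have "aperiodic N w []" using w by (auto simp: aperiodic_def cycle_at_rpath)
  then show ?thesis by blast
next
  case True
  then obtain \<alpha> \<beta> where ret: "return_path_at E w \<alpha>" "return_path_at E w \<beta>" and ne: "\<alpha> \<noteq> \<beta>"
    using K w unfolding condition_K_def by blast
  let ?pow = "\<lambda>k. concat (replicate k \<alpha>)"
  have \<alpha>: "rpath w \<alpha> w" "\<alpha> \<noteq> []" and \<beta>: "rpath w \<beta> w" "\<beta> \<noteq> []"
    using ret by (auto simp: return_path_rpath)
  let ?y = "?pow N @ \<beta>"
  have "rpath w ?y w" using rpath_append_iff[OF rpath_power[OF \<alpha>(1) w]] \<beta> by blast
  moreover have "\<not> prefix ?y (c @ ?y)" if c: "rpath w c w" "c \<noteq> []" "length c \<le> N" for c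
  proof
    assume y: "prefix ?y (c @ ?y)"
    \<comment> \<open>Every copy of \<open>\<alpha>\<close> has at least one edge, so
      \<open>N\<close> copies leave room for \<open>c\<close>.\<close>
    have len: "N \<le> length (?pow N)"
      using \<alpha>(2) by (cases \<alpha>) (simp_all add: length_concat sum_list_replicate)
    have "prefix c (c @ ?y)" "prefix (?pow N) (c @ ?y)"
      using y append_prefixD by auto
    then have "prefix c (?pow N)"
      using prefix_length_prefix[of c "c @ ?y" "?pow N"] c(3) len by linarith
    then obtain j where j: "c = ?pow j" using return_path_power_prefix ret(1) c(1) by blast
    with c(2) obtain i where i: "j = Suc i" by (cases j) auto
    \<comment> \<open>Powers of \<open>\<alpha>\<close> commute, so the leading power cancels and
      \<open>\<beta>\<close> becomes a prefix of \<open>?pow j @ \<beta>\<close> with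
      \<open>j > 0\<close>. Then \<open>\<alpha>\<close> and \<open>\<beta>\<close> are comparable,
      which distinct return paths never are.\<close>
    have "?pow j @ ?pow N = ?pow N @ ?pow j"
      by (metis add.commute concat_append replicate_add)
    then have "c @ ?y = ?pow N @ ?pow j @ \<beta>" unfolding j by (metis append.assoc)
    then have "prefix (?pow N @ \<beta>) (?pow N @ (?pow j @ \<beta>))" using y by metis
    then have "prefix \<beta> (?pow j @ \<beta>)" by (simp only: same_prefix_prefix)
    then have "prefix \<beta> (\<alpha> @ (?pow i @ \<beta>))" by (simp add: i)
    then have "prefix \<beta> \<alpha> \<or> prefix \<alpha> \<beta>"
      using prefix_same_cases[of \<beta> "\<alpha> @ (?pow i @ \<beta>)" \<alpha>] by auto
    then show False
      using return_path_prefix[OF ret(1) \<beta>] return_path_prefix[OF ret(2) \<alpha>] ne by auto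
  qed
  ultimately have "aperiodic N w ?y" by (auto simp: aperiodic_def)
  then show ?thesis by blast
qed

text \<open>Comparability would give \<open>es = fs @ c\<close>, where \<open>c\<close> is a
  nonempty closed path at \<open>w\<close> of length at most \<open>N\<close>; cancelling
  \<open>fs\<close> leaves the prefix relation excluded by \<open>aperiodic\<close>.\<close>

lemma aperiodic_not_prefix:
  assumes y: "aperiodic N w y" and es: "rpath v es w" "rpath v fs w" "es \<noteq> fs" "length es \<le> N"
  shows "\<not> prefix (fs @ y) (es @ y)"
proof
  assume pre: "prefix (fs @ y) (es @ y)"
  then have "length fs \<le> length es" using prefix_length_le by force
  moreover have "prefix fs (es @ y)" using pre append_prefixD by blast
  ultimately have "prefix fs es" using prefix_length_prefix[of fs "es @ y" es] by simp
  then obtain c where c: "es = fs @ c" by (auto simp: prefix_def)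
  have "rpath w c w" using es(1,2) rpath_append_iff c by blast
  moreover have "c \<noteq> []" "length c \<le> N" using c es by auto
  moreover have "prefix y (c @ y)" using pre c by simp
  ultimately show False using y by (auto simp: aperiodic_def)
qed

text \<open>Equal length forces \<open>fs = fs0\<close> in the middle product. Both monomials then
  have source \<open>w\<close>, and what remains is a product of \<open>es0 @ y\<close> with
  \<open>es @ y\<close>, which are equal or incomparable.\<close>

lemma extract_coefficient:
  assumes y: "aperiodic N w y"
    and i: "rpath v es u" "rpath v' fs u"
    and j: "rpath v0 es0 w" "rpath v0' fs0 w"
    and len: "length fs = length fs0" "length es \<le> N" "length es0 \<le> N"
  shows "gp v0 (es0 @ y) \<otimes>\<^bsub>L\<^esub> ((sp v es \<otimes>\<^bsub>L\<^esub> gp v' fs) \<otimes>\<^bsub>L\<^esub> sp v0' (fs0 @ y)) =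
    (if (v, es, v', fs) = (v0, es0, v0', fs0) then p w else \<zero>\<^bsub>L\<^esub>)"
proof -
  have yw: "rpath w y w" using y by (auto simp: aperiodic_def)
  have x: "rpath v0 (es0 @ y) w" using j yw rpath_append_iff by blast
  note [simp] = sp_closed[OF i(1)] gp_closed[OF i(2)] sp_closed[OF j(2)] gp_closed[OF j(1)]
    sp_closed[OF yw] gp_closed[OF x]
  have z: "(sp v es \<otimes>\<^bsub>L\<^esub> gp v' fs) \<otimes>\<^bsub>L\<^esub> sp v0' (fs0 @ y) =
      sp v es \<otimes>\<^bsub>L\<^esub> ((gp v' fs \<otimes>\<^bsub>L\<^esub> sp v0' fs0) \<otimes>\<^bsub>L\<^esub> sp w y)"
    using sp_append[OF j(2) yw] by (simp add: mult_middle)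
  show ?thesis
  proof (cases "v' = v0' \<and> fs = fs0")
    case False
    then have "v' \<noteq> v0' \<or> \<not> prefix fs fs0 \<and> \<not> prefix fs0 fs"
      using len(1) by (auto simp: prefix_def)
    then have "gp v' fs \<otimes>\<^bsub>L\<^esub> sp v0' fs0 = \<zero>\<^bsub>L\<^esub>" by (rule gp_sp_zero[OF i(2) j(2)])
    then show ?thesis unfolding z using False by auto
  next
    case True
    then have u: "u = w" using i(2) j(2) rpath_unique by blast
    have yes: "rpath v (es @ y) w" using i(1) u yw rpath_append_iff by blast
    have "sp v es \<otimes>\<^bsub>L\<^esub> ((gp v' fs \<otimes>\<^bsub>L\<^esub> sp v0' fs0) \<otimes>\<^bsub>L\<^esub> sp w y) = sp v (es @ y)"
      using True gp_sp[OF j(2)] p_sp[OF yw] sp_append[of v es w y w] i(1) u yw by simp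
    then have *: "gp v0 (es0 @ y) \<otimes>\<^bsub>L\<^esub> ((sp v es \<otimes>\<^bsub>L\<^esub> gp v' fs) \<otimes>\<^bsub>L\<^esub> sp v0' (fs0 @ y)) =
        gp v0 (es0 @ y) \<otimes>\<^bsub>L\<^esub> sp v (es @ y)" using z by simp
    show ?thesis
    proof (cases "v = v0 \<and> es = es0")
      case True
      then show ?thesis using * gp_sp[OF x] \<open>v' = v0' \<and> fs = fs0\<close> by simp
    next
      case False
      \<comment> \<open>Either of \<open>es\<close> and \<open>es0\<close> may be the longer one,
        which is why \<open>N\<close> bounds both lengths.\<close>
      have "v0 \<noteq> v \<or> \<not> prefix (es0 @ y) (es @ y) \<and> \<not> prefix (es @ y) (es0 @ y)"
        using False aperiodic_not_prefix[OF y, of v es es0] aperiodic_not_prefix[OF y, of v es0 es]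
          i(1) j(1) u len by auto
      then have "gp v0 (es0 @ y) \<otimes>\<^bsub>L\<^esub> sp v (es @ y) = \<zero>\<^bsub>L\<^esub>" by (rule gp_sp_zero[OF x yes])
      then show ?thesis unfolding * using False by auto
    qed
  qed
qed

lemma coefficient_in_ideal:
  assumes K: "condition_K E" and I: "rng_ideal I L"
    and F0: "finite F0" "F0 \<subseteq> idxn n" "c \<in> F0 \<rightarrow> carrier R"
    and a: "(\<Oplus>\<^bsub>L\<^esub>i\<in>F0. c i \<odot>\<^bsub>L\<^esub> monom i) \<in> I"
    and j: "(v0, es0, v0', fs0) \<in> F0" "rpath v0 es0 w" "rpath v0' fs0 w"
  shows "c (v0, es0, v0', fs0) \<odot>\<^bsub>L\<^esub> p w \<in> I"
proof -
  \<comment> \<open>\<open>N\<close> bounds the paths of the whole finite combination, so one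
    \<open>y\<close> suppresses all terms but the chosen one.\<close>
  have "finite ((\<lambda>(v, es, v', fs). length es) ` F0)" using F0(1) by simp
  then obtain N where N: "\<And>v es v' fs. (v, es, v', fs) \<in> F0 \<Longrightarrow> length es \<le> N"
    unfolding finite_nat_set_iff_bounded_le by fastforce
  have w: "w \<in> verts E" using j(2) rpath_verts by blast
  obtain y where y: "aperiodic N w y" using condition_K_aperiodic[OF K w] by blast
  then have yw: "rpath w y w" by (auto simp: aperiodic_def)
  let ?x = "gp v0 (es0 @ y)" and ?z = "sp v0' (fs0 @ y)"
  have xz: "?x \<in> carrier L" "?z \<in> carrier L"
    using j(2,3) yw rpath_append_iff by (auto intro!: gp_closed sp_closed)
  have F0c: "monom i \<in> carrier L" "c i \<in> carrier R" if "i \<in> F0" for i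
    using that F0 monom_closed by (auto simp: idxn_def)
  have "?x \<otimes>\<^bsub>L\<^esub> ((\<Oplus>\<^bsub>L\<^esub>i\<in>F0. c i \<odot>\<^bsub>L\<^esub> monom i) \<otimes>\<^bsub>L\<^esub> ?z) =
      (\<Oplus>\<^bsub>L\<^esub>i\<in>F0. ?x \<otimes>\<^bsub>L\<^esub> ((c i \<odot>\<^bsub>L\<^esub> monom i) \<otimes>\<^bsub>L\<^esub> ?z))"
    using F0(1) F0c xz by (subst L.finsum_r_mult) (auto simp: L.finsum_l_mult)
  also have "\<dots> = (\<Oplus>\<^bsub>L\<^esub>i\<in>F0. if (v0, es0, v0', fs0) = i then c i \<odot>\<^bsub>L\<^esub> p w else \<zero>\<^bsub>L\<^esub>)"
  proof (rule L.M.finsum_cong')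
    fix i assume i: "i \<in> F0"
    obtain v es v' fs where i_eq: "i = (v, es, v', fs)" by (cases i)
    then obtain u where u: "rpath v es u" "rpath v' fs u" and len: "length fs = n"
      using i F0(2) by (auto simp: idxn_def idx_def)
    have len0: "length fs0 = n" using j(1) F0(2) by (auto simp: idxn_def)
    have "?x \<otimes>\<^bsub>L\<^esub> ((c i \<odot>\<^bsub>L\<^esub> monom i) \<otimes>\<^bsub>L\<^esub> ?z) = c i \<odot>\<^bsub>L\<^esub> (?x \<otimes>\<^bsub>L\<^esub> (monom i \<otimes>\<^bsub>L\<^esub> ?z))"
      using F0c[OF i] xz by (simp add: L.smult_l_assoc L.smult_r_assoc)
    also have "?x \<otimes>\<^bsub>L\<^esub> (monom i \<otimes>\<^bsub>L\<^esub> ?z) = (if i = (v0, es0, v0', fs0) then p w else \<zero>\<^bsub>L\<^esub>)"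
      unfolding i_eq monom_def prod.case
      by (rule extract_coefficient[OF y u j(2,3)]) (use len len0 N i i_eq j(1) in auto)
    finally show "?x \<otimes>\<^bsub>L\<^esub> ((c i \<odot>\<^bsub>L\<^esub> monom i) \<otimes>\<^bsub>L\<^esub> ?z) =
        (if (v0, es0, v0', fs0) = i then c i \<odot>\<^bsub>L\<^esub> p w else \<zero>\<^bsub>L\<^esub>)"
      using F0c[OF i] by auto
  qed (use F0c w in auto)
  also have "\<dots> = c (v0, es0, v0', fs0) \<odot>\<^bsub>L\<^esub> p w"
    by (rule L.M.finsum_singleton) (use j(1) F0(1) F0c w in auto)
  finally show ?thesis
    using rng_idealD(3)[OF I rng_idealD(4)[OF I a xz(2)] xz(1)] by simp
qed

section \<open>The spanning theorem for ideals\<close>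

lemma lin_comb_level:
  assumes "a \<in> carrier L"
  obtains n F0 c where "finite F0" "F0 \<subseteq> idxn n" "c \<in> F0 \<rightarrow> carrier R"
    "a = (\<Oplus>\<^bsub>L\<^esub>i\<in>F0. c i \<odot>\<^bsub>L\<^esub> monom i)"
proof -
  obtain n where n: "a \<in> span_of R L (monom ` idxn n)" using monom_span_level assms by blast
  have "monom \<in> idxn n \<rightarrow> carrier L" using monom_closed by (auto simp: idxn_def)
  from L.span_of_lin_comb[OF this n] that show ?thesis by blast
qed

abbreviation ideal_spanning_set where
  "ideal_spanning_set I \<equiv>
     {r \<odot>\<^bsub>L\<^esub> (lpa_path R E \<kappa> \<otimes>\<^bsub>L\<^esub> lpa_ghost R E \<mu>) | r \<kappa> \<mu>.
        r \<in> carrier R \<and> \<kappa> \<in> fin_paths E \<and> \<mu> \<in> fin_paths E \<and>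
        r \<odot>\<^bsub>L\<^esub> lpa_gen R E (Vertex (path_source E \<mu>)) \<in> I}"

lemma fin_paths_cases:
  assumes "\<mu> \<in> fin_paths E"
  obtains v es w where "\<mu> = (v, es)" "rpath v es w" "path_source E \<mu> = w"
    "lpa_path R E \<mu> = sp v es" "lpa_ghost R E \<mu> = gp v es"
proof -
  obtain v es where \<mu>: "\<mu> = (v, es)" by (cases \<mu>)
  then have r: "rpath v es (path_source E \<mu>)" using assms fin_paths_rpath by simp
  show ?thesis
    by (rule that[OF \<mu> r refl]) (simp_all add: \<mu> lpa_path_sp[OF r] lpa_ghost_gp[OF r])
qed

lemma ideal_spanned:
  assumes K: "condition_K E" and I: "rng_ideal I L"
  shows "I = span_of R L (ideal_spanning_set I)"
proof
  let ?S = "ideal_spanning_set I"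
  have SI: "?S \<subseteq> I"
  proof
    fix x assume "x \<in> ?S"
    then obtain r \<kappa> \<mu> where x: "x = r \<odot>\<^bsub>L\<^esub> (lpa_path R E \<kappa> \<otimes>\<^bsub>L\<^esub> lpa_ghost R E \<mu>)" and
      r: "r \<in> carrier R" "r \<odot>\<^bsub>L\<^esub> p (path_source E \<mu>) \<in> I" and *: "\<kappa> \<in> fin_paths E" "\<mu> \<in> fin_paths E"
      by blast
    obtain v es u where \<kappa>: "lpa_path R E \<kappa> = sp v es" "rpath v es u"
      using fin_paths_cases[OF *(1)] by metis
    obtain v' fs w where \<mu>: "lpa_ghost R E \<mu> = gp v' fs" "rpath v' fs w" "path_source E \<mu> = w"
      using fin_paths_cases[OF *(2)] by metis
    note cl = sp_closed[OF \<kappa>(2)] gp_closed[OF \<mu>(2)]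
    have w: "p w \<in> carrier L" using \<mu>(2) rpath_verts by auto
    \<comment> \<open>The two paths may have different sources. The idempotent is therefore taken
      from the ghost factor, whose source \<open>w\<close> is the vertex named in the condition on
      \<open>r\<close>.\<close>
    have "x = sp v es \<otimes>\<^bsub>L\<^esub> ((r \<odot>\<^bsub>L\<^esub> p w) \<otimes>\<^bsub>L\<^esub> gp v' fs)"
      unfolding x \<kappa>(1) \<mu>(1) using cl w r(1) p_gp[OF \<mu>(2)] by (simp add: L.smult_l_assoc L.smult_r_assoc)
    then show "x \<in> I"
      using rng_idealD(3)[OF I rng_idealD(4)[OF I _ cl(2)] cl(1)] r(2) \<mu>(3) by simp
  qed
  then show "span_of R L ?S \<subseteq> I"
    by (rule span_of_least[OF rng_ideal_submodule[OF I]])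
  have sub: "submodule (span_of R L ?S) R L"
    using L.span_of_submodule SI rng_ideal_subset[OF I] by blast
  show "I \<subseteq> span_of R L ?S"
  proof
    fix a assume a: "a \<in> I"
    then have "a \<in> carrier L" using rng_ideal_subset[OF I] by auto
    then obtain n F0 c where F0: "finite F0" "F0 \<subseteq> idxn n" "c \<in> F0 \<rightarrow> carrier R"
      and a_eq: "a = (\<Oplus>\<^bsub>L\<^esub>i\<in>F0. c i \<odot>\<^bsub>L\<^esub> monom i)" by (rule lin_comb_level)
    show "a \<in> span_of R L ?S" unfolding a_eq
    proof (rule L.submodule_finsum[OF sub])
      fix i assume i: "i \<in> F0"
      obtain v es v' fs where i_eq: "i = (v, es, v', fs)" by (cases i)
      then obtain w where w: "rpath v es w" "rpath v' fs w"
        using i F0(2) by (auto simp: idxn_def idx_def)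
      have "c i \<odot>\<^bsub>L\<^esub> p w \<in> I"
        using coefficient_in_ideal[OF K I F0 _ _ w] a a_eq i i_eq by simp
      then have "c i \<odot>\<^bsub>L\<^esub> (lpa_path R E (v, es) \<otimes>\<^bsub>L\<^esub> lpa_ghost R E (v', fs)) \<in> ?S"
        using w i F0(3) rpath_fin_paths rpath_path_source by (intro CollectI) blast
      then show "c i \<odot>\<^bsub>L\<^esub> monom i \<in> span_of R L ?S"
        using lpa_path_sp[OF w(1)] lpa_ghost_gp[OF w(2)] by (simp add: i_eq monom_def span_of_base)
    qed
  qed
qed

section \<open>Saturated hereditary sets and the ideals attached to them\<close>

lemma sat_heredD:
  assumes "H \<in> sat_hered E"
  shows "H \<subseteq> verts E"
    and "\<lbrakk>e \<in> arcs E; head E e \<in> H\<rbrakk> \<Longrightarrow> tail E e \<in> H"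
    and "\<lbrakk>v \<in> verts E; \<And>e. e \<in> in_arcs E v \<Longrightarrow> tail E e \<in> H\<rbrakk> \<Longrightarrow> v \<in> H"
  using assms by (auto simp: sat_hered_def hereditary_def saturated_def)

lemma sat_heredI:
  assumes "H \<subseteq> verts E"
    and "\<And>e. \<lbrakk>e \<in> arcs E; head E e \<in> H\<rbrakk> \<Longrightarrow> tail E e \<in> H"
    and "\<And>v. \<lbrakk>v \<in> verts E; \<And>e. e \<in> in_arcs E v \<Longrightarrow> tail E e \<in> H\<rbrakk> \<Longrightarrow> v \<in> H"
  shows "H \<in> sat_hered E"
proof -
  have "saturated E H"
    unfolding saturated_def
  proof (intro ballI impI)
    fix v assume v: "v \<in> verts E" "tail E ` in_arcs E v \<subseteq> H"
    show "v \<in> H" by (rule assms(3)) (use v in auto)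
  qed
  moreover have "hereditary E H"
    unfolding hereditary_def by (intro ballI impI assms(2))
  ultimately show ?thesis using assms(1) by (simp add: sat_hered_def)
qed

lemma verts_sat_hered: "verts E \<in> sat_hered E"
  by (rule sat_heredI) auto

lemma sat_hered_Inter:
  assumes "\<K> \<noteq> {}" "\<K> \<subseteq> sat_hered E"
  shows "\<Inter>\<K> \<in> sat_hered E"
proof (rule sat_heredI)
  show "\<Inter>\<K> \<subseteq> verts E" using assms sat_heredD(1) by blast
  show "tail E e \<in> \<Inter>\<K>" if "e \<in> arcs E" "head E e \<in> \<Inter>\<K>" for e
    using that assms sat_heredD(2) by blast
  show "v \<in> \<Inter>\<K>" if v: "v \<in> verts E" "\<And>e. e \<in> in_arcs E v \<Longrightarrow> tail E e \<in> \<Inter>\<K>" for v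
  proof
    fix K assume "K \<in> \<K>"
    then show "v \<in> K" using v assms(2) by (intro sat_heredD(3)[of K v]) auto
  qed
qed

lemma sh_join_sat_hered: "\<A> \<subseteq> sat_hered E \<Longrightarrow> sh_join E \<A> \<in> sat_hered E"
  unfolding sh_join_def
  by (rule sat_hered_Inter) (use verts_sat_hered sat_heredD(1) in blast)+

lemma sh_join_upper: "H \<in> \<A> \<Longrightarrow> H \<subseteq> sh_join E \<A>"
  unfolding sh_join_def by blast

lemma sh_join_least: "K \<in> sat_hered E \<Longrightarrow> (\<And>H. H \<in> \<A> \<Longrightarrow> H \<subseteq> K) \<Longrightarrow> sh_join E \<A> \<subseteq> K"
  unfolding sh_join_def by blast

text \<open>Every saturated hereditary set is a join of such sets, so they reduce a function
  \<open>\<pi>\<close> to a family of ideals indexed by vertices.\<close>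

definition hull1 :: "'v \<Rightarrow> 'v set" where
  "hull1 v = \<Inter> {K \<in> sat_hered E. v \<in> K}"

lemma hull1_sat_hered: "v \<in> verts E \<Longrightarrow> hull1 v \<in> sat_hered E"
  unfolding hull1_def by (rule sat_hered_Inter) (use verts_sat_hered in auto)

lemma hull1_mem: "v \<in> hull1 v"
  unfolding hull1_def by blast

lemma hull1_least: "K \<in> sat_hered E \<Longrightarrow> v \<in> K \<Longrightarrow> hull1 v \<subseteq> K"
  unfolding hull1_def by blast

lemma ideal_functionsD:
  assumes "\<pi> \<in> ideal_functions R E"
  shows "H \<in> sat_hered E \<Longrightarrow> ideal (\<pi> H) R"
    and "\<A> \<subseteq> sat_hered E \<Longrightarrow> \<pi> (sh_join E \<A>) = carrier R \<inter> (\<Inter>H \<in> \<A>. \<pi> H)"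
    and "\<pi> \<in> extensional (sat_hered E)"
  using assms by (auto simp: ideal_functions_def PiE_def Pi_def)

lemma ideal_function_carrier:
  assumes "\<pi> \<in> ideal_functions R E" "H \<in> sat_hered E" "r \<in> \<pi> H"
  shows "r \<in> carrier R"
  using ideal.Icarr[OF ideal_functionsD(1)[OF assms(1,2)]] assms(3) by blast

text \<open>\<open>K\<close> is the join of \<open>H\<close> and \<open>K\<close>, so its value is
  the intersection of both values.\<close>

lemma ideal_function_antimono:
  assumes \<pi>: "\<pi> \<in> ideal_functions R E" and "H \<in> sat_hered E" "K \<in> sat_hered E" "H \<subseteq> K"
  shows "\<pi> K \<subseteq> \<pi> H"
proof -
  have "sh_join E {H, K} = K"
    using sh_join_upper[of K "{H, K}"] sh_join_least[of K "{H, K}"] assms by blast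
  then show ?thesis using ideal_functionsD(2)[OF \<pi>, of "{H, K}"] assms by auto
qed

text \<open>\<open>H\<close> is the join of the hulls of its vertices, hence \<open>\<pi> H\<close>
  is the intersection of the ideals at these hulls.\<close>

lemma ideal_function_Inter_hull1:
  assumes \<pi>: "\<pi> \<in> ideal_functions R E" and H: "H \<in> sat_hered E"
    and r: "r \<in> carrier R" "\<And>v. v \<in> H \<Longrightarrow> r \<in> \<pi> (hull1 v)"
  shows "r \<in> \<pi> H"
proof -
  have sub: "hull1 ` H \<subseteq> sat_hered E" using hull1_sat_hered sat_heredD(1)[OF H] by blast
  have "sh_join E (hull1 ` H) = H"
  proof
    show "sh_join E (hull1 ` H) \<subseteq> H" by (rule sh_join_least[OF H]) (use hull1_least[OF H] in auto)
    show "H \<subseteq> sh_join E (hull1 ` H)"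
      using sh_join_upper[of "hull1 _" "hull1 ` H"] hull1_mem by blast
  qed
  then show ?thesis using ideal_functionsD(2)[OF \<pi> sub] r by auto
qed

text \<open>By saturation \<open>v\<close> lies in the join of the hulls of the tails, so this join
  contains \<open>hull1 v\<close>. In contrapositive form the lemma extends a path by an edge at
  whose tail \<open>r\<close> is still excluded.\<close>

lemma ideal_function_hull1_saturated:
  assumes \<pi>: "\<pi> \<in> ideal_functions R E" and v: "v \<in> verts E" and r: "r \<in> carrier R"
    and tails: "\<And>e. e \<in> in_arcs E v \<Longrightarrow> r \<in> \<pi> (hull1 (tail E e))"
  shows "r \<in> \<pi> (hull1 v)"
proof -
  let ?A = "(\<lambda>e. hull1 (tail E e)) ` in_arcs E v"
  have sub: "?A \<subseteq> sat_hered E" using hull1_sat_hered by auto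
  have "r \<in> \<pi> (sh_join E ?A)" using ideal_functionsD(2)[OF \<pi> sub] r tails by auto
  moreover have "v \<in> sh_join E ?A"
  proof (rule sat_heredD(3)[OF sh_join_sat_hered[OF sub] v])
    show "tail E e \<in> sh_join E ?A" if "e \<in> in_arcs E v" for e
      using sh_join_upper[of "hull1 (tail E e)" ?A] hull1_mem that by blast
  qed
  ultimately show ?thesis
    using ideal_function_antimono[OF \<pi> hull1_sat_hered[OF v] sh_join_sat_hered[OF sub]]
      hull1_least[OF sh_join_sat_hered[OF sub]] by blast
qed

text \<open>For an edge \<open>e\<close>, multiplying \<open>r p (head E e)\<close> by
  \<open>t e\<close> and \<open>s e\<close> gives \<open>r p (tail E e)\<close>, so the set is
  hereditary; the Cuntz--Krieger sum gives saturation.\<close>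

lemma vertex_set_sat_hered:
  assumes I: "rng_ideal I L" and r: "r \<in> carrier R"
  shows "{v \<in> verts E. r \<odot>\<^bsub>L\<^esub> p v \<in> I} \<in> sat_hered E"
proof (rule sat_heredI)
  fix e assume e: "e \<in> arcs E" and "head E e \<in> {v \<in> verts E. r \<odot>\<^bsub>L\<^esub> p v \<in> I}"
  then have *: "r \<odot>\<^bsub>L\<^esub> p (head E e) \<in> I" by simp
  have "t e \<otimes>\<^bsub>L\<^esub> ((r \<odot>\<^bsub>L\<^esub> p (head E e)) \<otimes>\<^bsub>L\<^esub> s e) = r \<odot>\<^bsub>L\<^esub> p (tail E e)"
    using e r by (simp add: L.smult_l_assoc L.smult_r_assoc)
  then show "tail E e \<in> {v \<in> verts E. r \<odot>\<^bsub>L\<^esub> p v \<in> I}"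
    using rng_idealD(3)[OF I rng_idealD(4)[OF I *, of "s e"], of "t e"] e by simp
next
  fix v assume v: "v \<in> verts E"
    and tails: "\<And>e. e \<in> in_arcs E v \<Longrightarrow> tail E e \<in> {v \<in> verts E. r \<odot>\<^bsub>L\<^esub> p v \<in> I}"
  have "r \<odot>\<^bsub>L\<^esub> p v = (\<Oplus>\<^bsub>L\<^esub>e\<in>in_arcs E v. r \<odot>\<^bsub>L\<^esub> (s e \<otimes>\<^bsub>L\<^esub> t e))"
    unfolding p_sum[OF v] using v r by (intro L.finsum_smult_ldistr) auto
  also have "\<dots> = (\<Oplus>\<^bsub>L\<^esub>e\<in>in_arcs E v. s e \<otimes>\<^bsub>L\<^esub> ((r \<odot>\<^bsub>L\<^esub> p (tail E e)) \<otimes>\<^bsub>L\<^esub> t e))"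
    using r by (intro L.M.finsum_cong') (auto simp: L.smult_l_assoc L.smult_r_assoc)
  also have "\<dots> \<in> I"
    by (rule L.submodule_finsum[OF rng_ideal_submodule[OF I]])
      (use tails rng_idealD(3,4)[OF I] in auto)
  finally show "v \<in> {v \<in> verts E. r \<odot>\<^bsub>L\<^esub> p v \<in> I}" using v by simp
qed auto

section \<open>From ideals of the algebra to functions on saturated hereditary sets\<close>

definition ideal_function_of :: "(('v, 'e) lgen list \<Rightarrow> 'a) set set \<Rightarrow> 'v set \<Rightarrow> 'a set" where
  "ideal_function_of I = (\<lambda>H \<in> sat_hered E. {r \<in> carrier R. \<forall>v \<in> H. r \<odot>\<^bsub>L\<^esub> p v \<in> I})"

lemma scalars_ideal:
  assumes I: "rng_ideal I L" and H: "H \<subseteq> verts E"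
  shows "ideal {r \<in> carrier R. \<forall>v \<in> H. r \<odot>\<^bsub>L\<^esub> p v \<in> I} R"
proof (rule idealI[OF cring.axioms(1)[OF is_cring]])
  note sub = rng_ideal_submodule[OF I]
  have pH: "v \<in> H \<Longrightarrow> p v \<in> carrier L" for v using H by auto
  show "subgroup {r \<in> carrier R. \<forall>v \<in> H. r \<odot>\<^bsub>L\<^esub> p v \<in> I} (add_monoid R)"
    by (rule add.subgroupI)
      (use pH L.submodule_zero[OF sub] L.submoduleE(3,5)[OF sub] in
        \<open>auto simp: L.smult_l_minus L.smult_l_distr a_inv_def[symmetric] intro!: exI[of _ \<zero>]\<close>)
  show "x \<otimes> a \<in> {r \<in> carrier R. \<forall>v \<in> H. r \<odot>\<^bsub>L\<^esub> p v \<in> I}"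
    if "a \<in> {r \<in> carrier R. \<forall>v \<in> H. r \<odot>\<^bsub>L\<^esub> p v \<in> I}" "x \<in> carrier R" for a x
    using that pH L.submoduleE(4)[OF sub] by (auto simp: L.smult_assoc1)
  then show "a \<otimes> x \<in> {r \<in> carrier R. \<forall>v \<in> H. r \<odot>\<^bsub>L\<^esub> p v \<in> I}"
    if "a \<in> {r \<in> carrier R. \<forall>v \<in> H. r \<odot>\<^bsub>L\<^esub> p v \<in> I}" "x \<in> carrier R" for a x
    using that m_comm[of a x] by auto
qed

lemma ideal_function_of_mem:
  assumes I: "rng_ideal I L"
  shows "ideal_function_of I \<in> ideal_functions R E"
  unfolding ideal_functions_def
proof (intro CollectI conjI allI impI)
  show "ideal_function_of I \<in> sat_hered E \<rightarrow>\<^sub>E {I. ideal I R}"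
    using scalars_ideal[OF I] sat_heredD(1) by (auto simp: ideal_function_of_def)
  fix \<A> assume A: "\<A> \<subseteq> sat_hered E"
  show "ideal_function_of I (sh_join E \<A>) = carrier R \<inter> (\<Inter>H \<in> \<A>. ideal_function_of I H)"
  proof (intro equalityI subsetI)
    fix r assume "r \<in> ideal_function_of I (sh_join E \<A>)"
    then show "r \<in> carrier R \<inter> (\<Inter>H \<in> \<A>. ideal_function_of I H)"
      using A sh_join_sat_hered[OF A] sh_join_upper by (fastforce simp: ideal_function_of_def)
  next
    fix r assume r: "r \<in> carrier R \<inter> (\<Inter>H \<in> \<A>. ideal_function_of I H)"
    have rp: "r \<odot>\<^bsub>L\<^esub> p v \<in> I" if "H \<in> \<A>" "v \<in> H" for H v
    proof -
      have "r \<in> ideal_function_of I H" "H \<in> sat_hered E" using r A that(1) by auto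
      then show ?thesis using that(2) by (simp add: ideal_function_of_def)
    qed
    have "sh_join E \<A> \<subseteq> {v \<in> verts E. r \<odot>\<^bsub>L\<^esub> p v \<in> I}"
    proof (rule sh_join_least[OF vertex_set_sat_hered[OF I]])
      show "r \<in> carrier R" using r by simp
      fix H assume H: "H \<in> \<A>"
      then have "H \<subseteq> verts E" using A sat_heredD(1)[of H] by auto
      then show "H \<subseteq> {v \<in> verts E. r \<odot>\<^bsub>L\<^esub> p v \<in> I}" using rp[OF H] by auto
    qed
    then show "r \<in> ideal_function_of I (sh_join E \<A>)"
      using r sh_join_sat_hered[OF A] by (auto simp: ideal_function_of_def)
  qed
qed

section \<open>The ideal attached to a function\<close>

abbreviation Gamma_set where
  "Gamma_set \<pi> \<equiv> {r \<odot>\<^bsub>L\<^esub> (lpa_path R E \<mu> \<otimes>\<^bsub>L\<^esub> lpa_ghost R E \<nu>) | r \<mu> \<nu>.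
        \<mu> \<in> fin_paths E \<and> \<nu> \<in> fin_paths E \<and>
        (\<exists>H \<in> sat_hered E. r \<in> \<pi> H \<and>
           lpa_path R E \<mu> \<otimes>\<^bsub>L\<^esub> lpa_ghost R E \<nu> \<in> vertex_ideal R E H)}"

text \<open>\<open>Gamma_set\<close> runs over arbitrary pairs of paths; a pair with different
  sources contributes zero, since the two vertex idempotents in the middle are orthogonal.\<close>

lemma path_ghost_mem:
  assumes "\<mu> \<in> fin_paths E" "\<nu> \<in> fin_paths E"
  shows "lpa_path R E \<mu> \<otimes>\<^bsub>L\<^esub> lpa_ghost R E \<nu> \<in> insert \<zero>\<^bsub>L\<^esub> (monom ` idx)"
proof -
  obtain v es u where \<mu>: "lpa_path R E \<mu> = sp v es" "rpath v es u"
    using fin_paths_cases[OF assms(1)] by metis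
  obtain v' fs w where \<nu>: "lpa_ghost R E \<nu> = gp v' fs" "rpath v' fs w"
    using fin_paths_cases[OF assms(2)] by metis
  show ?thesis
  proof (cases "u = w")
    case True
    then show ?thesis using monom_memI \<mu> \<nu> by auto
  next
    case False
    note [simp] = sp_closed[OF \<mu>(2)] gp_closed[OF \<nu>(2)] rpath_verts[OF \<mu>(2)] rpath_verts[OF \<nu>(2)]
    have "sp v es \<otimes>\<^bsub>L\<^esub> gp v' fs = (sp v es \<otimes>\<^bsub>L\<^esub> p u) \<otimes>\<^bsub>L\<^esub> (p w \<otimes>\<^bsub>L\<^esub> gp v' fs)"
      using sp_p[OF \<mu>(2)] p_gp[OF \<nu>(2)] by simp
    also have "\<dots> = \<zero>\<^bsub>L\<^esub>" using False by (subst mult_middle) (auto simp: p_orth)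
    finally show ?thesis using \<mu>(1) \<nu>(1) by simp
  qed
qed

lemma monom_path_ghost:
  assumes "m \<in> monom ` idx"
  obtains \<mu> \<nu> where "\<mu> \<in> fin_paths E" "\<nu> \<in> fin_paths E" "m = lpa_path R E \<mu> \<otimes>\<^bsub>L\<^esub> lpa_ghost R E \<nu>"
proof -
  obtain v es v' fs w where m: "m = sp v es \<otimes>\<^bsub>L\<^esub> gp v' fs" "rpath v es w" "rpath v' fs w"
    using assms by (auto simp: idx_def monom_def)
  show ?thesis
    by (rule that[OF rpath_fin_paths[OF m(2)] rpath_fin_paths[OF m(3)]])
      (simp add: m(1) lpa_path_sp[OF m(2)] lpa_ghost_gp[OF m(3)])
qed

lemma Gamma_set_carrier:
  assumes "\<pi> \<in> ideal_functions R E"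
  shows "Gamma_set \<pi> \<subseteq> carrier L"
proof
  fix x assume "x \<in> Gamma_set \<pi>"
  then obtain r \<mu> \<nu> H where x: "x = r \<odot>\<^bsub>L\<^esub> (lpa_path R E \<mu> \<otimes>\<^bsub>L\<^esub> lpa_ghost R E \<nu>)"
    "\<mu> \<in> fin_paths E" "\<nu> \<in> fin_paths E" "H \<in> sat_hered E" "r \<in> \<pi> H" by blast
  then show "x \<in> carrier L"
    using path_ghost_mem[OF x(2,3)] monom_closed ideal_function_carrier[OF assms] by auto
qed

text \<open>A generator times a monomial is again a monomial or zero and stays in the vertex ideal
  of the same \<open>H\<close>, so \<open>r\<close> and \<open>H\<close> remain witnesses for the
  product.\<close>

lemma Gamma_absorb:
  assumes \<pi>: "\<pi> \<in> ideal_functions R E" and a: "a \<in> Gamma_ideal R E \<pi>" and x: "x \<in> lgens E"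
  shows "gen x \<otimes>\<^bsub>L\<^esub> a \<in> Gamma_ideal R E \<pi>" "a \<otimes>\<^bsub>L\<^esub> gen x \<in> Gamma_ideal R E \<pi>"
proof -
  let ?G = "Gamma_ideal R E \<pi>"
  note gx = gen_carrier[OF x]
  have sub: "submodule ?G R L"
    unfolding Gamma_ideal_def using Gamma_set_carrier[OF \<pi>] by (rule L.span_of_submodule)
  have base: "r \<odot>\<^bsub>L\<^esub> m \<in> ?G"
    if m: "r \<in> \<pi> H" "H \<in> sat_hered E" "m \<in> vertex_ideal R E H" "m \<in> insert \<zero>\<^bsub>L\<^esub> (monom ` idx)" for r H m
  proof (cases "m = \<zero>\<^bsub>L\<^esub>")
    case True
    then show ?thesis using L.submodule_zero[OF sub] ideal_function_carrier[OF \<pi> m(2,1)] by simp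
  next
    case False
    then obtain \<mu> \<nu> where "\<mu> \<in> fin_paths E" "\<nu> \<in> fin_paths E" "m = lpa_path R E \<mu> \<otimes>\<^bsub>L\<^esub> lpa_ghost R E \<nu>"
      using monom_path_ghost m(4) by blast
    then have "r \<odot>\<^bsub>L\<^esub> m \<in> Gamma_set \<pi>" using m(1-3) by blast
    then show ?thesis unfolding Gamma_ideal_def by (rule span_of_base)
  qed
  have gens: "gen x \<otimes>\<^bsub>L\<^esub> b \<in> ?G \<and> b \<otimes>\<^bsub>L\<^esub> gen x \<in> ?G \<and> b \<in> carrier L" if b: "b \<in> Gamma_set \<pi>" for b
  proof -
    obtain r \<mu> \<nu> H where *: "\<mu> \<in> fin_paths E" "\<nu> \<in> fin_paths E" "H \<in> sat_hered E" "r \<in> \<pi> H"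
      and m: "lpa_path R E \<mu> \<otimes>\<^bsub>L\<^esub> lpa_ghost R E \<nu> \<in> vertex_ideal R E H"
      and b_eq: "b = r \<odot>\<^bsub>L\<^esub> (lpa_path R E \<mu> \<otimes>\<^bsub>L\<^esub> lpa_ghost R E \<nu>)"
      using b by blast
    define m where "m = lpa_path R E \<mu> \<otimes>\<^bsub>L\<^esub> lpa_ghost R E \<nu>"
    have mV: "m \<in> vertex_ideal R E H" using m m_def by simp
    have mi: "m \<in> insert \<zero>\<^bsub>L\<^esub> (monom ` idx)" unfolding m_def by (rule path_ghost_mem[OF *(1,2)])
    have mc: "m \<in> carrier L" using mi monom_closed by auto
    have r: "r \<in> carrier R" using ideal_function_carrier[OF \<pi> *(3,4)] .
    have "gen x \<otimes>\<^bsub>L\<^esub> m \<in> insert \<zero>\<^bsub>L\<^esub> (monom ` idx)" "m \<otimes>\<^bsub>L\<^esub> gen x \<in> insert \<zero>\<^bsub>L\<^esub> (monom ` idx)"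
      using mi gen_mult_monom[OF x, of m] monom_mult_gen[OF x, of m] gx by fastforce+
    moreover have "gen x \<otimes>\<^bsub>L\<^esub> m \<in> vertex_ideal R E H" "m \<otimes>\<^bsub>L\<^esub> gen x \<in> vertex_ideal R E H"
      using mV gx unfolding vertex_ideal_def by (auto intro: rng_genideal_l_mult rng_genideal_r_mult)
    ultimately have "r \<odot>\<^bsub>L\<^esub> (gen x \<otimes>\<^bsub>L\<^esub> m) \<in> ?G" "r \<odot>\<^bsub>L\<^esub> (m \<otimes>\<^bsub>L\<^esub> gen x) \<in> ?G"
      using base[OF *(4,3)] by blast+
    then show ?thesis
      unfolding b_eq m_def[symmetric] using L.smult_l_assoc[OF r mc gx] L.smult_r_assoc[OF r gx mc] r mc by simp
  qed
  have l: "?G \<subseteq> {a \<in> carrier L. gen x \<otimes>\<^bsub>L\<^esub> a \<in> ?G}"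
    by (subst (1) Gamma_ideal_def, rule span_of_least[OF L.l_mult_submodule[OF sub gx]]) (use gens in blast)
  have r: "?G \<subseteq> {a \<in> carrier L. a \<otimes>\<^bsub>L\<^esub> gen x \<in> ?G}"
    by (subst (1) Gamma_ideal_def, rule span_of_least[OF L.r_mult_submodule[OF sub gx]]) (use gens in blast)
  show "gen x \<otimes>\<^bsub>L\<^esub> a \<in> ?G" "a \<otimes>\<^bsub>L\<^esub> gen x \<in> ?G" using l r a by auto
qed

lemma Gamma_ideal_rng_ideal:
  assumes \<pi>: "\<pi> \<in> ideal_functions R E"
  shows "rng_ideal (Gamma_ideal R E \<pi>) L"
proof -
  have "alg_ideal (Gamma_ideal R E \<pi>) R L"
  proof (rule L.alg_ideal_generators[where X = "gen ` lgens E"])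
    show "submodule (Gamma_ideal R E \<pi>) R L"
      unfolding Gamma_ideal_def using Gamma_set_carrier[OF \<pi>] by (rule L.span_of_submodule)
    show "gen ` lgens E \<subseteq> carrier L" using gen_carrier by blast
    show "carrier L \<subseteq> B" if "submodule B R L" "gen ` lgens E \<subseteq> B"
      "\<And>x b. x \<in> gen ` lgens E \<Longrightarrow> b \<in> B \<Longrightarrow> x \<otimes>\<^bsub>L\<^esub> b \<in> B" for B
      by (rule L_generated[OF that(1)]) (use that(2,3) in auto)
  qed (use Gamma_absorb[OF \<pi>] in auto)
  then show ?thesis by (simp add: alg_ideal_def)
qed

lemma Gamma_ideal_function_of:
  assumes K: "condition_K E" and I: "rng_ideal I L"
  shows "Gamma_ideal R E (ideal_function_of I) = I"
proof
  let ?\<pi> = "ideal_function_of I"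
  note sub = rng_ideal_submodule[OF I]
  show "Gamma_ideal R E ?\<pi> \<subseteq> I"
    unfolding Gamma_ideal_def
  proof (rule span_of_least[OF sub], rule subsetI)
    fix x assume "x \<in> Gamma_set ?\<pi>"
    then obtain r H m where x: "x = r \<odot>\<^bsub>L\<^esub> m" and H: "H \<in> sat_hered E" "r \<in> ?\<pi> H"
      and m: "m \<in> vertex_ideal R E H" by blast
    have r: "r \<in> carrier R" "\<And>v. v \<in> H \<Longrightarrow> r \<odot>\<^bsub>L\<^esub> p v \<in> I" using H by (auto simp: ideal_function_of_def)
    \<comment> \<open>This ideal contains the generators of \<open>vertex_ideal R E H\<close>, hence
      all of it; no explicit description of the vertex ideal is required.\<close>
    have "alg_ideal {a \<in> carrier L. r \<odot>\<^bsub>L\<^esub> a \<in> I} R L"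
    proof (rule L.alg_idealI, rule L.submoduleI')
      show "s \<odot>\<^bsub>L\<^esub> a \<in> {a \<in> carrier L. r \<odot>\<^bsub>L\<^esub> a \<in> I}"
        if "s \<in> carrier R" "a \<in> {a \<in> carrier L. r \<odot>\<^bsub>L\<^esub> a \<in> I}" for s a
      proof -
        have "r \<odot>\<^bsub>L\<^esub> (s \<odot>\<^bsub>L\<^esub> a) = s \<odot>\<^bsub>L\<^esub> (r \<odot>\<^bsub>L\<^esub> a)"
          using that r(1) L.smult_assoc1[of r s a] L.smult_assoc1[of s r a] m_comm[of r s] by simp
        then show ?thesis using that L.submoduleE(4)[OF sub] by simp
      qed
      show "y \<otimes>\<^bsub>L\<^esub> a \<in> {a \<in> carrier L. r \<odot>\<^bsub>L\<^esub> a \<in> I}" "a \<otimes>\<^bsub>L\<^esub> y \<in> {a \<in> carrier L. r \<odot>\<^bsub>L\<^esub> a \<in> I}"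
        if "a \<in> {a \<in> carrier L. r \<odot>\<^bsub>L\<^esub> a \<in> I}" "y \<in> carrier L" for a y
        using that r(1) rng_idealD(3,4)[OF I, of "r \<odot>\<^bsub>L\<^esub> a" y]
        by (simp_all add: L.smult_l_assoc L.smult_r_assoc)
    qed (use r(1) L.submodule_zero[OF sub] L.submoduleE(5)[OF sub] in \<open>auto simp: L.smult_r_distr\<close>)
    then have "rng_ideal {a \<in> carrier L. r \<odot>\<^bsub>L\<^esub> a \<in> I} L" by (simp add: alg_ideal_def)
    then have "vertex_ideal R E H \<subseteq> {a \<in> carrier L. r \<odot>\<^bsub>L\<^esub> a \<in> I}"
      unfolding vertex_ideal_def
      by (rule rng_genideal_least) (use r(2) sat_heredD(1)[OF H(1)] in auto)
    then show "x \<in> I" using m x by auto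
  qed
  have "ideal_spanning_set I \<subseteq> Gamma_set ?\<pi>"
  proof
    fix x assume "x \<in> ideal_spanning_set I"
    then obtain r \<kappa> \<mu> where x: "x = r \<odot>\<^bsub>L\<^esub> (lpa_path R E \<kappa> \<otimes>\<^bsub>L\<^esub> lpa_ghost R E \<mu>)" and
      r: "r \<in> carrier R" "r \<odot>\<^bsub>L\<^esub> p (path_source E \<mu>) \<in> I" and *: "\<kappa> \<in> fin_paths E" "\<mu> \<in> fin_paths E"
      by blast
    obtain v es u where \<kappa>: "lpa_path R E \<kappa> = sp v es" "rpath v es u"
      using fin_paths_cases[OF *(1)] by metis
    obtain v' fs w where \<mu>: "lpa_ghost R E \<mu> = gp v' fs" "rpath v' fs w" "path_source E \<mu> = w"
      using fin_paths_cases[OF *(2)] by metis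
    note cl = sp_closed[OF \<kappa>(2)] gp_closed[OF \<mu>(2)]
    \<comment> \<open>The largest set at which the value of \<open>ideal_function_of I\<close>
      contains \<open>r\<close>.\<close>
    let ?H = "{v \<in> verts E. r \<odot>\<^bsub>L\<^esub> p v \<in> I}"
    have H: "?H \<in> sat_hered E" by (rule vertex_set_sat_hered[OF I r(1)])
    moreover have "r \<in> ?\<pi> ?H" using H r(1) by (simp add: ideal_function_of_def)
    moreover have "lpa_path R E \<kappa> \<otimes>\<^bsub>L\<^esub> lpa_ghost R E \<mu> \<in> vertex_ideal R E ?H"
    proof -
      have "w \<in> ?H" using \<mu>(2,3) r(2) rpath_verts by auto
      then have "p w \<in> vertex_ideal R E ?H" unfolding vertex_ideal_def by (intro rng_genideal_base) blast
      then have "sp v es \<otimes>\<^bsub>L\<^esub> (p w \<otimes>\<^bsub>L\<^esub> gp v' fs) \<in> vertex_ideal R E ?H"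
        unfolding vertex_ideal_def by (intro rng_genideal_l_mult rng_genideal_r_mult cl)
      then show ?thesis using p_gp[OF \<mu>(2)] \<kappa>(1) \<mu>(1) by simp
    qed
    ultimately show "x \<in> Gamma_set ?\<pi>" using x * by blast
  qed
  then have "span_of R L (ideal_spanning_set I) \<subseteq> Gamma_ideal R E ?\<pi>"
    unfolding Gamma_ideal_def by (rule span_of_mono)
  then show "I \<subseteq> Gamma_ideal R E ?\<pi>" using ideal_spanned[OF K I] by simp
qed

section \<open>The representation on infinite paths\<close>

definition inf_paths :: "(nat \<Rightarrow> 'e) set" where
  "inf_paths = {x. \<forall>i. x i \<in> arcs E \<and> tail E (x i) = head E (x (Suc i))}"

text \<open>The classical representation on infinite paths by prepending and deleting a first edge,
  with \<open>None\<close> for the zero vector. It is defined on all edge sequences;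
  \<open>act1_inf_paths\<close> shows that it preserves infinite paths.\<close>

fun act1 :: "('v, 'e) lgen \<Rightarrow> (nat \<Rightarrow> 'e) \<Rightarrow> (nat \<Rightarrow> 'e) option" where
  "act1 (Vertex v) x = (if head E (x 0) = v then Some x else None)"
| "act1 (Edge e) x = (if tail E e = head E (x 0) then Some (case_nat e x) else None)"
| "act1 (Ghost e) x = (if x 0 = e then Some (\<lambda>n. x (Suc n)) else None)"

fun act :: "('v, 'e) lgen list \<Rightarrow> (nat \<Rightarrow> 'e) \<Rightarrow> (nat \<Rightarrow> 'e) option" where
  "act [] x = Some x"
| "act (a # w) x = Option.bind (act w x) (act1 a)"

lemma act_append: "act (u @ v) x = Option.bind (act v x) (act u)"
  by (induction u) (auto simp: Option.bind_assoc)

lemma case_nat_shift: "case_nat (x 0) (\<lambda>n. x (Suc n)) = x"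
  by (auto simp: fun_eq_iff split: nat.split)

text \<open>Generators act as partial injections, so a row of the matrix of a generator has at most
  one nonzero entry. Left multiplication by a generator is then a mere change of row.\<close>

lemma act1_inj: "act1 a x = Some z \<Longrightarrow> act1 a y = Some z \<Longrightarrow> x = y"
proof (cases a)
  case (Edge e)
  assume "act1 a x = Some z" "act1 a y = Some z"
  then have "case_nat e x = case_nat e y" using Edge by (auto split: if_splits)
  then have "case_nat e x (Suc n) = case_nat e y (Suc n)" for n by (rule fun_cong)
  then show ?thesis by (simp add: fun_eq_iff)
next
  case (Ghost e)
  assume "act1 a x = Some z" "act1 a y = Some z"
  then have "x = case_nat e z" "y = case_nat e z"
    using Ghost case_nat_shift[of x] case_nat_shift[of y] by (auto split: if_splits)
  then show ?thesis by simp
qed (auto split: if_splits)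

lemma act1_inf_paths:
  assumes "a \<in> lgens E" "x \<in> inf_paths" "act1 a x = Some y"
  shows "y \<in> inf_paths"
  using assms by (cases a) (auto simp: inf_paths_def split: if_splits nat.split)

text \<open>The matrix coefficient at \<open>(x, y)\<close> of the action of \<open>f\<close> on the free module on infinite paths.\<close>

definition coef :: "(('v, 'e) lgen list \<Rightarrow> 'a) \<Rightarrow> (nat \<Rightarrow> 'e) \<Rightarrow> (nat \<Rightarrow> 'e) \<Rightarrow> 'a" where
  "coef f x y = (\<Oplus>w\<in>{w. f w \<noteq> \<zero>}. if act w y = Some x then f w else \<zero>)"

lemma coef_superset:
  assumes "f \<in> carrier F" "finite W" "{w. f w \<noteq> \<zero>} \<subseteq> W"
  shows "coef f x y = (\<Oplus>w\<in>W. if act w y = Some x then f w else \<zero>)"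
  unfolding coef_def
  by (rule add.finprod_mono_neutral_cong_left) (use assms F_valueD[OF assms(1)] in auto)

lemma coef_closed [simp]: "f \<in> carrier F \<Longrightarrow> coef f x y \<in> carrier R"
  unfolding coef_def using F_valueD by (intro finsum_closed) auto

lemma coef_add:
  assumes f: "f \<in> carrier F" and g: "g \<in> carrier F"
  shows "coef (f \<oplus>\<^bsub>F\<^esub> g) x y = coef f x y \<oplus> coef g x y"
proof -
  let ?W = "{w. f w \<noteq> \<zero>} \<union> {w. g w \<noteq> \<zero>}"
  have W: "finite ?W" using f g by (simp add: F_simps)
  have sub: "{w. (f \<oplus>\<^bsub>F\<^esub> g) w \<noteq> \<zero>} \<subseteq> ?W" by (auto simp: F_simps)
  have "coef f x y \<oplus> coef g x y =
      (\<Oplus>w\<in>?W. if act w y = Some x then f w else \<zero>) \<oplus> (\<Oplus>w\<in>?W. if act w y = Some x then g w else \<zero>)"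
    using coef_superset[OF f W] coef_superset[OF g W] by simp
  also have "\<dots> = (\<Oplus>w\<in>?W. (if act w y = Some x then f w else \<zero>) \<oplus> (if act w y = Some x then g w else \<zero>))"
    by (rule finsum_addf[symmetric]) (use F_valueD[OF f] F_valueD[OF g] in auto)
  also have "\<dots> = (\<Oplus>w\<in>?W. if act w y = Some x then (f \<oplus>\<^bsub>F\<^esub> g) w else \<zero>)"
    by (rule finsum_cong') (use F_valueD[OF f] F_valueD[OF g] in \<open>auto simp: F_simps(3)\<close>)
  also have "\<dots> = coef (f \<oplus>\<^bsub>F\<^esub> g) x y"
    by (rule coef_superset[symmetric, OF _ W sub]) (use f g in simp)
  finally show ?thesis ..
qed

lemma coef_smult:
  assumes r: "r \<in> carrier R" and f: "f \<in> carrier F"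
  shows "coef (r \<odot>\<^bsub>F\<^esub> f) x y = r \<otimes> coef f x y"
proof -
  let ?W = "{w. f w \<noteq> \<zero>}"
  have W: "finite ?W" using f by (simp add: F_simps)
  have sub: "{w. (r \<odot>\<^bsub>F\<^esub> f) w \<noteq> \<zero>} \<subseteq> ?W" using r by (auto simp: F_simps)
  have "r \<otimes> coef f x y = (\<Oplus>w\<in>?W. r \<otimes> (if act w y = Some x then f w else \<zero>))"
    unfolding coef_def by (rule finsum_rdistr) (use W r F_valueD[OF f] in auto)
  also have "\<dots> = (\<Oplus>w\<in>?W. if act w y = Some x then (r \<odot>\<^bsub>F\<^esub> f) w else \<zero>)"
    by (rule finsum_cong') (use r F_valueD[OF f] in \<open>auto simp: F_simps(4)\<close>)
  also have "\<dots> = coef (r \<odot>\<^bsub>F\<^esub> f) x y"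
    by (rule coef_superset[symmetric, OF _ W sub]) (use r f in simp)
  finally show ?thesis ..
qed

lemma coef_zero [simp]: "coef \<zero>\<^bsub>F\<^esub> x y = \<zero>"
  by (simp add: coef_def F_simps)

lemma coef_minus:
  assumes f: "f \<in> carrier F" and g: "g \<in> carrier F"
  shows "coef (f \<ominus>\<^bsub>F\<^esub> g) x y = coef f x y \<ominus> coef g x y"
proof -
  have "f \<ominus>\<^bsub>F\<^esub> g = f \<oplus>\<^bsub>F\<^esub> (\<ominus> \<one>) \<odot>\<^bsub>F\<^esub> g"
    using g by (simp add: a_minus_def F.smult_l_minus)
  then show ?thesis using f g by (simp add: coef_add coef_smult a_minus_def l_minus)
qed

lemma coef_finsum:
  assumes "finite I" "f \<in> I \<rightarrow> carrier F"
  shows "coef (\<Oplus>\<^bsub>F\<^esub>i\<in>I. f i) x y = (\<Oplus>i\<in>I. coef (f i) x y)"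
  using assms by (induction I) (auto simp: coef_add Pi_def F.M.finsum_closed)

lemma coef_word_mono:
  assumes "w \<noteq> []" "set w \<subseteq> lgens E"
  shows "coef (word_mono R w) x y = (if act w y = Some x then \<one> else \<zero>)"
proof -
  have "coef (word_mono R w) x y = (\<Oplus>u\<in>{w}. if act u y = Some x then word_mono R w u else \<zero>)"
    by (rule coef_superset[OF word_mono_closed[OF assms]]) (auto simp: word_mono_def)
  then show ?thesis by (simp add: word_mono_def)
qed

text \<open>Matrix multiplication in which row \<open>x\<close> of the generator has its single
  entry at \<open>z\<close>; an empty row is the case of \<open>coef_gen_mult_zero\<close>.\<close>

lemma coef_gen_mult:
  assumes a: "a \<in> lgens E" and f: "f \<in> carrier F" and z: "act1 a z = Some x"
  shows "coef (free_gen R a \<otimes>\<^bsub>F\<^esub> f) x y = coef f z y"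
proof -
  have "carrier F \<subseteq> {f \<in> carrier F. coef (free_gen R a \<otimes>\<^bsub>F\<^esub> f) x y = coef f z y}"
  proof (rule F_spanned)
    show "submodule {f \<in> carrier F. coef (free_gen R a \<otimes>\<^bsub>F\<^esub> f) x y = coef f z y} R F"
      by (rule F.submoduleI')
        (use free_gen_closed[OF a] in \<open>auto simp: F.A_r_distr F.smult_r_assoc coef_add coef_smult\<close>)
    fix w :: "('v, 'e) lgen list" assume w: "w \<noteq> []" "set w \<subseteq> lgens E"
    have "act (a # w) y = Some x \<longleftrightarrow> act w y = Some z"
      using z act1_inj by (auto simp: bind_eq_Some_conv)
    then show "word_mono R w \<in> {f \<in> carrier F. coef (free_gen R a \<otimes>\<^bsub>F\<^esub> f) x y = coef f z y}"
      using w a by (simp add: free_gen_word_mono word_mono_mult coef_word_mono del: act.simps)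
  qed
  then show ?thesis using f by auto
qed

lemma coef_gen_mult_zero:
  assumes a: "a \<in> lgens E" and f: "f \<in> carrier F" and z: "\<And>z. act1 a z \<noteq> Some x"
  shows "coef (free_gen R a \<otimes>\<^bsub>F\<^esub> f) x y = \<zero>"
proof -
  have "carrier F \<subseteq> {f \<in> carrier F. coef (free_gen R a \<otimes>\<^bsub>F\<^esub> f) x y = \<zero>}"
  proof (rule F_spanned)
    show "submodule {f \<in> carrier F. coef (free_gen R a \<otimes>\<^bsub>F\<^esub> f) x y = \<zero>} R F"
      by (rule F.submoduleI')
        (use free_gen_closed[OF a] in \<open>auto simp: F.A_r_distr F.smult_r_assoc coef_add coef_smult\<close>)
    fix w :: "('v, 'e) lgen list" assume w: "w \<noteq> []" "set w \<subseteq> lgens E"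
    have "act (a # w) y \<noteq> Some x" using z by (auto simp: bind_eq_Some_conv)
    then show "word_mono R w \<in> {f \<in> carrier F. coef (free_gen R a \<otimes>\<^bsub>F\<^esub> f) x y = \<zero>}"
      using w a by (simp add: free_gen_word_mono word_mono_mult coef_word_mono del: act.simps)
  qed
  then show ?thesis using f by auto
qed

text \<open>The dual statement for columns: column \<open>y\<close> of a generator has at most one
  entry, at the image of \<open>y\<close>.\<close>

lemma coef_mult_gen:
  assumes a: "a \<in> lgens E" and f: "f \<in> carrier F"
  shows "coef (f \<otimes>\<^bsub>F\<^esub> free_gen R a) x y =
    (case act1 a y of None \<Rightarrow> \<zero> | Some z \<Rightarrow> coef f x z)" (is "_ = ?c f")
proof -
  have "carrier F \<subseteq> {f \<in> carrier F. coef (f \<otimes>\<^bsub>F\<^esub> free_gen R a) x y = ?c f}"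
  proof (rule F_spanned)
    show "submodule {f \<in> carrier F. coef (f \<otimes>\<^bsub>F\<^esub> free_gen R a) x y = ?c f} R F"
      by (rule F.submoduleI')
        (use free_gen_closed[OF a] in
          \<open>auto simp: F.A_l_distr F.smult_l_assoc coef_add coef_smult split: option.split\<close>)
    fix w :: "('v, 'e) lgen list" assume w: "w \<noteq> []" "set w \<subseteq> lgens E"
    then show "word_mono R w \<in> {f \<in> carrier F. coef (f \<otimes>\<^bsub>F\<^esub> free_gen R a) x y = ?c f}"
      using a by (simp add: free_gen_word_mono word_mono_mult coef_word_mono act_append split: option.split)
  qed
  then show ?thesis using f by auto
qed

text \<open>
  An increasing family \<open>D\<close> of ideals along the edges yields, in the limit, a representation on
  \<open>\<Oplus>\<^sub>y R / lim D y\<close>; \<open>annih D\<close> is its kernel in the free algebra.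
\<close>

definition lim_ideal :: "('v \<Rightarrow> 'a set) \<Rightarrow> (nat \<Rightarrow> 'e) \<Rightarrow> 'a set" where
  "lim_ideal D y = (\<Union>i. D (head E (y i)))"

definition annih :: "('v \<Rightarrow> 'a set) \<Rightarrow> (('v, 'e) lgen list \<Rightarrow> 'a) set" where
  "annih D = {f \<in> carrier F. \<forall>x. \<forall>y \<in> inf_paths. coef f x y \<in> lim_ideal D y}"

definition increasing :: "('v \<Rightarrow> 'a set) \<Rightarrow> bool" where
  "increasing D \<longleftrightarrow> (\<forall>v \<in> verts E. ideal (D v) R) \<and> (\<forall>e \<in> arcs E. D (head E e) \<subseteq> D (tail E e))"

lemma lim_ideal_closed:
  assumes D: "increasing D" and y: "y \<in> inf_paths"
  shows "\<zero> \<in> lim_ideal D y"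
    and "\<lbrakk>a \<in> lim_ideal D y; b \<in> lim_ideal D y\<rbrakk> \<Longrightarrow> a \<oplus> b \<in> lim_ideal D y"
    and "\<lbrakk>r \<in> carrier R; a \<in> lim_ideal D y\<rbrakk> \<Longrightarrow> r \<otimes> a \<in> lim_ideal D y"
proof -
  have id: "ideal (D (head E (y i))) R" for i
    using D y by (simp add: increasing_def inf_paths_def)
  have "D (head E (y i)) \<subseteq> D (head E (y (Suc i)))" for i
  proof -
    have "y i \<in> arcs E" "head E (y (Suc i)) = tail E (y i)" using y by (auto simp: inf_paths_def)
    then show ?thesis using D by (simp add: increasing_def)
  qed
  then have mono: "i \<le> j \<Longrightarrow> D (head E (y i)) \<subseteq> D (head E (y j))" for i j
    by (rule lift_Suc_mono_le)
  show "\<zero> \<in> lim_ideal D y"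
    using additive_subgroup.zero_closed[OF ideal.axioms(1)[OF id]] by (auto simp: lim_ideal_def)
  show "r \<otimes> a \<in> lim_ideal D y" if "r \<in> carrier R" "a \<in> lim_ideal D y"
    using that ideal.I_l_closed[OF id] by (auto simp: lim_ideal_def)
  assume "a \<in> lim_ideal D y" "b \<in> lim_ideal D y"
  then obtain i j where "a \<in> D (head E (y i))" "b \<in> D (head E (y j))" by (auto simp: lim_ideal_def)
  then have "a \<in> D (head E (y (max i j)))" "b \<in> D (head E (y (max i j)))"
    using mono[of i "max i j"] mono[of j "max i j"] by auto
  then have "a \<oplus> b \<in> D (head E (y (max i j)))"
    by (rule additive_subgroup.a_closed[OF ideal.axioms(1)[OF id]])
  then show "a \<oplus> b \<in> lim_ideal D y" by (auto simp: lim_ideal_def)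
qed

text \<open>Deleting an edge only drops a member of the union. Prepending \<open>e\<close> adds the
  ideal at \<open>head E e\<close>, which lies in the ideal at \<open>tail E e\<close>, the range of
  \<open>y\<close>.\<close>

lemma lim_ideal_act1:
  assumes D: "increasing D" and y: "y \<in> inf_paths" and a: "a \<in> lgens E" "act1 a y = Some z"
  shows "lim_ideal D z \<subseteq> lim_ideal D y"
proof
  fix r assume "r \<in> lim_ideal D z"
  then obtain i where i: "r \<in> D (head E (z i))" by (auto simp: lim_ideal_def)
  show "r \<in> lim_ideal D y"
  proof (cases a)
    case (Vertex v)
    then show ?thesis using a i by (auto simp: lim_ideal_def split: if_splits)
  next
    case (Ghost e)
    then show ?thesis using a i by (auto simp: lim_ideal_def split: if_splits)
  next
    case (Edge e)
    then have e: "e \<in> arcs E" "tail E e = head E (y 0)" "z = case_nat e y"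
      using a by (auto split: if_splits)
    show ?thesis
    proof (cases i)
      case 0
      then have "r \<in> D (head E e)" using i e(3) by simp
      then have "r \<in> D (tail E e)" using D e(1) by (auto simp: increasing_def)
      then have "r \<in> D (head E (y 0))" using e(2) by simp
      then show ?thesis by (auto simp: lim_ideal_def)
    next
      case (Suc j)
      then show ?thesis using i e by (auto simp: lim_ideal_def)
    qed
  qed
qed

text \<open>Left multiplication rearranges the entries within a column and keeps its limit ideal.
  Right multiplication replaces column \<open>y\<close> by column \<open>z\<close>, whose limit
  ideal is contained in that of \<open>y\<close> by \<open>lim_ideal_act1\<close>.\<close>

lemma annih_alg_ideal:
  assumes D: "increasing D"
  shows "alg_ideal (annih D) R F"
proof (rule F.alg_ideal_generators[where X = "free_gen R ` lgens E"])
  show "submodule (annih D) R F"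
    by (rule F.submoduleI') (auto simp: annih_def coef_add coef_smult lim_ideal_closed[OF D])
  show "free_gen R ` lgens E \<subseteq> carrier F" using free_gen_closed by blast
  show "carrier F \<subseteq> B" if "submodule B R F" "free_gen R ` lgens E \<subseteq> B"
    "\<And>x b. x \<in> free_gen R ` lgens E \<Longrightarrow> b \<in> B \<Longrightarrow> x \<otimes>\<^bsub>F\<^esub> b \<in> B" for B
    by (rule F_generated[OF that(1)]) (use that(2,3) in auto)
  fix f g assume f: "f \<in> annih D" and "g \<in> free_gen R ` lgens E"
  then obtain a where a: "a \<in> lgens E" "g = free_gen R a" by auto
  have fF: "f \<in> carrier F" and fc: "\<And>x y. y \<in> inf_paths \<Longrightarrow> coef f x y \<in> lim_ideal D y"
    using f by (auto simp: annih_def)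
  have "coef (g \<otimes>\<^bsub>F\<^esub> f) x y \<in> lim_ideal D y" if y: "y \<in> inf_paths" for x y
  proof (cases "\<exists>z. act1 a z = Some x")
    case True
    then obtain z where "act1 a z = Some x" by blast
    then show ?thesis using coef_gen_mult[OF a(1) fF] fc[OF y] a(2) by simp
  next
    case False
    then show ?thesis
      using coef_gen_mult_zero[OF a(1) fF] a(2) lim_ideal_closed(1)[OF D y] by simp
  qed
  then show "g \<otimes>\<^bsub>F\<^esub> f \<in> annih D"
    using fF free_gen_closed[OF a(1)] a(2) by (simp add: annih_def)
  have "coef (f \<otimes>\<^bsub>F\<^esub> g) x y \<in> lim_ideal D y" if y: "y \<in> inf_paths" for x y
  proof (cases "act1 a y")
    case None
    then show ?thesis
      using coef_mult_gen[OF a(1) fF] a(2) lim_ideal_closed(1)[OF D y] by simp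
  next
    case (Some z)
    then show ?thesis
      using coef_mult_gen[OF a(1) fF] a(2) fc[OF act1_inf_paths[OF a(1) y Some]]
        lim_ideal_act1[OF D y a(1) Some] by auto
  qed
  then show "f \<otimes>\<^bsub>F\<^esub> g \<in> annih D"
    using fF free_gen_closed[OF a(1)] a(2) by (simp add: annih_def)
qed

text \<open>The relations hold for the action itself, before any reduction modulo ideals, so the
  same computation puts the kernel into \<open>annih D\<close> for every increasing
  \<open>D\<close>.\<close>

lemma coef_relator:
  assumes y: "y \<in> inf_paths" and f: "f \<in> leavitt_relators R E"
  shows "coef f x y = \<zero>"
proof -
  have y0: "y 0 \<in> arcs E" "tail E (y 0) = head E (y (Suc 0))" using y by (auto simp: inf_paths_def)
  note word = free_gen_word_mono word_mono_mult coef_word_mono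
  have rr: "r \<in> carrier R \<Longrightarrow> r \<ominus> r = \<zero>" for r by (simp add: a_minus_def r_neg)
  from f show ?thesis
  proof (cases rule: relators_cases)
    case (CK v)
    have "coef (\<Oplus>\<^bsub>F\<^esub>e \<in> in_arcs E v. S e \<otimes>\<^bsub>F\<^esub> T e) x y = (\<Oplus>e \<in> in_arcs E v. coef (S e \<otimes>\<^bsub>F\<^esub> T e) x y)"
      by (rule coef_finsum) (use CK(1) in auto)
    \<comment> \<open>The product of \<open>S e\<close> and \<open>T e\<close> deletes
      \<open>e\<close> and restores it, hence fixes the paths that begin with \<open>e\<close> and
      kills the others. A path with range \<open>v\<close> begins with exactly one edge of the
      sum.\<close>
    also have "\<dots> = (\<Oplus>e \<in> in_arcs E v. if y 0 = e then (if x = y then \<one> else \<zero>) else \<zero>)"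
      by (rule finsum_cong') (auto simp: word case_nat_shift y0)
    also have "\<dots> = coef (P v) x y"
    proof (cases "y 0 \<in> in_arcs E v")
      case True
      have "(\<Oplus>e \<in> in_arcs E v. if y 0 = e then (if x = y then \<one> else \<zero>) else \<zero>) = (if x = y then \<one> else \<zero>)"
        by (rule finsum_singleton) (use True CK(1) in auto)
      then show ?thesis using True CK(1) by (simp add: word)
    next
      case False
      have "(\<Oplus>e \<in> in_arcs E v. if y 0 = e then (if x = y then \<one> else \<zero>) else \<zero>) = \<zero>"
        by (rule add.finprod_one_eqI) (use False in auto)
      then show ?thesis using False CK(1) y0(1) by (simp add: word)
    qed
    finally have "coef f x y = coef (P v) x y \<ominus> coef (P v) x y"
      unfolding CK(2) using CK(1) by (subst coef_minus) (auto intro: F.M.finsum_closed)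
    then show ?thesis using CK(1) rr by simp
  qed (use y0 in \<open>auto simp: coef_minus word case_nat_shift rr\<close>)
qed

lemma kernel_annih: "increasing D \<Longrightarrow> Ker \<subseteq> annih D"
  by (rule kernel_least[OF annih_alg_ideal])
    (use relators_in_F coef_relator lim_ideal_closed(1) in \<open>auto simp: annih_def\<close>)

lemma annih_image:
  assumes D: "increasing D"
  shows "rng_ideal (q ` annih D) L" "submodule (q ` annih D) R L"
  using quot.q_image_alg_ideal[OF annih_alg_ideal[OF D], folded lpa_quot]
  by (auto simp: alg_ideal_def)

lemma q_mem_annih_image:
  assumes D: "increasing D" and f: "f \<in> carrier F"
  shows "q f \<in> q ` annih D \<longleftrightarrow> f \<in> annih D"
  using quot.q_mem_image_iff[OF _ kernel_annih[OF D] f] annih_alg_ideal[OF D]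
  by (simp add: alg_ideal_def)

section \<open>Upper bounds through the representation and recovery of the function\<close>

lemma coef_P: "v \<in> verts E \<Longrightarrow> coef (P v) x y = (if x = y \<and> head E (y 0) = v then \<one> else \<zero>)"
  by (auto simp: free_gen_word_mono coef_word_mono)

text \<open>The limit ideal is everything for paths that meet \<open>H\<close> and zero for the
  others, so \<open>annih\<close> of this family consists of the elements whose columns vanish at
  all infinite paths avoiding \<open>H\<close>.\<close>

definition support_family :: "'v set \<Rightarrow> 'v \<Rightarrow> 'a set" where
  "support_family H v = (if v \<in> H then carrier R else {\<zero>})"

lemma support_family_increasing:
  assumes "H \<in> sat_hered E"
  shows "increasing (support_family H)"
  using sat_heredD(2)[OF assms] oneideal zeroideal
  by (auto simp: increasing_def support_family_def)

lemma vertex_ideal_annih: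
  assumes H: "H \<in> sat_hered E"
  shows "vertex_ideal R E H \<subseteq> q ` annih (support_family H)"
  unfolding vertex_ideal_def
proof (rule rng_genideal_least[OF annih_image(1)[OF support_family_increasing[OF H]]], rule subsetI)
  fix x assume "x \<in> {p v | v. v \<in> H}"
  then obtain v where v: "v \<in> H" "x = p v" by auto
  have vE: "v \<in> verts E" using v sat_heredD(1)[OF H] by auto
  have "P v \<in> annih (support_family H)"
    using vE v(1) lim_ideal_closed(1)[OF support_family_increasing[OF H]]
    by (auto simp: annih_def coef_P lim_ideal_def support_family_def intro!: exI[of _ 0])
  then show "x \<in> q ` annih (support_family H)" using v(2) gen_q by blast
qed

definition hull_family :: "('v set \<Rightarrow> 'a set) \<Rightarrow> 'v \<Rightarrow> 'a set" where
  "hull_family \<pi> v = \<pi> (hull1 v)"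

lemma hull_family_increasing:
  assumes \<pi>: "\<pi> \<in> ideal_functions R E"
  shows "increasing (hull_family \<pi>)"
  unfolding increasing_def hull_family_def
proof (intro conjI ballI)
  show "ideal (\<pi> (hull1 v)) R" if "v \<in> verts E" for v
    using ideal_functionsD(1)[OF \<pi> hull1_sat_hered[OF that]] .
  fix e assume e: "e \<in> arcs E"
  have hd: "hull1 (head E e) \<in> sat_hered E" using e by (intro hull1_sat_hered) simp
  have "hull1 (tail E e) \<subseteq> hull1 (head E e)"
    by (rule hull1_least[OF hd sat_heredD(2)[OF hd e hull1_mem]])
  then show "\<pi> (hull1 (head E e)) \<subseteq> \<pi> (hull1 (tail E e))"
    using ideal_function_antimono[OF \<pi> hull1_sat_hered hd] e by simp
qed

text \<open>Let \<open>r \<in> \<pi> H\<close> and let \<open>m\<close> lie in the vertex ideal of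
  \<open>H\<close>. A column of \<open>m\<close> at a path avoiding \<open>H\<close> is zero. A path
  meeting \<open>H\<close> at \<open>u\<close> has \<open>hull1 u \<subseteq> H\<close>, so
  antitonicity puts \<open>r\<close> into the limit ideal of the path.\<close>

lemma Gamma_ideal_annih:
  assumes \<pi>: "\<pi> \<in> ideal_functions R E"
  shows "Gamma_ideal R E \<pi> \<subseteq> q ` annih (hull_family \<pi>)"
  unfolding Gamma_ideal_def
proof (rule span_of_least[OF annih_image(2)[OF hull_family_increasing[OF \<pi>]]], rule subsetI)
  fix b assume "b \<in> Gamma_set \<pi>"
  then obtain r m H where b: "b = r \<odot>\<^bsub>L\<^esub> m" and H: "H \<in> sat_hered E" "r \<in> \<pi> H" "m \<in> vertex_ideal R E H"
    by blast
  have r: "r \<in> carrier R" using ideal_function_carrier[OF \<pi> H(1,2)] .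
  have "m \<in> q ` annih (support_family H)" using H(3) vertex_ideal_annih[OF H(1)] by (rule subsetD[rotated])
  then obtain f where f: "f \<in> annih (support_family H)" "m = q f" by auto
  have fF: "f \<in> carrier F" using f(1) by (simp add: annih_def)
  have "r \<otimes> coef f x y \<in> lim_ideal (hull_family \<pi>) y" if y: "y \<in> inf_paths" for x y
  proof -
    have "coef f x y \<in> lim_ideal (support_family H) y" using f(1) y by (simp add: annih_def)
    then obtain i where i: "coef f x y \<in> support_family H (head E (y i))" by (auto simp: lim_ideal_def)
    show ?thesis
    proof (cases "head E (y i) \<in> H")
      case True
      have hi: "hull1 (head E (y i)) \<in> sat_hered E" using True sat_heredD(1)[OF H(1)] hull1_sat_hered by auto
      have "r \<in> \<pi> (hull1 (head E (y i)))"
        using ideal_function_antimono[OF \<pi> hi H(1) hull1_least[OF H(1) True]] H(2) by auto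
      then have "r \<otimes> coef f x y \<in> \<pi> (hull1 (head E (y i)))"
        using ideal.I_r_closed[OF ideal_functionsD(1)[OF \<pi> hi]] fF by simp
      then show ?thesis by (auto simp: lim_ideal_def hull_family_def)
    next
      case False
      then have "coef f x y = \<zero>" using i by (simp add: support_family_def)
      then show ?thesis using r lim_ideal_closed(1)[OF hull_family_increasing[OF \<pi>] y] by simp
    qed
  qed
  then have "r \<odot>\<^bsub>F\<^esub> f \<in> annih (hull_family \<pi>)"
    using fF r by (simp add: annih_def coef_smult)
  moreover have "b = q (r \<odot>\<^bsub>F\<^esub> f)" using b f(2) r fF by (simp add: q_smult)
  ultimately show "b \<in> q ` annih (hull_family \<pi>)" by blast
qed

text \<open>
  If \<open>r\<close> is not in \<open>\<pi>\<close> of the saturated hereditary set generated by \<open>v\<close>, the compatibility of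
  \<open>\<pi>\<close> with joins produces an infinite path from \<open>v\<close> along which this remains true, so \<open>rp\<^sub>v\<close>
  acts nontrivially.
\<close>

lemma Gamma_ideal_vertex:
  assumes \<pi>: "\<pi> \<in> ideal_functions R E" and v: "v \<in> verts E" and r: "r \<in> carrier R"
    and mem: "r \<odot>\<^bsub>L\<^esub> p v \<in> Gamma_ideal R E \<pi>"
  shows "r \<in> \<pi> (hull1 v)"
proof (rule ccontr)
  assume not: "r \<notin> \<pi> (hull1 v)"
  have next_edge: "\<exists>e. e \<in> arcs E \<and> head E e = u \<and> r \<notin> \<pi> (hull1 (tail E e))"
    if "u \<in> verts E" "r \<notin> \<pi> (hull1 u)" for u
    using ideal_function_hull1_saturated[OF \<pi> that(1) r] that(2) by auto
  \<comment> \<open>The invariant is kept at the tail of the chosen edge, where the next edge is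
    attached; the clause for \<open>n = 0\<close> fixes the range of the path.\<close>
  have "\<exists>y. \<forall>n. (y n \<in> arcs E \<and> r \<notin> \<pi> (hull1 (tail E (y n))) \<and> (n = 0 \<longrightarrow> head E (y n) = v)) \<and>
      head E (y (Suc n)) = tail E (y n)"
  proof (rule dependent_nat_choice)
    show "\<exists>e. e \<in> arcs E \<and> r \<notin> \<pi> (hull1 (tail E e)) \<and> (0 = 0 \<longrightarrow> head E e = v)"
      using next_edge[OF v not] by blast
    show "\<exists>e'. (e' \<in> arcs E \<and> r \<notin> \<pi> (hull1 (tail E e')) \<and> (Suc n = 0 \<longrightarrow> head E e' = v)) \<and> head E e' = tail E e"
      if "e \<in> arcs E \<and> r \<notin> \<pi> (hull1 (tail E e)) \<and> (n = 0 \<longrightarrow> head E e = v)" for e n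
      using next_edge[of "tail E e"] that by auto
  qed
  then obtain y where y: "\<And>n. y n \<in> arcs E" "\<And>n. r \<notin> \<pi> (hull1 (tail E (y n)))" "head E (y 0) = v"
    "\<And>n. head E (y (Suc n)) = tail E (y n)" by blast
  have yinf: "y \<in> inf_paths" using y by (simp add: inf_paths_def)
  have F: "r \<odot>\<^bsub>F\<^esub> P v \<in> carrier F" using v r by simp
  have "q (r \<odot>\<^bsub>F\<^esub> P v) \<in> q ` annih (hull_family \<pi>)"
    using mem Gamma_ideal_annih[OF \<pi>] v r by (auto simp: gen_q q_smult)
  then have "r \<odot>\<^bsub>F\<^esub> P v \<in> annih (hull_family \<pi>)"
    using q_mem_annih_image[OF hull_family_increasing[OF \<pi>] F] by simp
  then have "coef (r \<odot>\<^bsub>F\<^esub> P v) y y \<in> lim_ideal (hull_family \<pi>) y" using yinf by (simp add: annih_def)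
  then have "r \<in> lim_ideal (hull_family \<pi>) y" using v r y(3) by (simp add: coef_smult coef_P)
  then obtain i where "r \<in> \<pi> (hull1 (head E (y i)))" by (auto simp: lim_ideal_def hull_family_def)
  \<comment> \<open>The head of edge \<open>0\<close> is \<open>v\<close>, covered by
    \<open>not\<close>; every later head is the tail of the preceding edge, covered by the
    invariant.\<close>
  then show False using not y by (cases i) auto
qed

text \<open>That no scalar is gained follows vertex by vertex from \<open>Gamma_ideal_vertex\<close>
  and is reassembled by \<open>ideal_function_Inter_hull1\<close>. That none is lost is seen on
  paths of length zero, whose product is \<open>p v\<close>.\<close>

lemma ideal_function_of_Gamma:
  assumes \<pi>: "\<pi> \<in> ideal_functions R E"
  shows "ideal_function_of (Gamma_ideal R E \<pi>) = \<pi>"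
proof (rule extensionalityI[where A = "sat_hered E"])
  show "ideal_function_of (Gamma_ideal R E \<pi>) \<in> extensional (sat_hered E)"
    by (simp add: ideal_function_of_def)
  show "\<pi> \<in> extensional (sat_hered E)" using ideal_functionsD(3)[OF \<pi>] .
  fix H assume H: "H \<in> sat_hered E"
  have HE: "H \<subseteq> verts E" by (rule sat_heredD(1)[OF H])
  have "r \<in> \<pi> H" if r: "r \<in> carrier R" "\<forall>v \<in> H. r \<odot>\<^bsub>L\<^esub> p v \<in> Gamma_ideal R E \<pi>" for r
    by (rule ideal_function_Inter_hull1[OF \<pi> H r(1)])
      (use Gamma_ideal_vertex[OF \<pi> _ r(1)] HE r(2) in auto)
  moreover have "r \<odot>\<^bsub>L\<^esub> p v \<in> Gamma_ideal R E \<pi>" if r: "r \<in> \<pi> H" and v: "v \<in> H" for r v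
  proof -
    have vE: "v \<in> verts E" using v HE by auto
    then have path: "(v, []) \<in> fin_paths E" by (simp add: fin_paths_def)
    have pv: "lpa_path R E (v, []) \<otimes>\<^bsub>L\<^esub> lpa_ghost R E (v, []) = p v" using vE by simp
    have "p v \<in> vertex_ideal R E H"
      unfolding vertex_ideal_def using v by (intro rng_genideal_base) blast
    then have "r \<odot>\<^bsub>L\<^esub> (lpa_path R E (v, []) \<otimes>\<^bsub>L\<^esub> lpa_ghost R E (v, [])) \<in> Gamma_set \<pi>"
      using path H r unfolding pv[symmetric] by blast
    then show ?thesis unfolding pv Gamma_ideal_def by (rule span_of_base)
  qed
  ultimately show "ideal_function_of (Gamma_ideal R E \<pi>) H = \<pi> H"
    using H ideal_function_carrier[OF \<pi> H] by (auto simp: ideal_function_of_def)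
qed

lemma Gamma_ideal_mono:
  assumes "\<And>H. H \<in> sat_hered E \<Longrightarrow> \<pi>1 H \<subseteq> \<pi>2 H"
  shows "Gamma_ideal R E \<pi>1 \<subseteq> Gamma_ideal R E \<pi>2"
  unfolding Gamma_ideal_def by (rule span_of_mono) (use assms in blast)

lemma ideal_function_of_mono:
  assumes "I \<subseteq> I'" "H \<in> sat_hered E"
  shows "ideal_function_of I H \<subseteq> ideal_function_of I' H"
  using assms by (auto simp: ideal_function_of_def)

end

theorem theorem6p1:
  fixes E :: "('v, 'e) pre_digraph" and R :: "('r, 'n) ring_scheme"
  assumes "wf_digraph E" and "row_finite E" and "no_sources E"
    and "cring R"
    and "condition_K E"
  shows
    "(\<forall>I. rng_ideal I (lpa R E) \<longrightarrow>
        I = span_of R (lpa R E)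
              {r \<odot>\<^bsub>lpa R E\<^esub> (lpa_path R E \<kappa> \<otimes>\<^bsub>lpa R E\<^esub> lpa_ghost R E \<mu>) | r \<kappa> \<mu>.
                 r \<in> carrier R \<and> \<kappa> \<in> fin_paths E \<and> \<mu> \<in> fin_paths E \<and>
                 r \<odot>\<^bsub>lpa R E\<^esub> lpa_gen R E (Vertex (path_source E \<mu>)) \<in> I})
     \<and> bij_betw (Gamma_ideal R E) (ideal_functions R E) {I. rng_ideal I (lpa R E)}
     \<and> (\<forall>\<pi>1 \<in> ideal_functions R E. \<forall>\<pi>2 \<in> ideal_functions R E.
          Gamma_ideal R E \<pi>1 \<subseteq> Gamma_ideal R E \<pi>2 \<longleftrightarrow>
          (\<forall>H \<in> sat_hered E. \<pi>1 H \<subseteq> \<pi>2 H))"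
proof -
  interpret leavitt R E
    by (intro leavitt.intro leavitt_axioms.intro assms)
  show ?thesis
  proof (intro conjI allI impI ballI)
    fix I assume "rng_ideal I L"
    then show "I = span_of R L (ideal_spanning_set I)" by (rule ideal_spanned[OF assms(5)])
  next
    show "bij_betw (Gamma_ideal R E) (ideal_functions R E) {I. rng_ideal I L}"
      by (rule bij_betw_byWitness[where f' = ideal_function_of])
        (auto simp: ideal_function_of_Gamma Gamma_ideal_function_of[OF assms(5)]
          Gamma_ideal_rng_ideal ideal_function_of_mem)
  next
    fix \<pi>1 \<pi>2 assume \<pi>: "\<pi>1 \<in> ideal_functions R E" "\<pi>2 \<in> ideal_functions R E"
    \<comment> \<open>Both \<open>Gamma_ideal\<close> and its inverse are monotone, which gives the
      two directions.\<close>
    show "Gamma_ideal R E \<pi>1 \<subseteq> Gamma_ideal R E \<pi>2 \<longleftrightarrow> (\<forall>H \<in> sat_hered E. \<pi>1 H \<subseteq> \<pi>2 H)"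
      using ideal_function_of_mono[of "Gamma_ideal R E \<pi>1" "Gamma_ideal R E \<pi>2"]
        Gamma_ideal_mono[of \<pi>1 \<pi>2] ideal_function_of_Gamma[OF \<pi>(1)] ideal_function_of_Gamma[OF \<pi>(2)]
      by auto
  qed
qed

end
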